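(* Let $k\in\mathbb{N}$ and let $\mathcal{R}_1$ and $\mathcal{R}_2$ be rules of the same order $k$. The following are equivalent. (S1) For all $J\in\mathcal{J}_k$ we have $q_{J,\mathcal{R}_1}=q_{J,\mathcal{R}_2}$. (S2) $\mathfrak{V}_{\mathcal{R}_1}=\mathfrak{V}_{\mathcal{R}_2}$ on $\mathcal{W}_0$. (S3) $\mathfrak{V}_{\mathcal{R}_1}=\mathfrak{V}_{\mathcal{R}_2}$ on $\mathcal{W}$. (S4) $\mathcal{R}_1$ and $\mathcal{R}_2$ have the same trajectories.
   Context: $\mathbb{N}$ is the set of positive integers and $[k]=\{1,\dots,k\}$. Graphs are finite, simple and undirected. $\mathbb{I}_{\{\cdot\}}$ denotes an indicator. Rules. For $k\in\mathbb{N}$, $\mathcal{H}_k$ is the set of all labelled graphs on vertex set $[k]$. A rule of order $k$ is a matrix $\mathcal{R}=(\mathcal{R}_{F,H})_{F,H\in\mathcal{H}_k}\in[0,1]^{\mathcal{H}_k\times\mathcal{H}_k}$ such that $\sum_{H\in\mathcal{H}_k}\mathcal{R}_{F,H}=1$ for every $F\in\mathcal{H}_k$. Rooted graphs. $\mathcal{G}_k=\mathcal{H}_k\times\{(a,b)\in[k]^2:a\neq b\}$; its element $(F,(a,b))$ is written $F^{a,b}$. Two elements $F^{a,b},G^{c,d}\in\mathcal{G}_k$ are isomorphic if there is a bijection $\phi:[k]\to[k]$ with $uv\in E(F)\iff\phi(u)\phi(v)\in E(G)$ for all $u,v$, $\phi(a)=c$ and $\phi(b)=d$. $\mathcal{J}_k$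 is the set of isomorphism classes of $\mathcal{G}_k$. (For $k=1$ these sets are empty.) For $J\in\mathcal{J}_k$ and a rule $\mathcal{R}$ of order $k$, $$q_{J,\mathcal{R}}=\sum_{F^{a,b}\in J}\Big(\sum_{H\in\mathcal{H}_k}\mathcal{R}_{F,H}\cdot\mathbb{I}_{\{ab\in E(H)\}}-\mathbb{I}_{\{ab\in E(F)\}}\Big).$$ Kernels and graphons. $(\Omega,\pi)$ is a fixed atomless probability space with a separable sigma-algebra. $\mathcal{W}\subseteq L^\infty(\Omega^2)$ is the set of kernels, i.e. bounded symmetric measurable real-valued functions on $\Omega^2$, with the norm $\|\cdot\|_\infty$. $\mathcal{W}_0\subseteq\mathcal{W}$ is the set of graphons, i.e. kernels with values in $[0,1]$. Velocity. For $F^{a,b}\in\mathcal{G}_k$ and $W\in\mathcal{W}$, $$T_{F^{a,b}}W(x,y)=\int\prod_{ij\in E(F)}W(x_i,x_j)\prod_{ij\notin E(F)}(1-W(x_i,x_j))\,\mathrm{d}\pi^{[k]\setminus\{a,b\}},$$ where the products are over unordered pairs $ij$ of distinct vertices in $[k]$, $x_a=x$ and $x_b=y$ are fixed, and the integral is over $(x_i)_{i\in[k]\setminus\{a,b\}}$. The velocity operator of a rule $\mathcal{R}$ of order $k$ is $\mathfrak{V}_{\mathcal{R}}:\mathcal{W}\to\mathcal{W}$, $$\mathfrak{V}_{\mathcal{R}}W=\sum_{F^{a,b}\in\mathcal{G}_k}\Big(\sum_{H\in\mathcal{H}_k}\mathcal{R}_{F,H}\mathbb{I}_{\{ab\in E(H)\}}-\mathbb{I}_{\{ab\in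 E(F)\}}\Big)T_{F^{a,b}}W.$$ Trajectories. A trajectory of $\mathcal{R}$ starting at $W\in\mathcal{W}$ is a differentiable function $\Phi_{\mathcal{R}}^{\cdot}W:I\to(\mathcal{W},\|\cdot\|_\infty)$ on an open interval $I\subseteq\mathbb{R}$ containing $0$ with $\frac{\mathrm{d}}{\mathrm{d}t}\Phi_{\mathcal{R}}^tW=\mathfrak{V}_{\mathcal{R}}\Phi_{\mathcal{R}}^tW$ and $\Phi_{\mathcal{R}}^0W=W$. It is known that for every rule $\mathcal{R}$ and kernel $W$ there is a trajectory starting at $W$ with maximal open interval domain $\mathcal{D}_{\mathcal{R},W}$ such that every other trajectory starting at $W$ is its restriction to a subinterval; $\Phi_{\mathcal{R}}^{\cdot}W$ denotes this maximal trajectory. (It is also known that if $W\in\mathcal{W}_0$ then $\{t\in\mathcal{D}_{\mathcal{R},W}:\Phi_{\mathcal{R}}^tW\in\mathcal{W}_0\}$ is a closed interval containing $[0,\infty)$.) Rules $\mathcal{R}_1,\mathcal{R}_2$ have the same trajectories if for all $W\in\mathcal{W}$ we have $\mathcal{D}_{\mathcal{R}_1,W}=\mathcal{D}_{\mathcal{R}_2,W}$ and $\Phi_{\mathcal{R}_1}^tW=\Phi_{\mathcal{R}_2}^tW$ for all $t\in\mathcal{D}_{\mathcal{R}_1,W}$. *)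

theory Defs
  imports "HOL-Probability.Probability"
begin

text \<open>A labelled graph on \<open>{1..k}\<close> is represented by its set of edges, each edge being a
  two-element set of vertices.\<close>

type_synonym lgraph = "nat set set"
type_synonym rooted = "lgraph \<times> nat \<times> nat"
type_synonym rule = "lgraph \<Rightarrow> lgraph \<Rightarrow> real"

definition labelled_graphs :: "nat \<Rightarrow> lgraph set" where
  "labelled_graphs k = Pow {{u, v} | u v. u \<in> {1..k} \<and> v \<in> {1..k} \<and> u \<noteq> v}"

text \<open>Only the entries of \<open>R\<close> indexed by graphs on \<open>{1..k}\<close> carry meaning.\<close>

definition is_rule :: "nat \<Rightarrow> rule \<Rightarrow> bool" where
  "is_rule k R \<longleftrightarrow>
     (\<forall>F\<in>labelled_graphs k. \<forall>H\<in>labelled_graphs k. 0 \<le> R F H \<and> R F H \<le> 1) \<and>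
     (\<forall>F\<in>labelled_graphs k. (\<Sum>H\<in>labelled_graphs k. R F H) = 1)"

definition rooted_graphs :: "nat \<Rightarrow> rooted set" where
  "rooted_graphs k =
     labelled_graphs k \<times> {(a, b). a \<in> {1..k} \<and> b \<in> {1..k} \<and> a \<noteq> b}"

definition rooted_iso :: "nat \<Rightarrow> (rooted \<times> rooted) set" where
  "rooted_iso k =
     {((F, a, b), (G, c, d)) | F a b G c d.
        (F, a, b) \<in> rooted_graphs k \<and> (G, c, d) \<in> rooted_graphs k \<and>
        (\<exists>\<phi>. bij_betw \<phi> {1..k} {1..k} \<and>
             (\<forall>u\<in>{1..k}. \<forall>v\<in>{1..k}. {u, v} \<in> F \<longleftrightarrow> {\<phi> u, \<phi> v} \<in> G) \<and>
             \<phi> a = c \<and> \<phi> b = d)}"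

definition rooted_classes :: "nat \<Rightarrow> rooted set set" where
  "rooted_classes k = rooted_graphs k // rooted_iso k"

definition flip_coeff :: "nat \<Rightarrow> rule \<Rightarrow> rooted \<Rightarrow> real" where
  "flip_coeff k R = (\<lambda>(F, a, b).
     (\<Sum>H\<in>labelled_graphs k. R F H * of_bool ({a, b} \<in> H)) - of_bool ({a, b} \<in> F))"

definition class_coeff :: "nat \<Rightarrow> rule \<Rightarrow> rooted set \<Rightarrow> real" where
  "class_coeff k R J = (\<Sum>X\<in>J. flip_coeff k R X)"

definition atomless :: "'a measure \<Rightarrow> bool" where
  "atomless M \<longleftrightarrow>
     (\<forall>A\<in>sets M. 0 < emeasure M A \<longrightarrow>
        (\<exists>B\<in>sets M. B \<subseteq> A \<and> 0 < emeasure M B \<and> emeasure M B < emeasure M A))"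

text \<open>Separability of the sigma-algebra as a pseudometric space under the measure of the
  symmetric difference. Every countably generated sigma-algebra is separable in this sense.\<close>

definition separable_sigma_algebra :: "'a measure \<Rightarrow> bool" where
  "separable_sigma_algebra M \<longleftrightarrow>
     (\<exists>\<D>. countable \<D> \<and> \<D> \<subseteq> sets M \<and>
        (\<forall>A\<in>sets M. \<forall>\<epsilon>>0. \<exists>D\<in>\<D>. measure M ((A - D) \<union> (D - A)) < \<epsilon>))"

text \<open>Elements of the space \<open>L\<^sup>\<infinity>\<close> over the square of \<open>M\<close> are given by
  representatives: a kernel is a bounded symmetric measurable function, and two kernels are
  identified by \<open>kernel_eq\<close> when they agree almost everywhere. An almost everywhere
  symmetric and essentially bounded function always has a representative that is symmetric and
  bounded everywhere, so requiring these properties pointwise loses no classes.\<close>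

type_synonym 'a kern = "'a \<times> 'a \<Rightarrow> real"

definition is_kernel :: "'a measure \<Rightarrow> 'a kern \<Rightarrow> bool" where
  "is_kernel M W \<longleftrightarrow>
     W \<in> borel_measurable (M \<Otimes>\<^sub>M M) \<and>
     (\<exists>C. \<forall>x\<in>space M. \<forall>y\<in>space M. \<bar>W (x, y)\<bar> \<le> C) \<and>
     (\<forall>x\<in>space M. \<forall>y\<in>space M. W (x, y) = W (y, x))"

definition is_graphon :: "'a measure \<Rightarrow> 'a kern \<Rightarrow> bool" where
  "is_graphon M W \<longleftrightarrow>
     is_kernel M W \<and> (\<forall>x\<in>space M. \<forall>y\<in>space M. 0 \<le> W (x, y) \<and> W (x, y) \<le> 1)"

definition kernel_eq :: "'a measure \<Rightarrow> 'a kern \<Rightarrow> 'a kern \<Rightarrow> bool" where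
  "kernel_eq M U W \<longleftrightarrow> (AE z in M \<Otimes>\<^sub>M M. U z = W z)"

definition Linf_norm :: "'a measure \<Rightarrow> 'a kern \<Rightarrow> ereal" where
  "Linf_norm M W = esssup (M \<Otimes>\<^sub>M M) (\<lambda>z. ereal \<bar>W z\<bar>)"

text \<open>Unordered pairs of distinct vertices are enumerated as \<open>(i, j)\<close> with
  \<open>i < j\<close>; the orientation is immaterial because \<open>W\<close> is symmetric.\<close>

definition rooted_op :: "'a measure \<Rightarrow> nat \<Rightarrow> rooted \<Rightarrow> 'a kern \<Rightarrow> 'a kern" where
  "rooted_op M k = (\<lambda>(F, a, b) W (x, y).
     \<integral>\<omega>. (let z = fun_upd (fun_upd \<omega> a x) b y in
          \<Prod>(i, j)\<in>{(i, j). i \<in> {1..k} \<and> j \<in> {1..k} \<and> i < j}.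
            if {i, j} \<in> F then W (z i, z j) else 1 - W (z i, z j))
       \<partial>(\<Pi>\<^sub>M i\<in>{1..k} - {a, b}. M))"

definition velocity :: "'a measure \<Rightarrow> nat \<Rightarrow> rule \<Rightarrow> 'a kern \<Rightarrow> 'a kern" where
  "velocity M k R W = (\<lambda>z. \<Sum>X\<in>rooted_graphs k. flip_coeff k R X * rooted_op M k X W z)"

definition has_Linf_derivative ::
    "'a measure \<Rightarrow> (real \<Rightarrow> 'a kern) \<Rightarrow> 'a kern \<Rightarrow> real \<Rightarrow> bool" where
  "has_Linf_derivative M \<Phi> V t \<longleftrightarrow>
     ((\<lambda>h. Linf_norm M (\<lambda>z. (\<Phi> (t + h) z - \<Phi> t z) / h - V z)) \<longlongrightarrow> 0) (at 0)"

definition is_trajectory ::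
    "'a measure \<Rightarrow> nat \<Rightarrow> rule \<Rightarrow> 'a kern \<Rightarrow> real set \<Rightarrow> (real \<Rightarrow> 'a kern) \<Rightarrow> bool" where
  "is_trajectory M k R W I \<Phi> \<longleftrightarrow>
     open I \<and> is_interval I \<and> 0 \<in> I \<and>
     (\<forall>t\<in>I. is_kernel M (\<Phi> t)) \<and>
     (\<forall>t\<in>I. has_Linf_derivative M \<Phi> (velocity M k R (\<Phi> t)) t) \<and>
     kernel_eq M (\<Phi> 0) W"

definition is_maximal_trajectory ::
    "'a measure \<Rightarrow> nat \<Rightarrow> rule \<Rightarrow> 'a kern \<Rightarrow> real set \<Rightarrow> (real \<Rightarrow> 'a kern) \<Rightarrow> bool" where
  "is_maximal_trajectory M k R W D \<Phi> \<longleftrightarrow>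
     is_trajectory M k R W D \<Phi> \<and>
     (\<forall>I \<Psi>. is_trajectory M k R W I \<Psi> \<longrightarrow> I \<subseteq> D \<and> (\<forall>t\<in>I. kernel_eq M (\<Psi> t) (\<Phi> t)))"

text \<open>A maximal trajectory from a kernel \<open>W\<close> exists; its domain is unique, and its values
  on that domain are unique up to \<open>kernel_eq\<close>.\<close>

definition traj_domain :: "'a measure \<Rightarrow> nat \<Rightarrow> rule \<Rightarrow> 'a kern \<Rightarrow> real set" where
  "traj_domain M k R W = (THE D. \<exists>\<Phi>. is_maximal_trajectory M k R W D \<Phi>)"

definition traj :: "'a measure \<Rightarrow> nat \<Rightarrow> rule \<Rightarrow> 'a kern \<Rightarrow> real \<Rightarrow> 'a kern" where
  "traj M k R W = (SOME \<Phi>. is_maximal_trajectory M k R W (traj_domain M k R W) \<Phi>)"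

definition same_trajectories :: "'a measure \<Rightarrow> nat \<Rightarrow> rule \<Rightarrow> rule \<Rightarrow> bool" where
  "same_trajectories M k R1 R2 \<longleftrightarrow>
     (\<forall>W. is_kernel M W \<longrightarrow>
        traj_domain M k R1 W = traj_domain M k R2 W \<and>
        (\<forall>t\<in>traj_domain M k R1 W. kernel_eq M (traj M k R1 W t) (traj M k R2 W t)))"

end

theory Submission
  imports Defs "HOL-Probability.Discrete_Topology"
begin

text \<open>
  \<open>T\<^sub>X W\<close> depends only on the isomorphism class of the rooted graph \<open>X\<close>, so the velocity is a combination
  of one operator per class with coefficients \<open>q\<^sub>J\<close>; hence (S1) implies (S3), which contains (S2).

  For (S2) implies (S1), fix a rooted graph \<open>G\<^sup>c\<^sup>d\<close> and evaluate the velocity difference at the 0-1 step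
  graphons modelled on \<open>G\<close>, at a point whose coordinates lie in the parts \<open>c\<close> and \<open>d\<close>. Up to a common
  factor this is a polynomial in the part sizes \<open>n\<^sub>i\<close>, with one monomial for every map of \<open>[k]\<close> to itself that
  sends the roots of some \<open>F\<^sup>a\<^sup>b\<close> to \<open>c\<close> and \<open>d\<close>. Its multilinear coefficient in the parts other than
  \<open>c\<close> and \<open>d\<close> collects exactly the bijections and, up to sign, equals the difference of the class sums at
  the class of \<open>G\<^sup>c\<^sup>d\<close> times the number of automorphisms. Atomlessness makes all part sizes available.

  The velocity determines the trajectories. Conversely it is the derivative of the trajectory at
  time \<open>0\<close>; as the trajectory is given by a description, this needs the existence of a maximal
  trajectory, which is the Picard-Lindeloef theorem in \<open>L\<^sup>\<infinity>\<close>.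
\<close>

section \<open>Autonomous differential equations in a closed subspace\<close>

text \<open>Two obstacles shape the proof. Kernels are representatives and are compared almost
  everywhere, so neither the velocity nor a trajectory lives in a normed space as it stands. The
  analysis is therefore carried over to a closed subspace of a space of bounded functions. The
  Lipschitz bound proved for this serves twice: it makes the differential equation solvable, and at
  distance 0 it shows that the velocity does not depend on the representative. The second obstacle
  is reading off one coefficient of a polynomial in the part sizes that is known to vanish at
  positive sizes only. A finite difference does this without any theory of polynomials: the values
  of \<open>x ^ m\<close> at 1 and at 2 differ by \<open>1 - 2 ^ m\<close>, which is 0 for
  \<open>m = 0\<close> and -1 for \<open>m = 1\<close>. Exponents above 1 do no harm. There are
  \<open>k - 2\<close> free vertices and \<open>k - 2\<close> parts other than \<open>c\<close> and
  \<open>d\<close>, so a monomial that misses none of these parts contains each exactly once, and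
  every other monomial is killed by a factor 0. Positive sizes also give the block of parts
  \<open>c\<close> and \<open>d\<close> positive measure, so that an identity valid almost
  everywhere yields a point in it.\<close>

lemma norm_diff_le_vector_derivative:
  fixes f :: "real \<Rightarrow> 'e::real_normed_vector"
  assumes "convex A" and "\<And>t. t \<in> A \<Longrightarrow> (f has_vector_derivative f' t) (at t within A)"
    and "\<And>t. t \<in> A \<Longrightarrow> norm (f' t) \<le> B" and "a \<in> A" "b \<in> A"
  shows "norm (f b - f a) \<le> B * \<bar>b - a\<bar>"
proof -
  have "norm (f b - f a) \<le> B * norm (b - a)"
  proof (rule differentiable_bound[OF \<open>convex A\<close>])
    show "(f has_derivative (\<lambda>h. h *\<^sub>R f' t)) (at t within A)" if "t \<in> A" for t
      using assms(2)[OF that] by (simp add: has_vector_derivative_def)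
    show "onorm (\<lambda>h. h *\<^sub>R f' t) \<le> B" if "t \<in> A" for t
      using assms(3)[OF that] by (intro onorm_le) (simp add: mult.commute[of B] mult_left_mono)
  qed (use assms in auto)
  then show ?thesis by simp
qed

text \<open>Riemann sums are finite linear combinations of values of \<open>f\<close>, so they lie
  in \<open>S\<close>, and they come arbitrarily close to the integral.\<close>

lemma integral_in_closed_subspace:
  fixes f :: "real \<Rightarrow> 'e::banach"
  assumes S: "subspace S" "closed S" and f: "continuous_on {a..b} f" "\<And>t. t \<in> {a..b} \<Longrightarrow> f t \<in> S"
  shows "integral {a..b} f \<in> S"
proof -
  have "(f has_integral integral {a..b} f) (cbox a b)"
    using integrable_integral[OF integrable_continuous_real[OF f(1)]] by simp
  then have *: "\<forall>e>0. \<exists>\<gamma>. gauge \<gamma> \<and> (\<forall>p. p tagged_division_of cbox a b \<and> \<gamma> fine p \<longrightarrow>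
      norm ((\<Sum>(x, k)\<in>p. measure lborel k *\<^sub>R f x) - integral {a..b} f) < e)"
    unfolding has_integral .
  have "\<exists>y\<in>S. dist y (integral {a..b} f) < e" if "e > 0" for e
  proof -
    from *[rule_format, OF that] obtain \<gamma> where \<gamma>: "gauge \<gamma>" and
      "\<forall>p. p tagged_division_of cbox a b \<and> \<gamma> fine p \<longrightarrow>
        norm ((\<Sum>(x, k)\<in>p. measure lborel k *\<^sub>R f x) - integral {a..b} f) < e" by blast
    then have *: "norm ((\<Sum>(x, k)\<in>p. measure lborel k *\<^sub>R f x) - integral {a..b} f) < e"
      if "p tagged_division_of cbox a b" "\<gamma> fine p" for p using that by blast
    obtain p where p: "p tagged_division_of cbox a b" "\<gamma> fine p"
      using fine_division_exists[OF \<gamma>] by blast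
    have "(\<Sum>(x, k)\<in>p. measure lborel k *\<^sub>R f x) \<in> S"
    proof (intro subspace_sum[OF S(1)], clarify)
      fix x k assume "(x, k) \<in> p"
      then have "x \<in> k" "k \<subseteq> {a..b}" using tagged_division_ofD(2,3)[OF p(1)] by auto
      then show "measure lborel k *\<^sub>R f x \<in> S" using f(2)[of x] subspace_scale[OF S(1)] by auto
    qed
    with *[OF p] show ?thesis by (auto simp: dist_norm)
  qed
  then have "integral {a..b} f \<in> closure S" by (simp add: closure_approachable)
  with S(2) show ?thesis by simp
qed

lemma antiderivative_in_closed_subspace:
  fixes g :: "real \<Rightarrow> 'e::banach"
  assumes S: "subspace S" "closed S" and g: "continuous_on {-d..d} g" "\<And>t. t \<in> {-d..d} \<Longrightarrow> g t \<in> S"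
    and "d > 0"
  shows "\<exists>G. G 0 = 0 \<and> (\<forall>t\<in>{-d..d}. G t \<in> S \<and> (G has_vector_derivative g t) (at t within {-d..d}))"
proof -
  \<comment> \<open>The base point is \<open>-d\<close> because \<open>integral {0..t} g\<close>
    would be 0 for all negative \<open>t\<close>. Subtracting the value at 0 restores
    \<open>G 0 = 0\<close>.\<close>
  let ?G = "\<lambda>t. integral {-d..t} g - integral {-d..0} g"
  have "?G t \<in> S \<and> (?G has_vector_derivative g t) (at t within {-d..d})" if t: "t \<in> {-d..d}" for t
  proof
  have in_S: "integral {-d..s} g \<in> S" if "s \<in> {-d..d}" for s
    using g that by (intro integral_in_closed_subspace[OF S]) (auto intro: continuous_on_subset)
  show "?G t \<in> S"
    using in_S[OF t] in_S[of 0] \<open>d > 0\<close> by (intro subspace_diff[OF S(1)]) auto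
  show "(?G has_vector_derivative g t) (at t within {-d..d})"
    using has_vector_derivative_diff[OF integral_has_vector_derivative[OF g(1) t] has_vector_derivative_const]
    by simp
  qed
  then show ?thesis by (intro exI[of _ ?G]) simp
qed

text \<open>The velocity is polynomial in the kernel, so a Lipschitz constant exists on each ball
  but not globally. Its lift to the Banach space means something on kernel classes only, so all
  assumptions are confined to \<open>S\<close>, and solutions have to be kept inside
  \<open>S\<close>.\<close>

locale autonomous_ode =
  fixes S :: "'e::banach set" and V :: "'e \<Rightarrow> 'e"
  assumes subspace: "subspace S" and closed: "closed S"
    and V_in: "u \<in> S \<Longrightarrow> V u \<in> S"
    and lipschitz: "\<exists>L. \<forall>u\<in>S. \<forall>v\<in>S. norm u \<le> C \<longrightarrow> norm v \<le> C \<longrightarrow> norm (V u - V v) \<le> L * norm (u - v)"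
begin

definition solution :: "'e \<Rightarrow> real set \<Rightarrow> (real \<Rightarrow> 'e) \<Rightarrow> bool" where
  "solution u I \<phi> \<longleftrightarrow> open I \<and> is_interval I \<and> 0 \<in> I \<and> \<phi> 0 = u \<and>
     (\<forall>t\<in>I. \<phi> t \<in> S \<and> (\<phi> has_vector_derivative V (\<phi> t)) (at t))"

lemma lipschitz_nonneg:
  obtains L where "L \<ge> 0" "\<And>u v. u \<in> S \<Longrightarrow> v \<in> S \<Longrightarrow> norm u \<le> C \<Longrightarrow> norm v \<le> C \<Longrightarrow>
    norm (V u - V v) \<le> L * norm (u - v)"
proof -
  from lipschitz[of C] obtain L where L: "\<And>u v. u \<in> S \<Longrightarrow> v \<in> S \<Longrightarrow> norm u \<le> C \<Longrightarrow> norm v \<le> C \<Longrightarrow>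
    norm (V u - V v) \<le> L * norm (u - v)" by blast
  show thesis
  proof (rule that)
    show "max L 0 \<ge> 0" by simp
    show "norm (V u - V v) \<le> max L 0 * norm (u - v)"
      if "u \<in> S" "v \<in> S" "norm u \<le> C" "norm v \<le> C" for u v
      using L[OF that] by (rule order_trans) (simp add: mult_right_mono)
  qed
qed

lemma solution_continuous: "solution u I \<phi> \<Longrightarrow> continuous_on I \<phi>"
  unfolding solution_def
  by (intro continuous_at_imp_continuous_on) (auto intro: has_vector_derivative_continuous)

lemma solution_subset:
  "solution u I \<phi> \<Longrightarrow> open J \<Longrightarrow> is_interval J \<Longrightarrow> 0 \<in> J \<Longrightarrow> J \<subseteq> I \<Longrightarrow> solution u J \<phi>"
  unfolding solution_def by blast

text \<open>The mean value inequality replaces Gronwall's lemma. On an interval of radius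
  \<open>d\<close> with \<open>L * d < 1\<close>, let \<open>t1\<close> maximise the norm of the
  difference of the solutions. The derivative of the difference is at most \<open>L\<close> times
  this maximum, so the maximum is at most \<open>L * d\<close> times itself, hence 0.\<close>

lemma solution_locally_unique:
  assumes \<phi>: "solution u I \<phi>" and \<psi>: "solution u I \<psi>" and t0: "t0 \<in> I" "\<phi> t0 = \<psi> t0"
  shows "\<exists>d>0. \<forall>t. \<bar>t - t0\<bar> \<le> d \<longrightarrow> t \<in> I \<and> \<phi> t = \<psi> t"
proof -
  have "open I" using \<phi> by (simp add: solution_def)
  then obtain r where r: "r > 0" "cball t0 r \<subseteq> I" using t0 open_contains_cball by blast
  let ?K = "cball t0 r"
  have cont: "continuous_on ?K \<phi>" "continuous_on ?K \<psi>"
    using solution_continuous[OF \<phi>] solution_continuous[OF \<psi>] r(2) by (auto intro: continuous_on_subset)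
  have "bounded (\<phi> ` ?K \<union> \<psi> ` ?K)"
    using cont by (auto intro!: compact_imp_bounded compact_continuous_image)
  then obtain C where C: "\<And>t. t \<in> ?K \<Longrightarrow> norm (\<phi> t) \<le> C \<and> norm (\<psi> t) \<le> C"
    unfolding bounded_iff by blast
  obtain L where L: "L \<ge> 0" "\<And>u v. u \<in> S \<Longrightarrow> v \<in> S \<Longrightarrow> norm u \<le> C \<Longrightarrow> norm v \<le> C \<Longrightarrow>
    norm (V u - V v) \<le> L * norm (u - v)" using lipschitz_nonneg[of C] by blast
  define d where "d = min r (1 / (L + 1))"
  have d: "d > 0" "d \<le> r" "L * d < 1"
  proof -
    show "d > 0" "d \<le> r" using r(1) L(1) by (auto simp: d_def)
    have "L * d \<le> L * (1 / (L + 1))" using L(1) by (intro mult_left_mono) (auto simp: d_def)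
    also have "\<dots> < 1" using L(1) by (simp add: divide_simps)
    finally show "L * d < 1" .
  qed
  let ?D = "cball t0 d"
  have DK: "?D \<subseteq> ?K" using d(2) by (simp add: subset_cball)
  let ?w = "\<lambda>t. \<phi> t - \<psi> t"
  have "continuous_on ?D (\<lambda>t. norm (?w t))"
    using cont DK by (auto intro!: continuous_intros intro: continuous_on_subset)
  then obtain t1 where t1: "t1 \<in> ?D" "\<And>t. t \<in> ?D \<Longrightarrow> norm (?w t) \<le> norm (?w t1)"
    using continuous_attains_sup[of ?D "\<lambda>t. norm (?w t)"] d(1) by (auto simp: cball_eq_empty)
  have "norm (?w t1 - ?w t0) \<le> (L * norm (?w t1)) * \<bar>t1 - t0\<bar>"
  proof (rule norm_diff_le_vector_derivative[where A = ?D])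
    fix t assume t: "t \<in> ?D"
    then have tI: "t \<in> I" using DK r(2) by blast
    show "(?w has_vector_derivative (V (\<phi> t) - V (\<psi> t))) (at t within ?D)"
      using \<phi> \<psi> tI unfolding solution_def
      by (intro has_vector_derivative_diff) (auto intro: has_vector_derivative_at_within)
    have "norm (V (\<phi> t) - V (\<psi> t)) \<le> L * norm (?w t)"
      using \<phi> \<psi> tI C[of t] t DK unfolding solution_def by (intro L(2)) auto
    also have "\<dots> \<le> L * norm (?w t1)" using t1(2)[OF t] L(1) by (intro mult_left_mono)
    finally show "norm (V (\<phi> t) - V (\<psi> t)) \<le> L * norm (?w t1)" .
  qed (use t1 d(1) in auto)
  also have "\<dots> \<le> (L * norm (?w t1)) * d"
    using t1(1) L(1) by (intro mult_left_mono) (auto simp: dist_real_def)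
  finally have "norm (?w t1) \<le> (L * d) * norm (?w t1)"
    using t0(2) by (simp add: mult_ac)
  then have "norm (?w t1) * (1 - L * d) \<le> 0" by (simp add: algebra_simps)
  then have "norm (?w t1) = 0" using d(3) by (simp add: mult_le_0_iff)
  then have "\<phi> t = \<psi> t" if "t \<in> ?D" for t using t1(2)[OF that] by simp
  then show ?thesis using d(1) DK r(2)
    by (intro exI[of _ d]) (auto simp: dist_real_def abs_minus_commute subset_eq)
qed

text \<open>The set of times of agreement is closed by continuity, open by
  \<open>solution_locally_unique\<close>, and contains 0; the interval is connected.\<close>

lemma solution_unique_same_domain:
  assumes \<phi>: "solution u I \<phi>" and \<psi>: "solution u I \<psi>" and "t \<in> I"
  shows "\<phi> t = \<psi> t"
proof -
  let ?T = "{t \<in> I. \<phi> t - \<psi> t = 0}"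
  have I: "open I" "connected I" "0 \<in> I" "\<phi> 0 = \<psi> 0"
    using \<phi> \<psi> by (auto simp: solution_def is_interval_connected)
  have "closedin (top_of_set I) ?T"
    using continuous_closedin_preimage_constant[of I "\<lambda>t. \<phi> t - \<psi> t" 0]
      solution_continuous[OF \<phi>] solution_continuous[OF \<psi>] by (auto intro: continuous_intros)
  moreover have "openin (top_of_set I) ?T"
  proof -
    have "\<exists>e>0. ball s e \<subseteq> ?T" if s: "s \<in> ?T" for s
    proof -
      from solution_locally_unique[OF \<phi> \<psi>, of s] s
      obtain d where "d > 0" "\<forall>t. \<bar>t - s\<bar> \<le> d \<longrightarrow> t \<in> I \<and> \<phi> t = \<psi> t" by auto
      then show ?thesis by (intro exI[of _ d]) (auto simp: dist_real_def abs_minus_commute)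
    qed
    then have "open ?T" by (simp add: open_contains_ball)
    then show ?thesis by (simp add: open_subset)
  qed
  ultimately have "?T = {} \<or> ?T = I" using I(2) by (auto simp: connected_clopen)
  with I \<open>t \<in> I\<close> show ?thesis by auto
qed

lemma solution_unique:
  assumes "solution u I \<phi>" "solution u J \<psi>" "t \<in> I" "t \<in> J"
  shows "\<phi> t = \<psi> t"
proof (rule solution_unique_same_domain)
  have *: "open (I \<inter> J)" "is_interval (I \<inter> J)" "0 \<in> I \<inter> J"
    using assms by (auto simp: solution_def intro: is_interval_Int)
  show "solution u (I \<inter> J) \<phi>" "solution u (I \<inter> J) \<psi>"
    using solution_subset[OF assms(1) *] solution_subset[OF assms(2) *] by auto
qed (use assms in auto)

text \<open>Picard iteration: Banach's fixed point theorem is applied to the integral operator on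
  functions with values in \<open>K\<close>, the part of \<open>S\<close> within distance 1 of
  \<open>u\<close>. Closedness of \<open>S\<close> makes this function space complete, and integrals
  of functions with values in \<open>S\<close> stay in \<open>S\<close>.\<close>

lemma local_solution:
  assumes "u \<in> S"
  obtains I \<phi> where "solution u I \<phi>"
proof -
  define K where "K = S \<inter> cball u 1"
  define C where "C = norm u + 1"
  have K: "v \<in> S \<and> norm v \<le> C" if "v \<in> K" for v
    using that norm_triangle_sub[of v u] by (auto simp: K_def C_def dist_norm norm_minus_commute)
  obtain L where L: "L \<ge> 0" "\<And>u v. u \<in> S \<Longrightarrow> v \<in> S \<Longrightarrow> norm u \<le> C \<Longrightarrow> norm v \<le> C \<Longrightarrow>
    norm (V u - V v) \<le> L * norm (u - v)" using lipschitz_nonneg[of C] by blast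
  have uK: "u \<in> K" using assms by (simp add: K_def)
  define B where "B = norm (V u) + L"
  have B: "norm (V v) \<le> B" if "v \<in> K" for v
  proof -
    have "norm (V v) \<le> norm (V u) + norm (V v - V u)" by (rule norm_triangle_sub)
    also have "norm (V v - V u) \<le> L * norm (v - u)" using K[OF that] K[OF uK] by (intro L(2)) auto
    also have "\<dots> \<le> L * 1"
      using that L(1) by (intro mult_left_mono) (auto simp: K_def dist_norm norm_minus_commute)
    finally show ?thesis by (simp add: B_def)
  qed
  have "B \<ge> 0" using L(1) by (simp add: B_def)
  \<comment> \<open>The bound \<open>B * d \<le> 1\<close> keeps the iterates in the ball of radius
    1, and \<open>L * d \<le> 1 / 2\<close> makes the operator a contraction.\<close>
  define d where "d = 1 / (B + 2 * L + 1)"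
  have d: "d > 0" "B * d \<le> 1" "L * d \<le> 1 / 2"
    using L(1) \<open>B \<ge> 0\<close> by (auto simp: d_def divide_simps)
  let ?I = "{-d..d}"
  \<comment> \<open>Retracting the line onto \<open>{-d..d}\<close> extends the iterates to bounded
    continuous functions on the whole line, so that the type of such functions can serve as the
    complete space.\<close>
  define clamp where "clamp t = max (-d) (min d t)" for t :: real
  have clamp: "clamp t \<in> ?I" "t \<in> ?I \<Longrightarrow> clamp t = t" "continuous_on A clamp" for t A
    using d(1) unfolding clamp_def by (auto intro!: continuous_intros)
  have contV: "continuous_on K V"
  proof (rule lipschitz_on_continuous_on)
    show "L-lipschitz_on K V"
      using L K by (auto simp: lipschitz_on_def dist_norm)
  qed
  define X where "X = {x :: real \<Rightarrow>\<^sub>C 'e. \<forall>t. x t \<in> K}"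
  have contVx: "continuous_on ?I (\<lambda>t. V (x t))" if "x \<in> X" for x
    using that by (intro continuous_on_compose2[OF contV]) (auto simp: X_def)
  \<comment> \<open>The antiderivative of \<open>V (x t)\<close> that vanishes at 0; on the interval
    it is the integral from 0 to \<open>t\<close>, whatever the sign of \<open>t\<close>.\<close>
  define G where "G x = (SOME G. G 0 = 0 \<and>
    (\<forall>t\<in>?I. G t \<in> S \<and> (G has_vector_derivative V (apply_bcontfun x t)) (at t within ?I)))" for x
  have G: "G x 0 = 0 \<and>
    (\<forall>t\<in>?I. G x t \<in> S \<and> (G x has_vector_derivative V (x t)) (at t within ?I))" if "x \<in> X" for x
  proof -
    have "\<exists>G. G 0 = 0 \<and> (\<forall>t\<in>?I. G t \<in> S \<and> (G has_vector_derivative V (x t)) (at t within ?I))"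
    proof (rule antiderivative_in_closed_subspace[OF subspace closed contVx[OF that] _ d(1)])
      show "V (x t) \<in> S" for t using that K[of "x t"] by (intro V_in) (auto simp: X_def)
    qed
    from someI_ex[OF this] show ?thesis unfolding G_def .
  qed
  have Gbound: "norm (G x t) \<le> 1" if "x \<in> X" "t \<in> ?I" for x t
  proof -
    have "norm (G x t - G x 0) \<le> B * \<bar>t - 0\<bar>"
    proof (rule norm_diff_le_vector_derivative[where A = ?I])
      show "(G x has_vector_derivative V (x s)) (at s within ?I)" if "s \<in> ?I" for s
        using G[OF \<open>x \<in> X\<close>] that by blast
      show "norm (V (x s)) \<le> B" for s using B \<open>x \<in> X\<close> by (simp add: X_def)
    qed (use that d(1) in auto)
    also have "\<dots> \<le> B * d" using that(2) \<open>B \<ge> 0\<close> by (intro mult_left_mono) auto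
    finally show ?thesis using G[OF that(1)] d(2) by simp
  qed
  have Gcont: "continuous_on UNIV (\<lambda>t. u + G x (clamp t))" if "x \<in> X" for x
  proof -
    have "continuous_on ?I (G x)"
      unfolding continuous_on_eq_continuous_within
      using G[OF that] by (blast intro: has_vector_derivative_continuous)
    then have "continuous_on UNIV (\<lambda>t. G x (clamp t))"
      by (rule continuous_on_compose2[OF _ clamp(3)]) (use clamp(1) in blast)
    then show ?thesis by (intro continuous_on_add continuous_on_const)
  qed
  define P where "P x = Bcontfun (\<lambda>t. u + G x (clamp t))" for x
  have P: "apply_bcontfun (P x) t = u + G x (clamp t)" if "x \<in> X" for x t
  proof -
    have "(\<lambda>t. u + G x (clamp t)) \<in> bcontfun"
    proof (rule bcontfun_normI[OF Gcont[OF that]])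
      fix t
      show "norm (u + G x (clamp t)) \<le> norm u + 1"
        using norm_triangle_ineq[of u "G x (clamp t)"] Gbound[OF that clamp(1)[of t]] by linarith
    qed
    then show ?thesis by (simp add: P_def Bcontfun_inverse)
  qed
  have PX: "P ` X \<subseteq> X"
  proof (clarify, simp add: X_def, intro allI)
    fix x :: "real \<Rightarrow>\<^sub>C 'e" and t assume "\<forall>t. x t \<in> K"
    then have x: "x \<in> X" by (simp add: X_def)
    show "P x t \<in> K"
      using Gbound[OF x clamp(1)[of t]] G[OF x] clamp(1)[of t] assms
      by (auto simp: P[OF x] K_def dist_norm intro: subspace_add[OF subspace])
  qed
  have contr: "dist (P x) (P y) \<le> 1 / 2 * dist x y" if x: "x \<in> X" and y: "y \<in> X" for x y
  proof (rule dist_bound)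
    fix t
    let ?t = "clamp t"
    have "norm ((G x ?t - G y ?t) - (G x 0 - G y 0)) \<le> (L * dist x y) * \<bar>?t - 0\<bar>"
    proof (rule norm_diff_le_vector_derivative[where A = ?I])
      fix s assume s: "s \<in> ?I"
      show "((\<lambda>t. G x t - G y t) has_vector_derivative (V (x s) - V (y s))) (at s within ?I)"
        using G[OF x] G[OF y] s by (intro has_vector_derivative_diff) auto
      have "norm (V (x s) - V (y s)) \<le> L * dist (x s) (y s)"
        unfolding dist_norm using x y K by (intro L(2)) (auto simp: X_def)
      also have "\<dots> \<le> L * dist x y" using L(1) by (intro mult_left_mono dist_bounded)
      finally show "norm (V (x s) - V (y s)) \<le> L * dist x y" .
    qed (use clamp d(1) in auto)
    also have "\<dots> \<le> (L * dist x y) * d"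
      using clamp(1)[of t] L(1) by (intro mult_left_mono) auto
    also have "\<dots> = (L * d) * dist x y" by simp
    also have "\<dots> \<le> 1 / 2 * dist x y" by (intro mult_right_mono d(3)) simp
    finally show "dist (P x t) (P y t) \<le> 1 / 2 * dist x y"
      using G[OF x] G[OF y] by (simp add: P[OF x] P[OF y] dist_norm)
  qed
  have "closed X"
  proof -
    have "X = PiC UNIV (\<lambda>_. K)" by (auto simp: X_def mem_PiC_iff Pi_iff)
    moreover have "closed K" using closed by (simp add: K_def closed_Int)
    ultimately show ?thesis by (simp add: closed_PiC)
  qed
  moreover have "const_bcontfun u \<in> X" using uK by (simp add: X_def const_bcontfun.rep_eq)
  ultimately have "\<exists>!x. x \<in> X \<and> P x = x"
    using PX contr by (intro Banach_fix[of X "1 / 2"]) (auto simp: complete_eq_closed)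
  then obtain x where x: "x \<in> X" "P x = x" by blast
  have xG: "x t = u + G x t" if "t \<in> ?I" for t
    using P[OF x(1), of t] clamp(2)[OF that] x(2) by simp
  have "solution u {-d<..<d} x"
    unfolding solution_def
  proof (intro conjI ballI)
    show "x 0 = u" using xG[of 0] G[OF x(1)] d(1) by simp
    fix t assume t: "t \<in> {-d<..<d}"
    show "x t \<in> S" using x(1) K by (auto simp: X_def)
    have "(G x has_vector_derivative V (x t)) (at t within {-d<..<d})"
      by (rule has_vector_derivative_within_subset[where S = ?I]) (use G[OF x(1)] t in auto)
    from has_vector_derivative_add[OF has_vector_derivative_const this, of u]
    have "((\<lambda>t. u + G x t) has_vector_derivative V (x t)) (at t within {-d<..<d})" by simp
    then have "(x has_vector_derivative V (x t)) (at t within {-d<..<d})"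
      by (rule has_vector_derivative_transform[OF t, rotated]) (rule xG, simp)
    then show "(x has_vector_derivative V (x t)) (at t)"
      by (rule has_vector_derivative_within_open[THEN iffD1, rotated 2]) (use t in simp_all)
  qed (simp_all add: d(1) is_interval_oo)
  then show thesis by (rule that)
qed

text \<open>The domain is the union of the domains of all solutions, which is an interval because
  they all contain 0. By uniqueness all solutions defined at \<open>t\<close> take the same value
  there, so the description of \<open>\<phi> t\<close> denotes it.\<close>

lemma maximal_solution:
  assumes "u \<in> S"
  obtains D \<phi> where "solution u D \<phi>"
    "\<And>I \<psi>. solution u I \<psi> \<Longrightarrow> I \<subseteq> D \<and> (\<forall>t\<in>I. \<psi> t = \<phi> t)"
proof -
  let ?\<I> = "{I. \<exists>\<psi>. solution u I \<psi>}"
  define D where "D = \<Union>?\<I>"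
  define \<phi> where "\<phi> t = (THE v. \<exists>I \<psi>. solution u I \<psi> \<and> t \<in> I \<and> v = \<psi> t)" for t
  have \<phi>: "\<psi> t = \<phi> t" if "solution u I \<psi>" "t \<in> I" for I \<psi> t
    unfolding \<phi>_def
    by (rule the_equality[symmetric]) (use that solution_unique in blast)+
  obtain I0 \<psi>0 where sol0: "solution u I0 \<psi>0" using local_solution[OF assms] .
  show thesis
  proof (rule that)
    show "solution u D \<phi>" unfolding solution_def
    proof (intro conjI ballI)
      show "open D" unfolding D_def by (auto simp: solution_def)
      have "connected D" unfolding D_def
        by (rule connected_Union) (auto simp: solution_def is_interval_connected)
      then show "is_interval D" by (simp add: is_interval_connected_1)
      show "0 \<in> D" using sol0 by (auto simp: D_def solution_def)
      show "\<phi> 0 = u" using \<phi>[OF sol0, of 0] sol0 by (simp add: solution_def)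
      fix t assume "t \<in> D"
      then obtain I \<psi> where I: "solution u I \<psi>" "t \<in> I" by (auto simp: D_def)
      then have *: "open I" "\<psi> t \<in> S" "(\<psi> has_vector_derivative V (\<psi> t)) (at t)"
        by (auto simp: solution_def)
      show "\<phi> t \<in> S" using *(2) \<phi>[OF I] by simp
      show "(\<phi> has_vector_derivative V (\<phi> t)) (at t)"
        using has_vector_derivative_transform_within_open[OF *(3,1) I(2)] \<phi>[OF I(1)] \<phi>[OF I] by simp
    qed
    show "I \<subseteq> D \<and> (\<forall>t\<in>I. \<psi> t = \<phi> t)" if "solution u I \<psi>" for I \<psi>
      using that \<phi> by (auto simp: D_def)
  qed
qed

end

section \<open>Kernels as elements of a Banach space\<close>

definition bounded_measurable :: "'b measure \<Rightarrow> ('b \<Rightarrow> real) set" where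
  "bounded_measurable N = {f \<in> borel_measurable N. \<exists>C. \<forall>z\<in>space N. \<bar>f z\<bar> \<le> C}"

text \<open>Averages over measurable sets embed \<open>L\<^sup>\<infinity>\<close> isometrically into a Banach space of
  bounded functions, so that no quotient type is needed. Sets that are null or not measurable contribute
  \<open>x / 0 = 0\<close>.\<close>

definition Linf_embed :: "'b measure \<Rightarrow> ('b \<Rightarrow> real) \<Rightarrow> ('b set discrete \<Rightarrow>\<^sub>C real)" where
  "Linf_embed N f = Bcontfun (\<lambda>A. (LINT z|N. indicator (of_discrete A) z * f z) / measure N (of_discrete A))"

lemma bounded_measurableI:
  "f \<in> borel_measurable N \<Longrightarrow> (\<And>z. z \<in> space N \<Longrightarrow> \<bar>f z\<bar> \<le> C) \<Longrightarrow> f \<in> bounded_measurable N"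
  by (auto simp: bounded_measurable_def)

lemma bounded_measurable_linear:
  assumes "f \<in> bounded_measurable N" "g \<in> bounded_measurable N"
  shows "(\<lambda>z. a * f z + b * g z) \<in> bounded_measurable N"
proof -
  from assms obtain C D where CD: "\<And>z. z \<in> space N \<Longrightarrow> \<bar>f z\<bar> \<le> C" "\<And>z. z \<in> space N \<Longrightarrow> \<bar>g z\<bar> \<le> D"
    and [measurable]: "f \<in> borel_measurable N" "g \<in> borel_measurable N"
    by (auto simp: bounded_measurable_def)
  show ?thesis
  proof (rule bounded_measurableI)
    fix z assume z: "z \<in> space N"
    have "\<bar>a * f z + b * g z\<bar> \<le> \<bar>a\<bar> * \<bar>f z\<bar> + \<bar>b\<bar> * \<bar>g z\<bar>" by (metis abs_mult abs_triangle_ineq)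
    also have "\<dots> \<le> \<bar>a\<bar> * C + \<bar>b\<bar> * D" using CD z by (intro add_mono mult_left_mono) auto
    finally show "\<bar>a * f z + b * g z\<bar> \<le> \<bar>a\<bar> * C + \<bar>b\<bar> * D" .
  qed measurable
qed

lemma bounded_measurable_diff:
  "f \<in> bounded_measurable N \<Longrightarrow> g \<in> bounded_measurable N \<Longrightarrow> (\<lambda>z. f z - g z) \<in> bounded_measurable N"
  using bounded_measurable_linear[of f N g 1 "-1"] by simp

lemma bounded_measurable_sum:
  assumes "\<And>i. i \<in> A \<Longrightarrow> f i \<in> bounded_measurable N"
  shows "(\<lambda>z. \<Sum>i\<in>A. c i * f i z) \<in> bounded_measurable N"
proof -
  have 0: "(\<lambda>_. 0) \<in> bounded_measurable N" by (auto simp: bounded_measurable_def)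
  show ?thesis using assms
  proof (induction A rule: infinite_finite_induct)
    case (insert i F)
    then show ?case using bounded_measurable_linear[of "f i" N "\<lambda>z. \<Sum>i\<in>F. c i * f i z" "c i" 1] by simp
  qed (simp_all add: 0)
qed

context finite_measure
begin

lemma bounded_measurable_integrable:
  assumes "f \<in> bounded_measurable M"
  shows "integrable M f" and "A \<in> sets M \<Longrightarrow> integrable M (\<lambda>z. indicator A z * f z)"
proof -
  show *: "integrable M f"
    using assms by (auto simp: bounded_measurable_def intro!: integrable_const_bound[OF AE_I2])
  show "integrable M (\<lambda>z. indicator A z * f z)" if "A \<in> sets M"
    using integrable_mult_indicator[OF that *] by simp
qed

lemma integral_indicator_abs_le:
  assumes f: "f \<in> bounded_measurable M" and AE: "AE z in M. \<bar>f z\<bar> \<le> c" and A: "A \<in> sets M"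
  shows "\<bar>LINT z|M. indicator A z * f z\<bar> \<le> c * measure M A"
proof -
  have "\<bar>LINT z|M. indicator A z * f z\<bar> \<le> (LINT z|M. \<bar>indicator A z * f z\<bar>)"
    by (rule integral_abs_bound)
  also have "\<dots> \<le> (LINT z|M. c * indicator A z)"
  proof (rule integral_mono_AE)
    show "integrable M (\<lambda>z. \<bar>indicator A z * f z\<bar>)"
      using bounded_measurable_integrable(2)[OF f A] by (rule integrable_abs)
    show "integrable M (\<lambda>z. c * indicator A z)"
      using A by (intro integrable_mult_right integrable_real_indicator) (auto simp: emeasure_eq_measure)
    show "AE z in M. \<bar>indicator A z * f z\<bar> \<le> c * indicator A z"
      using AE by eventually_elim (simp add: indicator_def)
  qed
  also have "\<dots> = c * measure M A" using A by (simp add: Int_absorb1 sets.sets_into_space)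
  finally show ?thesis .
qed

text \<open>An average never exceeds a bound for the function, and continuity is automatic on a
  discrete space. The bound is \<open>max C 0\<close> because the quotient is 0 on sets of measure 0
  and on sets that are not measurable.\<close>

lemma Linf_embed_bcontfun:
  assumes f: "f \<in> bounded_measurable M"
  shows "(\<lambda>A. (LINT z|M. indicator (of_discrete A) z * f z) / measure M (of_discrete A)) \<in> bcontfun"
proof -
  from f obtain C where C: "\<And>z. z \<in> space M \<Longrightarrow> \<bar>f z\<bar> \<le> C" by (auto simp: bounded_measurable_def)
  show ?thesis
  proof (rule bcontfun_normI)
    show "continuous_on UNIV (\<lambda>A. (LINT z|M. indicator (of_discrete A) z * f z) / measure M (of_discrete A))"
      by (simp add: continuous_on_open_vimage open_discrete)
    fix D :: "'a set discrete"
    let ?A = "of_discrete D"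
    show "norm ((LINT z|M. indicator ?A z * f z) / measure M ?A) \<le> max C 0"
    proof (cases "?A \<in> sets M")
      case True
      have "AE z in M. \<bar>f z\<bar> \<le> max C 0" using C by (intro AE_I2) (auto simp: le_max_iff_disj)
      from integral_indicator_abs_le[OF f this True] show ?thesis
        by (auto simp: divide_simps)
    qed (simp add: measure_notin_sets)
  qed
qed

lemma Linf_embed_apply:
  assumes "f \<in> bounded_measurable M"
  shows "apply_bcontfun (Linf_embed M f) A = (LINT z|M. indicator (of_discrete A) z * f z) / measure M (of_discrete A)"
  unfolding Linf_embed_def by (subst Bcontfun_inverse) (use Linf_embed_bcontfun[OF assms] in auto)

lemma Linf_embed_linear:
  assumes "f \<in> bounded_measurable M" "g \<in> bounded_measurable M"
  shows "Linf_embed M (\<lambda>z. a * f z + b * g z) = a *\<^sub>R Linf_embed M f + b *\<^sub>R Linf_embed M g"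
proof (rule bcontfun_eqI)
  fix D :: "'a set discrete"
  let ?A = "of_discrete D"
  show "Linf_embed M (\<lambda>z. a * f z + b * g z) D = (a *\<^sub>R Linf_embed M f + b *\<^sub>R Linf_embed M g) D"
  proof (cases "?A \<in> sets M")
    case True
    have "(LINT z|M. indicator ?A z * (a * f z + b * g z)) =
        (LINT z|M. a * (indicator ?A z * f z) + b * (indicator ?A z * g z))"
      by (simp add: algebra_simps)
    also have "\<dots> = a * (LINT z|M. indicator ?A z * f z) + b * (LINT z|M. indicator ?A z * g z)"
      using bounded_measurable_integrable(2)[OF assms(1) True] bounded_measurable_integrable(2)[OF assms(2) True]
      by simp
    finally show ?thesis
      by (simp add: Linf_embed_apply assms bounded_measurable_linear plus_bcontfun.rep_eq
        scaleR_bcontfun.rep_eq add_divide_distrib)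
  qed (simp add: Linf_embed_apply assms bounded_measurable_linear plus_bcontfun.rep_eq
        scaleR_bcontfun.rep_eq measure_notin_sets)
qed

lemma Linf_embed_diff:
  assumes "f \<in> bounded_measurable M" "g \<in> bounded_measurable M"
  shows "Linf_embed M (\<lambda>z. f z - g z) = Linf_embed M f - Linf_embed M g"
  using Linf_embed_linear[OF assms, of 1 "-1"] by simp

text \<open>The hypothesis is tested on the set where \<open>f\<close> exceeds \<open>c\<close>.
  There \<open>f - c\<close> is positive, but its integral is at most 0, so the set is null.\<close>

lemma AE_le_if_averages_le:
  assumes f: "f \<in> bounded_measurable M"
    and le: "\<And>A. A \<in> sets M \<Longrightarrow> (LINT z|M. indicator A z * f z) \<le> c * measure M A"
  shows "AE z in M. f z \<le> c"
proof -
  have [measurable]: "f \<in> borel_measurable M" using f by (simp add: bounded_measurable_def)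
  let ?A = "{z \<in> space M. f z > c}"
  have A: "?A \<in> sets M" by measurable
  have int: "integrable M (\<lambda>z. indicator ?A z * f z)" "integrable M (\<lambda>z. indicator ?A z * c)"
    using bounded_measurable_integrable(2)[OF f A] A
    by (auto simp: emeasure_eq_measure intro!: integrable_mult_left integrable_real_indicator)
  let ?g = "\<lambda>z. indicator ?A z * f z - indicator ?A z * c"
  have nonneg: "AE z in M. 0 \<le> ?g z" by (auto simp: indicator_def)
  have "(LINT z|M. ?g z) = (LINT z|M. indicator ?A z * f z) - measure M ?A * c"
    using int A by (simp add: Int_absorb1 sets.sets_into_space)
  also have "\<dots> \<le> 0" using le[OF A] by (simp add: mult.commute)
  finally have "(LINT z|M. ?g z) = 0" using integral_nonneg_AE[OF nonneg] by simp
  then have "AE z in M. ?g z = 0"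
    using integral_nonneg_eq_0_iff_AE[OF _ nonneg] int by auto
  then show ?thesis by (rule AE_mp) (auto simp: indicator_def split: if_splits)
qed

text \<open>This is the isometry: the sup norm of the averages is the essential supremum. All later
  passages between norms and almost everywhere bounds go through it.\<close>

lemma norm_Linf_embed_le_iff:
  assumes f: "f \<in> bounded_measurable M" and "c \<ge> 0"
  shows "norm (Linf_embed M f) \<le> c \<longleftrightarrow> (AE z in M. \<bar>f z\<bar> \<le> c)"
proof
  assume AE: "AE z in M. \<bar>f z\<bar> \<le> c"
  show "norm (Linf_embed M f) \<le> c"
  proof (rule norm_bound)
    fix D :: "'a set discrete"
    let ?A = "of_discrete D"
    show "norm (Linf_embed M f D) \<le> c"
    proof (cases "?A \<in> sets M")
      case True
      from integral_indicator_abs_le[OF f AE True] \<open>c \<ge> 0\<close> show ?thesis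
        by (simp add: Linf_embed_apply[OF f] divide_simps)
    qed (use \<open>c \<ge> 0\<close> in \<open>simp add: Linf_embed_apply[OF f] measure_notin_sets\<close>)
  qed
next
  assume le: "norm (Linf_embed M f) \<le> c"
  have avg: "\<bar>LINT z|M. indicator A z * f z\<bar> \<le> c * measure M A" if A: "A \<in> sets M" for A
  \<comment> \<open>A null set is invisible to the embedding, whose value there is
    \<open>x / 0 = 0\<close>, so the bound is checked directly from the vanishing integral.\<close>
  proof (cases "measure M A = 0")
    case True
    then have "AE z in M. indicator A z * f z = 0"
      using A by (intro AE_I'[of A]) (auto simp: indicator_def null_sets_def emeasure_eq_measure)
    then have "(LINT z|M. indicator A z * f z) = 0" by (rule integral_eq_zero_AE)
    with True show ?thesis by simp
  next
    case False
    have "\<bar>Linf_embed M f (discrete A)\<bar> \<le> c"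
      using norm_bounded[of "Linf_embed M f" "discrete A"] le by simp
    moreover have "measure M A > 0" using False by (simp add: zero_less_measure_iff)
    ultimately show ?thesis
      by (simp add: Linf_embed_apply[OF f] discrete_inverse pos_divide_le_eq)
  qed
  have "(\<lambda>z. - f z) \<in> bounded_measurable M"
    using bounded_measurable_linear[OF f f, of "-1" 0] by simp
  moreover have "(LINT z|M. indicator A z * - f z) \<le> c * measure M A" if "A \<in> sets M" for A
    using avg[OF that] by simp
  ultimately have "AE z in M. - f z \<le> c" by (rule AE_le_if_averages_le)
  moreover have "AE z in M. f z \<le> c"
    by (rule AE_le_if_averages_le[OF f]) (use avg in \<open>force\<close>)
  ultimately show "AE z in M. \<bar>f z\<bar> \<le> c" by eventually_elim auto
qed

lemma AE_le_norm_Linf_embed: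
  assumes "f \<in> bounded_measurable M" "g \<in> bounded_measurable M"
  shows "AE z in M. \<bar>f z - g z\<bar> \<le> norm (Linf_embed M f - Linf_embed M g)"
  using norm_Linf_embed_le_iff[OF bounded_measurable_diff[OF assms],
    of "norm (Linf_embed M f - Linf_embed M g)"] Linf_embed_diff[OF assms] by simp

lemma Linf_embed_eq_iff:
  assumes "f \<in> bounded_measurable M" "g \<in> bounded_measurable M"
  shows "Linf_embed M f = Linf_embed M g \<longleftrightarrow> (AE z in M. f z = g z)"
  using norm_Linf_embed_le_iff[OF bounded_measurable_diff[OF assms], of 0] Linf_embed_diff[OF assms]
  by simp

end

lemma Linf_norm_eq:
  assumes "prob_space M" and f: "f \<in> bounded_measurable (M \<Otimes>\<^sub>M M)"
  shows "Linf_norm M f = ereal (norm (Linf_embed (M \<Otimes>\<^sub>M M) f))"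
proof -
  interpret M: prob_space M by fact
  interpret P: pair_prob_space M M ..
  have [measurable]: "f \<in> borel_measurable (M \<Otimes>\<^sub>M M)" using f by (simp add: bounded_measurable_def)
  let ?c = "norm (Linf_embed (M \<Otimes>\<^sub>M M) f)"
  show ?thesis
  proof (rule antisym)
    show "Linf_norm M f \<le> ereal ?c"
      unfolding Linf_norm_def using P.norm_Linf_embed_le_iff[OF f, of ?c] by (intro esssup_I) auto
    have AE: "AE z in M \<Otimes>\<^sub>M M. ereal \<bar>f z\<bar> \<le> Linf_norm M f"
      unfolding Linf_norm_def by (rule esssup_AE)
    \<comment> \<open>On a probability space a constant statement that holds almost everywhere is
      true. This excludes the value minus infinity in the case distinction below.\<close>
    then have "AE z in M \<Otimes>\<^sub>M M. 0 \<le> Linf_norm M f"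
      by eventually_elim (meson abs_ge_zero ereal_less_eq(5) order_trans)
    then have "Linf_norm M f \<ge> 0" by simp
    then show "ereal ?c \<le> Linf_norm M f"
    proof (cases "Linf_norm M f")
      case (real r)
      with AE \<open>Linf_norm M f \<ge> 0\<close> show ?thesis using P.norm_Linf_embed_le_iff[OF f, of r] by simp
    qed auto
  qed
qed

section \<open>The closed subspace of kernel classes\<close>

definition kernel_space :: "'a measure \<Rightarrow> (('a \<times> 'a) set discrete \<Rightarrow>\<^sub>C real) set" where
  "kernel_space M = Linf_embed (M \<Otimes>\<^sub>M M) ` {W. is_kernel M W}"

lemma kernel_bounded_measurable: "is_kernel M W \<Longrightarrow> W \<in> bounded_measurable (M \<Otimes>\<^sub>M M)"
  by (auto simp: is_kernel_def bounded_measurable_def space_pair_measure)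

lemma is_kernel_linear:
  assumes "is_kernel M U" "is_kernel M W"
  shows "is_kernel M (\<lambda>z. a * U z + b * W z)"
  using bounded_measurable_linear[OF assms[THEN kernel_bounded_measurable], of a b] assms
  by (auto simp: is_kernel_def bounded_measurable_def space_pair_measure)

lemma subspace_kernel_space:
  assumes "prob_space M"
  shows "subspace (kernel_space M)"
proof -
  interpret M: prob_space M by fact
  interpret P: pair_prob_space M M ..
  note linear = P.Linf_embed_linear[OF kernel_bounded_measurable kernel_bounded_measurable]
  have comb: "a *\<^sub>R u + b *\<^sub>R v \<in> kernel_space M" if "u \<in> kernel_space M" "v \<in> kernel_space M" for a b u v
  proof -
    from that obtain U W where "is_kernel M U" "is_kernel M W"
      and uv: "u = Linf_embed (M \<Otimes>\<^sub>M M) U" "v = Linf_embed (M \<Otimes>\<^sub>M M) W"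
      by (auto simp: kernel_space_def)
    then show ?thesis
      unfolding kernel_space_def uv linear[OF \<open>is_kernel M U\<close> \<open>is_kernel M W\<close>, symmetric]
      by (intro imageI) (simp add: is_kernel_linear)
  qed
  have "is_kernel M (\<lambda>_. 0)" by (auto simp: is_kernel_def)
  then obtain u where u: "u \<in> kernel_space M" by (auto simp: kernel_space_def)
  show ?thesis
    unfolding subspace_def using comb[OF u u, of 0 0] comb[of _ _ 1 1] comb[of _ _ _ 0] by auto
qed

text \<open>As in the proof that L-infinity is complete: off one null set the representatives are
  uniformly bounded and uniformly Cauchy, since only countably many conditions are involved. The
  additional point is to find a limit that is bounded and symmetric everywhere.\<close>

lemma closed_kernel_space:
  assumes "prob_space M"
  shows "closed (kernel_space M)"
  unfolding closed_sequential_limits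
proof (intro allI impI, elim conjE)
  interpret M: prob_space M by fact
  interpret P: pair_prob_space M M ..
  let ?N = "M \<Otimes>\<^sub>M M" and ?J = "Linf_embed (M \<Otimes>\<^sub>M M)"
  fix x l assume "\<forall>n. x n \<in> kernel_space M" and lim: "x \<longlonglongrightarrow> l"
  then have "\<forall>n. \<exists>W. is_kernel M W \<and> x n = ?J W" unfolding kernel_space_def by blast
  then obtain W where W: "\<And>n. is_kernel M (W n)" "\<And>n. x n = ?J (W n)" by metis
  note bm = kernel_bounded_measurable[OF W(1)]
  have [measurable]: "W n \<in> borel_measurable ?N" for n using bm[of n] by (simp add: bounded_measurable_def)
  obtain C where "C > 0" and C: "\<And>n. norm (x n) \<le> C"
    using convergent_imp_Bseq[OF convergentI[OF lim]] by (auto simp: Bseq_def)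
  have "AE z in ?N. \<forall>n. \<bar>W n z\<bar> \<le> C"
    using C W(2) P.norm_Linf_embed_le_iff[OF bm] \<open>C > 0\<close> by (auto simp: AE_all_countable)
  moreover have "AE z in ?N. \<forall>n m. \<bar>W n z - W m z\<bar> \<le> norm (x n - x m)"
    using P.AE_le_norm_Linf_embed[OF bm bm] W(2) by (auto simp: AE_all_countable)
  ultimately have good: "AE z in ?N. (\<forall>n. \<bar>W n z\<bar> \<le> C) \<and> (\<forall>n m. \<bar>W n z - W m z\<bar> \<le> norm (x n - x m))"
    by (rule AE_conjI)
  \<comment> \<open>\<open>lim\<close> has some value even where the sequence diverges. Truncation
    then makes \<open>U\<close> bounded everywhere, and symmetry holds everywhere because mirrored
    points have the same sequence of values. Where the sequence converges within the bounds,
    truncation changes nothing.\<close>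
  define U where "U z = max (- C) (min C (lim (\<lambda>n. W n z)))" for z
  have "Cauchy x" using lim by (rule LIMSEQ_imp_Cauchy)
  have conv: "(\<lambda>n. W n z) \<longlonglongrightarrow> U z"
    if z: "\<forall>n. \<bar>W n z\<bar> \<le> C" "\<forall>n m. \<bar>W n z - W m z\<bar> \<le> norm (x n - x m)" for z
  proof -
    have "Cauchy (\<lambda>n. W n z)"
      unfolding Cauchy_def dist_real_def
    proof (intro allI impI)
      fix e :: real assume "e > 0"
      with \<open>Cauchy x\<close> obtain n0 where "\<And>m n. m \<ge> n0 \<Longrightarrow> n \<ge> n0 \<Longrightarrow> norm (x m - x n) < e"
        unfolding Cauchy_def dist_norm by blast
      then show "\<exists>n0. \<forall>m\<ge>n0. \<forall>n\<ge>n0. \<bar>W m z - W n z\<bar> < e"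
        using z(2) le_less_trans by blast
    qed
    then have L: "(\<lambda>n. W n z) \<longlonglongrightarrow> lim (\<lambda>n. W n z)"
      by (simp add: Cauchy_convergent_iff convergent_LIMSEQ_iff)
    have "lim (\<lambda>n. W n z) \<le> C" "- C \<le> lim (\<lambda>n. W n z)"
      using z(1) by (auto intro!: LIMSEQ_le_const2[OF L] LIMSEQ_le_const[OF L] simp: abs_le_iff minus_le_iff)
    then show ?thesis using L by (simp add: U_def min_def max_def)
  qed
  have U: "is_kernel M U"
    unfolding is_kernel_def
  proof (intro conjI ballI exI)
    show "U \<in> borel_measurable ?N" unfolding U_def by measurable
    show "\<bar>U (a, b)\<bar> \<le> C" for a b using \<open>C > 0\<close> by (auto simp: U_def)
    show "U (a, b) = U (b, a)" if "a \<in> space M" "b \<in> space M" for a b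
      using W(1) that by (simp add: U_def is_kernel_def)
  qed
  have "x \<longlonglongrightarrow> ?J U"
    unfolding LIMSEQ_iff
  proof (intro allI impI)
    fix e :: real assume "e > 0"
    with \<open>Cauchy x\<close> obtain n0 where n0: "\<And>m n. m \<ge> n0 \<Longrightarrow> n \<ge> n0 \<Longrightarrow> norm (x m - x n) < e / 2"
      unfolding Cauchy_def dist_norm by (meson half_gt_zero)
    have "norm (x n - ?J U) < e" if "n \<ge> n0" for n
    proof -
      have "AE z in ?N. \<bar>W n z - U z\<bar> \<le> e / 2"
        using good
      proof eventually_elim
        case (elim z)
        have "(\<lambda>m. \<bar>W n z - W m z\<bar>) \<longlonglongrightarrow> \<bar>W n z - U z\<bar>"
          using conv[of z] elim by (intro tendsto_intros) auto
        then show ?case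
        proof (rule LIMSEQ_le_const2, intro exI allI impI)
          fix m assume "m \<ge> n0"
          then have "norm (x n - x m) < e / 2" using n0 that by blast
          with elim show "\<bar>W n z - W m z\<bar> \<le> e / 2" by (meson le_less_trans less_imp_le)
        qed
      qed
      then have "norm (?J (\<lambda>z. W n z - U z)) \<le> e / 2"
        using \<open>e > 0\<close> bounded_measurable_diff[OF bm kernel_bounded_measurable[OF U]]
        by (subst P.norm_Linf_embed_le_iff) auto
      then show ?thesis
        using \<open>e > 0\<close> P.Linf_embed_diff[OF bm kernel_bounded_measurable[OF U]] by (simp add: W(2))
    qed
    then show "\<exists>n0. \<forall>n\<ge>n0. norm (x n - ?J U) < e" by blast
  qed
  with lim have "l = ?J U" by (rule LIMSEQ_unique)
  with U show "l \<in> kernel_space M" by (simp add: kernel_space_def)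
qed

text \<open>The values of \<Phi> need to be kernels near \<open>t\<close>, because only for bounded
  measurable functions is \<open>Linf_norm\<close> known to be the norm of the embedding. Then both
  sides are the same limit of difference quotients.\<close>

lemma has_Linf_derivative_iff:
  assumes "prob_space M" and ev: "\<forall>\<^sub>F h in at 0. is_kernel M (\<Phi> (t + h))"
    and \<Phi>t: "is_kernel M (\<Phi> t)" and V: "is_kernel M V"
  shows "has_Linf_derivative M \<Phi> V t \<longleftrightarrow>
    ((\<lambda>s. Linf_embed (M \<Otimes>\<^sub>M M) (\<Phi> s)) has_vector_derivative Linf_embed (M \<Otimes>\<^sub>M M) V) (at t)"
proof -
  interpret M: prob_space M by fact
  interpret P: pair_prob_space M M ..
  let ?J = "Linf_embed (M \<Otimes>\<^sub>M M)"
  note bm = kernel_bounded_measurable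
  have eq: "Linf_norm M (\<lambda>z. (\<Phi> (t + h) z - \<Phi> t z) / h - V z) =
      ereal (norm (?J (\<Phi> (t + h)) - ?J (\<Phi> t) - h *\<^sub>R ?J V) / norm h)"
    if h: "is_kernel M (\<Phi> (t + h))" "h \<noteq> 0" for h
  proof -
    have d: "(\<lambda>z. \<Phi> (t + h) z - \<Phi> t z) \<in> bounded_measurable (M \<Otimes>\<^sub>M M)"
      using h \<Phi>t by (intro bounded_measurable_diff bm)
    have "(\<lambda>z. (\<Phi> (t + h) z - \<Phi> t z) / h - V z) =
        (\<lambda>z. (1 / h) * (\<Phi> (t + h) z - \<Phi> t z) + (- 1) * V z)" by auto
    moreover have "\<dots> \<in> bounded_measurable (M \<Otimes>\<^sub>M M)"
      by (rule bounded_measurable_linear[OF d bm[OF V]])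
    ultimately have "Linf_norm M (\<lambda>z. (\<Phi> (t + h) z - \<Phi> t z) / h - V z) =
        ereal (norm (?J (\<lambda>z. (1 / h) * (\<Phi> (t + h) z - \<Phi> t z) + (- 1) * V z)))"
      using Linf_norm_eq[OF assms(1)] by simp
    also have "?J (\<lambda>z. (1 / h) * (\<Phi> (t + h) z - \<Phi> t z) + (- 1) * V z) =
        (1 / h) *\<^sub>R (?J (\<Phi> (t + h)) - ?J (\<Phi> t)) + (- 1) *\<^sub>R ?J V"
      by (simp only: P.Linf_embed_linear[OF d bm[OF V]] P.Linf_embed_diff[OF bm[OF h(1)] bm[OF \<Phi>t]])
    also have "\<dots> = (1 / h) *\<^sub>R (?J (\<Phi> (t + h)) - ?J (\<Phi> t) - h *\<^sub>R ?J V)"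
      using h(2) by (simp add: scaleR_diff_right)
    finally show ?thesis using h(2) by (simp add: divide_inverse_commute)
  qed
  have "has_Linf_derivative M \<Phi> V t \<longleftrightarrow>
      ((\<lambda>h. ereal (norm (?J (\<Phi> (t + h)) - ?J (\<Phi> t) - h *\<^sub>R ?J V) / norm h)) \<longlongrightarrow> ereal 0) (at 0)"
    unfolding has_Linf_derivative_def zero_ereal_def
  proof (rule tendsto_cong)
    have "\<forall>\<^sub>F h in at 0. h \<noteq> (0::real)" by (simp add: eventually_at_filter)
    with ev show "\<forall>\<^sub>F h in at 0. Linf_norm M (\<lambda>z. (\<Phi> (t + h) z - \<Phi> t z) / h - V z) =
      ereal (norm (?J (\<Phi> (t + h)) - ?J (\<Phi> t) - h *\<^sub>R ?J V) / norm h)"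
      by eventually_elim (rule eq)
  qed
  also have "\<dots> \<longleftrightarrow> ((\<lambda>s. ?J (\<Phi> s)) has_vector_derivative ?J V) (at t)"
    by (simp add: has_vector_derivative_def has_derivative_at bounded_linear_scaleR_left)
  finally show ?thesis .
qed

section \<open>The velocity operator\<close>

definition vertex_pairs :: "nat \<Rightarrow> (nat \<times> nat) set" where
  "vertex_pairs k = {(i, j). i \<in> {1..k} \<and> j \<in> {1..k} \<and> i < j}"

definition induced_weight :: "nat \<Rightarrow> lgraph \<Rightarrow> 'a kern \<Rightarrow> (nat \<Rightarrow> 'a) \<Rightarrow> real" where
  "induced_weight k F W z =
     (\<Prod>(i, j)\<in>vertex_pairs k. if {i, j} \<in> F then W (z i, z j) else 1 - W (z i, z j))"

lemma finite_vertex_pairs: "finite (vertex_pairs k)"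
  by (rule finite_subset[of _ "{1..k} \<times> {1..k}"]) (auto simp: vertex_pairs_def)

lemma vertex_pairsD: "(i, j) \<in> vertex_pairs k \<Longrightarrow> i \<in> {1..k} \<and> j \<in> {1..k} \<and> i \<noteq> j"
  by (auto simp: vertex_pairs_def)

lemma finite_labelled_graphs: "finite (labelled_graphs k)"
  unfolding labelled_graphs_def
  by (rule finite_Pow_iff[THEN iffD2], rule finite_subset[of _ "Pow {1..k}"]) auto

lemma finite_rooted_graphs: "finite (rooted_graphs k)"
  unfolding rooted_graphs_def
  by (intro finite_cartesian_product finite_labelled_graphs, rule finite_subset[of _ "{1..k} \<times> {1..k}"]) auto

lemma rooted_op_eq:
  "rooted_op M k (F, a, b) W (x, y) =
     (LINT v|(\<Pi>\<^sub>M i\<in>{1..k} - {a, b}. M). induced_weight k F W (v(a := x, b := y)))"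
  by (simp add: rooted_op_def induced_weight_def vertex_pairs_def Let_def)

lemma rooted_op_swap:
  "a \<noteq> b \<Longrightarrow> rooted_op M k (F, a, b) W (x, y) = rooted_op M k (F, b, a) W (y, x)"
  by (simp add: rooted_op_eq fun_upd_twist insert_commute)

lemma flip_coeff_swap: "flip_coeff k R (F, a, b) = flip_coeff k R (F, b, a)"
  by (simp add: flip_coeff_def insert_commute)

text \<open>A single \<open>rooted_op\<close> need not yield a symmetric function. Exchanging the
  two roots permutes the rooted graphs, keeps \<open>flip_coeff\<close> and mirrors the operator, so
  the sum is symmetric.\<close>

lemma velocity_symmetric: "velocity M k R W (x, y) = velocity M k R W (y, x)"
  unfolding velocity_def
  by (rule sum.reindex_bij_witness[where i = "\<lambda>(F, a, b). (F, b, a)" and j = "\<lambda>(F, a, b). (F, b, a)"])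
    (auto simp: rooted_graphs_def flip_coeff_swap intro: rooted_op_swap)

text \<open>Dividing every factor by \<open>B\<close> brings it into the unit interval around 0,
  where the difference of two products is at most the sum of the differences of the factors.\<close>

lemma abs_prod_diff_le:
  fixes f g :: "'i \<Rightarrow> real"
  assumes "B > 0" and "\<And>i. i \<in> I \<Longrightarrow> \<bar>f i\<bar> \<le> B" "\<And>i. i \<in> I \<Longrightarrow> \<bar>g i\<bar> \<le> B"
    and "\<And>i. i \<in> I \<Longrightarrow> \<bar>f i - g i\<bar> \<le> d"
  shows "\<bar>prod f I - prod g I\<bar> \<le> B ^ card I * (card I * (d / B))"
proof -
  have "norm ((\<Prod>i\<in>I. f i / B) - (\<Prod>i\<in>I. g i / B)) \<le> (\<Sum>i\<in>I. norm (f i / B - g i / B))"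
    using assms by (intro norm_prod_diff) auto
  also have "\<dots> \<le> (\<Sum>i\<in>I. d / B)"
    using assms by (intro sum_mono) (auto simp: diff_divide_distrib[symmetric] divide_right_mono)
  finally have *: "\<bar>(\<Prod>i\<in>I. f i / B) - (\<Prod>i\<in>I. g i / B)\<bar> \<le> card I * (d / B)" by simp
  have scale: "prod f I = B ^ card I * (\<Prod>i\<in>I. f i / B)" "prod g I = B ^ card I * (\<Prod>i\<in>I. g i / B)"
    using \<open>B > 0\<close> by (simp_all add: prod_dividef)
  have "\<bar>prod f I - prod g I\<bar> = \<bar>B ^ card I\<bar> * \<bar>(\<Prod>i\<in>I. f i / B) - (\<Prod>i\<in>I. g i / B)\<bar>"
    unfolding scale right_diff_distrib[symmetric] abs_mult ..
  with mult_left_mono[OF *, of "B ^ card I"] \<open>B > 0\<close> show ?thesis by simp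
qed

text \<open>Each factor is a value of the kernel or 1 minus it, so its modulus is at most
  \<open>1 + C\<close>, and passing from \<open>U\<close> to \<open>W\<close> changes it by at most
  \<open>d\<close>.\<close>

lemma induced_weight_diff_le:
  assumes "C \<ge> 0"
    and "\<And>i j. (i, j) \<in> vertex_pairs k \<Longrightarrow> \<bar>U (z i, z j)\<bar> \<le> C \<and> \<bar>W (z i, z j)\<bar> \<le> C \<and>
      \<bar>U (z i, z j) - W (z i, z j)\<bar> \<le> d"
  shows "\<bar>induced_weight k F U z - induced_weight k F W z\<bar> \<le>
    ((1 + C) ^ card (vertex_pairs k) * (card (vertex_pairs k) / (1 + C))) * d"
proof -
  let ?f = "\<lambda>U (i, j). if {i, j} \<in> F then U (z i, z j) else 1 - U (z i, z j)"
  have *: "\<bar>?f U p\<bar> \<le> 1 + C \<and> \<bar>?f W p\<bar> \<le> 1 + C \<and> \<bar>?f U p - ?f W p\<bar> \<le> d" if "p \<in> vertex_pairs k" for p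
  proof -
    obtain i j where p: "p = (i, j)" by (cases p)
    from assms(2)[of i j] that \<open>C \<ge> 0\<close> show ?thesis by (auto simp: p abs_minus_commute)
  qed
  have "\<bar>prod (?f U) (vertex_pairs k) - prod (?f W) (vertex_pairs k)\<bar> \<le>
      (1 + C) ^ card (vertex_pairs k) * (card (vertex_pairs k) * (d / (1 + C)))"
    by (rule abs_prod_diff_le) (use * \<open>C \<ge> 0\<close> in auto)
  then have "\<bar>induced_weight k F U z - induced_weight k F W z\<bar> \<le>
      (1 + C) ^ card (vertex_pairs k) * (card (vertex_pairs k) * (d / (1 + C)))"
    by (simp add: induced_weight_def)
  then show ?thesis by simp
qed

lemma induced_weight_le:
  assumes "C \<ge> 0" and "\<And>i j. (i, j) \<in> vertex_pairs k \<Longrightarrow> \<bar>W (z i, z j)\<bar> \<le> C"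
  shows "\<bar>induced_weight k F W z\<bar> \<le> (1 + C) ^ card (vertex_pairs k)"
proof -
  have "\<bar>induced_weight k F W z\<bar> =
      (\<Prod>p\<in>vertex_pairs k. \<bar>case p of (i, j) \<Rightarrow> if {i, j} \<in> F then W (z i, z j) else 1 - W (z i, z j)\<bar>)"
    unfolding induced_weight_def by (rule abs_prod)
  also have "\<dots> \<le> (\<Prod>p\<in>vertex_pairs k. 1 + C)"
  proof (rule prod_mono, clarify, intro conjI)
    fix i j assume "(i, j) \<in> vertex_pairs k"
    from assms(2)[OF this] \<open>C \<ge> 0\<close>
    show "\<bar>if {i, j} \<in> F then W (z i, z j) else 1 - W (z i, z j)\<bar> \<le> 1 + C" by auto
  qed simp
  finally show ?thesis by simp
qed

lemma kernel_bound:
  assumes "is_kernel M W"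
  obtains C where "\<forall>x\<in>space M. \<forall>y\<in>space M. \<bar>W (x, y)\<bar> \<le> C" "C \<ge> 0"
proof -
  from assms obtain C where C: "\<forall>x\<in>space M. \<forall>y\<in>space M. \<bar>W (x, y)\<bar> \<le> C" unfolding is_kernel_def by blast
  show thesis by (rule that[of "max C 0"]) (use C in \<open>auto simp: le_max_iff_disj\<close>)
qed

section \<open>Fubini for the roots and the Lipschitz bound of the velocity\<close>

context prob_space
begin

text \<open>Separates the two roots from the free vertices. A statement about almost every
  assignment of all vertices becomes one about almost every pair of roots and almost every
  assignment of the rest. It suffices to compare the measures on boxes.\<close>

lemma distr_PiM_insert_two:
  assumes "finite I" "a \<notin> I" "b \<notin> I" "a \<noteq> b"
  defines "f \<equiv> \<lambda>(p, v). (v(a := fst p, b := snd p))"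
  shows "f \<in> (M \<Otimes>\<^sub>M M) \<Otimes>\<^sub>M (\<Pi>\<^sub>M i\<in>I. M) \<rightarrow>\<^sub>M (\<Pi>\<^sub>M i\<in>insert b (insert a I). M)"
    and "distr ((M \<Otimes>\<^sub>M M) \<Otimes>\<^sub>M (\<Pi>\<^sub>M i\<in>I. M)) (\<Pi>\<^sub>M i\<in>insert b (insert a I). M) f =
      (\<Pi>\<^sub>M i\<in>insert b (insert a I). M)"
proof -
  interpret P: product_prob_space "\<lambda>_. M" UNIV by standard
  interpret MM: pair_prob_space M M ..
  interpret I: prob_space "\<Pi>\<^sub>M i\<in>I. M" by (intro prob_space_PiM prob_space_axioms)
  let ?N = "(M \<Otimes>\<^sub>M M) \<Otimes>\<^sub>M (\<Pi>\<^sub>M i\<in>I. M)" and ?K = "insert b (insert a I)"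
  show f: "f \<in> ?N \<rightarrow>\<^sub>M (\<Pi>\<^sub>M i\<in>?K. M)"
    unfolding f_def case_prod_beta
    by (rule measurable_fun_upd[where J = "insert a I"], simp, rule measurable_fun_upd[where J = I]) auto
  show "distr ?N (\<Pi>\<^sub>M i\<in>?K. M) f = (\<Pi>\<^sub>M i\<in>?K. M)"
  proof (rule P.PiM_eqI)
    fix A assume "\<And>i. i \<in> ?K \<Longrightarrow> A i \<in> sets M"
    then have A: "A a \<in> sets M" "A b \<in> sets M" "\<And>i. i \<in> I \<Longrightarrow> A i \<in> sets M"
      and sub: "\<And>i. i \<in> ?K \<Longrightarrow> A i \<subseteq> space M" by (auto dest: sets.sets_into_space)
    have "f -` (Pi\<^sub>E ?K A) \<inter> space ?N = (A a \<times> A b) \<times> Pi\<^sub>E I A"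
    proof (intro set_eqI iffI)
      fix p assume "p \<in> f -` (Pi\<^sub>E ?K A) \<inter> space ?N"
      then have p': "f p \<in> Pi\<^sub>E ?K A" "p \<in> space ?N" by auto
      obtain x y v where p_eq: "p = ((x, y), v)" by (metis surj_pair)
      have p: "p = ((x, y), v)" "v(a := x, b := y) \<in> Pi\<^sub>E ?K A" "v \<in> extensional I"
        using p' by (simp_all add: p_eq f_def space_pair_measure space_PiM PiE_def)
      have *: "(v(a := x, b := y)) i \<in> A i" if "i \<in> ?K" for i using p(2) that by (rule PiE_mem)
      have "v i \<in> A i" if "i \<in> I" for i using *[of i] that assms by (auto simp: fun_upd_def split: if_splits)
      then show "p \<in> (A a \<times> A b) \<times> Pi\<^sub>E I A"
        using *[of a] *[of b] p \<open>a \<noteq> b\<close> by (auto simp: PiE_def)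
    next
      fix p assume "p \<in> (A a \<times> A b) \<times> Pi\<^sub>E I A"
      then show "p \<in> f -` (Pi\<^sub>E ?K A) \<inter> space ?N"
        using sub by (auto simp: f_def space_pair_measure space_PiM PiE_def extensional_def Pi_iff subset_eq)
    qed
    moreover have "Pi\<^sub>E ?K A \<in> sets (\<Pi>\<^sub>M i\<in>?K. M)" "Pi\<^sub>E I A \<in> sets (\<Pi>\<^sub>M i\<in>I. M)"
      using A \<open>finite I\<close> by (auto intro!: sets_PiM_I_finite)
    ultimately have "emeasure (distr ?N (\<Pi>\<^sub>M i\<in>?K. M) f) (Pi\<^sub>E ?K A) =
        (emeasure M (A a) * emeasure M (A b)) * emeasure (\<Pi>\<^sub>M i\<in>I. M) (Pi\<^sub>E I A)"
      using A by (simp add: emeasure_distr[OF f] I.emeasure_pair_measure_Times emeasure_pair_measure_Times)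
    also have "emeasure (\<Pi>\<^sub>M i\<in>I. M) (Pi\<^sub>E I A) = (\<Prod>i\<in>I. emeasure M (A i))"
      using A \<open>finite I\<close> by (intro P.emeasure_PiM) auto
    finally show "emeasure (distr ?N (\<Pi>\<^sub>M i\<in>?K. M) f) (Pi\<^sub>E ?K A) = (\<Prod>i\<in>?K. emeasure M (A i))"
      using assms by (simp add: mult_ac)
  qed (use \<open>finite I\<close> in simp_all)
qed

text \<open>Through this marginal, an almost everywhere property of a kernel holds at
  \<open>(z i, z j)\<close> for almost every assignment \<open>z\<close>. Distinctness of
  \<open>i\<close> and \<open>j\<close> is essential, as the diagonal of the square may be
  null.\<close>

lemma distr_PiM_two_components:
  assumes "finite I" "i \<in> I" "j \<in> I" "i \<noteq> j"
  shows "distr (\<Pi>\<^sub>M l\<in>I. M) (M \<Otimes>\<^sub>M M) (\<lambda>z. (z i, z j)) = M \<Otimes>\<^sub>M M"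
proof (rule pair_measure_eqI[symmetric])
  interpret P: product_prob_space "\<lambda>_. M" UNIV by standard
  have meas: "(\<lambda>z. (z i, z j)) \<in> (\<Pi>\<^sub>M l\<in>I. M) \<rightarrow>\<^sub>M M \<Otimes>\<^sub>M M"
    using assms by (intro measurable_Pair measurable_component_singleton)
  show "sigma_finite_measure M" ..
  show "sigma_finite_measure M" ..
  fix A B assume AB: "A \<in> sets M" "B \<in> sets M"
  let ?E = "\<lambda>l. if l = i then A else if l = j then B else space M"
  have "(\<lambda>z. (z i, z j)) -` (A \<times> B) \<inter> space (\<Pi>\<^sub>M l\<in>I. M) = Pi\<^sub>E I ?E"
    using assms AB[THEN sets.sets_into_space]
    by (auto simp: space_PiM PiE_def Pi_iff split: if_splits) (metis subsetD)
  then have "emeasure (distr (\<Pi>\<^sub>M l\<in>I. M) (M \<Otimes>\<^sub>M M) (\<lambda>z. (z i, z j))) (A \<times> B) =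
      emeasure (\<Pi>\<^sub>M l\<in>I. M) (Pi\<^sub>E I ?E)"
    using AB by (simp add: emeasure_distr[OF meas])
  also have "\<dots> = (\<Prod>l\<in>I. emeasure M (?E l))"
    using AB \<open>finite I\<close> by (intro P.emeasure_PiM) auto
  also have "\<dots> = emeasure M A * (emeasure M B * (\<Prod>l\<in>I - {i} - {j}. emeasure M (?E l)))"
    using assms by (simp add: prod.remove[of I i] prod.remove[of "I - {i}" j])
  also have "(\<Prod>l\<in>I - {i} - {j}. emeasure M (?E l)) = 1"
    by (rule prod.neutral) (auto simp: emeasure_space_1)
  finally show "emeasure M A * emeasure M B = emeasure (distr (\<Pi>\<^sub>M l\<in>I. M) (M \<Otimes>\<^sub>M M) (\<lambda>z. (z i, z j))) (A \<times> B)"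
    by simp
qed simp

lemma induced_weight_measurable:
  assumes "W \<in> borel_measurable (M \<Otimes>\<^sub>M M)"
  shows "induced_weight k F W \<in> borel_measurable (\<Pi>\<^sub>M i\<in>{1..k}. M)"
  unfolding induced_weight_def
proof (rule borel_measurable_prod, clarify)
  fix i j assume "(i, j) \<in> vertex_pairs k"
  then have "(\<lambda>z. (z i, z j)) \<in> (\<Pi>\<^sub>M i\<in>{1..k}. M) \<rightarrow>\<^sub>M M \<Otimes>\<^sub>M M"
    by (intro measurable_Pair measurable_component_singleton) (auto dest: vertex_pairsD)
  from measurable_compose[OF this assms]
  show "(\<lambda>z. if {i, j} \<in> F then W (z i, z j) else 1 - W (z i, z j)) \<in> borel_measurable (\<Pi>\<^sub>M i\<in>{1..k}. M)"
    by auto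
qed

lemma rooted_vertices:
  assumes "(F, a, b) \<in> rooted_graphs k"
  shows "insert b (insert a ({1..k} - {a, b})) = {1..k}" "a \<noteq> b" "a \<in> {1..k}" "b \<in> {1..k}"
  using assms by (auto simp: rooted_graphs_def)

lemma distr_PiM_roots:
  assumes X: "(F, a, b) \<in> rooted_graphs k"
  shows "(\<lambda>(p, v). v(a := fst p, b := snd p)) \<in>
      (M \<Otimes>\<^sub>M M) \<Otimes>\<^sub>M (\<Pi>\<^sub>M i\<in>{1..k} - {a, b}. M) \<rightarrow>\<^sub>M (\<Pi>\<^sub>M i\<in>{1..k}. M)"
    and "distr ((M \<Otimes>\<^sub>M M) \<Otimes>\<^sub>M (\<Pi>\<^sub>M i\<in>{1..k} - {a, b}. M)) (\<Pi>\<^sub>M i\<in>{1..k}. M)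
      (\<lambda>(p, v). v(a := fst p, b := snd p)) = (\<Pi>\<^sub>M i\<in>{1..k}. M)"
  by (rule distr_PiM_insert_two[of "{1..k} - {a, b}" a b, unfolded rooted_vertices(1)[OF X]];
    use rooted_vertices(2)[OF X] in simp)+

lemma rooted_integrand_measurable:
  assumes X: "(F, a, b) \<in> rooted_graphs k" and W: "W \<in> borel_measurable (M \<Otimes>\<^sub>M M)"
  shows "(\<lambda>(p, v). induced_weight k F W (v(a := fst p, b := snd p))) \<in>
    borel_measurable ((M \<Otimes>\<^sub>M M) \<Otimes>\<^sub>M (\<Pi>\<^sub>M i\<in>{1..k} - {a, b}. M))"
  using measurable_compose[OF distr_PiM_roots(1)[OF X] induced_weight_measurable[OF W, of k F]]
  by (simp add: case_prod_beta)

lemma rooted_integrand_bound: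
  assumes X: "(F, a, b) \<in> rooted_graphs k"
    and C: "\<forall>x\<in>space M. \<forall>y\<in>space M. \<bar>W (x, y)\<bar> \<le> C" "C \<ge> 0"
    and p: "p \<in> space (M \<Otimes>\<^sub>M M)" and v: "v \<in> space (\<Pi>\<^sub>M i\<in>{1..k} - {a, b}. M)"
  shows "\<bar>induced_weight k F W (v(a := fst p, b := snd p))\<bar> \<le> (1 + C) ^ card (vertex_pairs k)"
proof (rule induced_weight_le[OF C(2)])
  fix i j assume ij: "(i, j) \<in> vertex_pairs k"
  have "(v(a := fst p, b := snd p)) l \<in> space M" if "l \<in> {1..k}" for l
    using that p v by (auto simp: space_pair_measure space_PiM PiE_def Pi_iff)
  then show "\<bar>W ((v(a := fst p, b := snd p)) i, (v(a := fst p, b := snd p)) j)\<bar> \<le> C"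
    using vertex_pairsD[OF ij] C(1) by blast
qed

lemma rooted_integrand_integrable:
  assumes X: "(F, a, b) \<in> rooted_graphs k" and W: "is_kernel M W" and p: "p \<in> space (M \<Otimes>\<^sub>M M)"
  shows "integrable (\<Pi>\<^sub>M i\<in>{1..k} - {a, b}. M) (\<lambda>v. induced_weight k F W (v(a := fst p, b := snd p)))"
proof -
  interpret I: prob_space "\<Pi>\<^sub>M i\<in>{1..k} - {a, b}. M" by (intro prob_space_PiM prob_space_axioms)
  obtain C where C: "\<forall>x\<in>space M. \<forall>y\<in>space M. \<bar>W (x, y)\<bar> \<le> C" "C \<ge> 0"
    using kernel_bound[OF W] by blast
  have W': "W \<in> borel_measurable (M \<Otimes>\<^sub>M M)" using W by (simp add: is_kernel_def)
  show ?thesis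
  proof (rule I.integrable_const_bound)
    show "AE v in \<Pi>\<^sub>M i\<in>{1..k} - {a, b}. M.
        norm (induced_weight k F W (v(a := fst p, b := snd p))) \<le> (1 + C) ^ card (vertex_pairs k)"
      using rooted_integrand_bound[OF X C p] by (intro AE_I2) simp
    show "(\<lambda>v. induced_weight k F W (v(a := fst p, b := snd p))) \<in> borel_measurable (\<Pi>\<^sub>M i\<in>{1..k} - {a, b}. M)"
      using measurable_compose[OF measurable_Pair1'[OF p] rooted_integrand_measurable[OF X W']] by simp
  qed
qed

lemma rooted_op_bounded_measurable:
  assumes X: "X \<in> rooted_graphs k" and W: "is_kernel M W"
  shows "rooted_op M k X W \<in> bounded_measurable (M \<Otimes>\<^sub>M M)"
proof -
  obtain F a b where X_eq: "X = (F, a, b)" by (cases X)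
  note X = X[unfolded X_eq]
  interpret I: prob_space "\<Pi>\<^sub>M i\<in>{1..k} - {a, b}. M" by (intro prob_space_PiM prob_space_axioms)
  obtain C where C: "\<forall>x\<in>space M. \<forall>y\<in>space M. \<bar>W (x, y)\<bar> \<le> C" "C \<ge> 0"
    using kernel_bound[OF W] by blast
  have W': "W \<in> borel_measurable (M \<Otimes>\<^sub>M M)" using W by (simp add: is_kernel_def)
  have eq: "rooted_op M k X W =
      (\<lambda>p. LINT v|(\<Pi>\<^sub>M i\<in>{1..k} - {a, b}. M). induced_weight k F W (v(a := fst p, b := snd p)))"
    by (auto simp: X_eq rooted_op_eq fun_eq_iff)
  show ?thesis
    unfolding eq
  proof (rule bounded_measurableI)
    show "(\<lambda>p. LINT v|(\<Pi>\<^sub>M i\<in>{1..k} - {a, b}. M). induced_weight k F W (v(a := fst p, b := snd p)))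
        \<in> borel_measurable (M \<Otimes>\<^sub>M M)"
      by (rule I.borel_measurable_lebesgue_integral[OF rooted_integrand_measurable[OF X W']])
    fix p assume p: "p \<in> space (M \<Otimes>\<^sub>M M)"
    let ?w = "\<lambda>v. induced_weight k F W (v(a := fst p, b := snd p))"
    have "\<bar>LINT v|(\<Pi>\<^sub>M i\<in>{1..k} - {a, b}. M). ?w v\<bar> \<le> (LINT v|(\<Pi>\<^sub>M i\<in>{1..k} - {a, b}. M). \<bar>?w v\<bar>)"
      by (rule integral_abs_bound)
    also have "\<dots> \<le> (1 + C) ^ card (vertex_pairs k)"
      using rooted_integrand_bound[OF X C p]
      by (intro I.integral_le_const integrable_abs rooted_integrand_integrable[OF X W p] AE_I2) simp
    finally show "\<bar>LINT v|(\<Pi>\<^sub>M i\<in>{1..k} - {a, b}. M). ?w v\<bar> \<le> (1 + C) ^ card (vertex_pairs k)" .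
  qed
qed

lemma velocity_is_kernel:
  assumes "is_kernel M W"
  shows "is_kernel M (velocity M k R W)"
proof -
  have "velocity M k R W \<in> bounded_measurable (M \<Otimes>\<^sub>M M)"
    unfolding velocity_def
    by (rule bounded_measurable_sum) (rule rooted_op_bounded_measurable[OF _ assms])
  then show ?thesis
    using velocity_symmetric[of M k R W]
    by (auto simp: is_kernel_def bounded_measurable_def space_pair_measure)
qed

text \<open>The bounds are assumed almost everywhere, while the integral for a fixed pair of roots
  sees a thin set only. They are lifted to the product over all vertices, one pair of vertices at a
  time, combined there into a bound on the weights, and brought back by Fubini to almost every pair
  of roots. With \<open>d = 0\<close> this says that equivalent kernels have equivalent
  images.\<close>

lemma rooted_op_Linf_lipschitz:
  assumes X: "X \<in> rooted_graphs k" and "C \<ge> 0"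
    and U: "is_kernel M U" "AE p in M \<Otimes>\<^sub>M M. \<bar>U p\<bar> \<le> C"
    and W: "is_kernel M W" "AE p in M \<Otimes>\<^sub>M M. \<bar>W p\<bar> \<le> C"
    and d: "AE p in M \<Otimes>\<^sub>M M. \<bar>U p - W p\<bar> \<le> d"
  shows "AE p in M \<Otimes>\<^sub>M M. \<bar>rooted_op M k X U p - rooted_op M k X W p\<bar> \<le>
    ((1 + C) ^ card (vertex_pairs k) * (card (vertex_pairs k) / (1 + C))) * d"
proof -
  obtain F a b where X_eq: "X = (F, a, b)" by (cases X)
  note X = X[unfolded X_eq]
  let ?I = "\<Pi>\<^sub>M i\<in>{1..k} - {a, b}. M" and ?K = "\<Pi>\<^sub>M i\<in>{1..k}. M"
  let ?L = "(1 + C) ^ card (vertex_pairs k) * (card (vertex_pairs k) / (1 + C))"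
  interpret I: prob_space ?I by (intro prob_space_PiM prob_space_axioms)
  interpret MM: pair_prob_space M M ..
  interpret MI: pair_prob_space "M \<Otimes>\<^sub>M M" ?I ..
  let ?u = "\<lambda>v p. v(a := fst p, b := snd p)"
  have AE_p: "AE p in M \<Otimes>\<^sub>M M. \<bar>U p\<bar> \<le> C \<and> \<bar>W p\<bar> \<le> C \<and> \<bar>U p - W p\<bar> \<le> d"
    using U(2) W(2) d by eventually_elim simp
  have *: "AE z in ?K. \<bar>U (z i, z j)\<bar> \<le> C \<and> \<bar>W (z i, z j)\<bar> \<le> C \<and> \<bar>U (z i, z j) - W (z i, z j)\<bar> \<le> d"
    if "(i, j) \<in> vertex_pairs k" for i j
  proof -
    have ij: "i \<in> {1..k}" "j \<in> {1..k}" "i \<noteq> j" using vertex_pairsD[OF that] by auto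
    have "(\<lambda>z. (z i, z j)) \<in> ?K \<rightarrow>\<^sub>M M \<Otimes>\<^sub>M M"
      using ij by (intro measurable_Pair measurable_component_singleton)
    from AE_distrD[OF this, unfolded distr_PiM_two_components[OF finite_atLeastAtMost ij], OF AE_p]
    show ?thesis .
  qed
  have "AE z in ?K. \<forall>(i, j)\<in>vertex_pairs k. \<bar>U (z i, z j)\<bar> \<le> C \<and> \<bar>W (z i, z j)\<bar> \<le> C \<and>
      \<bar>U (z i, z j) - W (z i, z j)\<bar> \<le> d"
    by (rule AE_finite_allI[OF finite_vertex_pairs]) (use * in auto)
  then have AE: "AE z in ?K. \<bar>induced_weight k F U z - induced_weight k F W z\<bar> \<le> ?L * d"
  proof eventually_elim
    case (elim z)
    show ?case by (rule induced_weight_diff_le[OF \<open>C \<ge> 0\<close>]) (use elim in blast)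
  qed
  note upd = distr_PiM_roots[OF X]
  have "AE q in (M \<Otimes>\<^sub>M M) \<Otimes>\<^sub>M ?I. case q of (p, v) \<Rightarrow>
      \<bar>induced_weight k F U (?u v p) - induced_weight k F W (?u v p)\<bar> \<le> ?L * d"
    using AE_distrD[OF upd(1), unfolded upd(2), OF AE] by (simp add: case_prod_beta)
  from MI.AE_pair[OF this]
  have "AE p in M \<Otimes>\<^sub>M M. AE v in ?I.
      \<bar>induced_weight k F U (?u v p) - induced_weight k F W (?u v p)\<bar> \<le> ?L * d"
    by (simp only: prod.case)
  then show ?thesis
    using AE_space
  proof eventually_elim
    case (elim p)
    note int = rooted_integrand_integrable[OF X U(1) elim(2)] rooted_integrand_integrable[OF X W(1) elim(2)]
    have "rooted_op M k X U p - rooted_op M k X W p =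
        (LINT v|?I. induced_weight k F U (?u v p) - induced_weight k F W (?u v p))"
      using int by (cases p) (simp add: X_eq rooted_op_eq)
    then have "\<bar>rooted_op M k X U p - rooted_op M k X W p\<bar> \<le>
        (LINT v|?I. \<bar>induced_weight k F U (?u v p) - induced_weight k F W (?u v p)\<bar>)"
      by (simp only: integral_abs_bound)
    also have "\<dots> \<le> ?L * d"
      using elim(1) int by (intro I.integral_le_const integrable_abs) auto
    finally show ?case .
  qed
qed

lemma velocity_Linf_lipschitz:
  fixes C :: real
  shows "\<exists>L. \<forall>U W. is_kernel M U \<longrightarrow> is_kernel M W \<longrightarrow>
    norm (Linf_embed (M \<Otimes>\<^sub>M M) U) \<le> C \<longrightarrow> norm (Linf_embed (M \<Otimes>\<^sub>M M) W) \<le> C \<longrightarrow>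
    norm (Linf_embed (M \<Otimes>\<^sub>M M) (velocity M k R U) - Linf_embed (M \<Otimes>\<^sub>M M) (velocity M k R W)) \<le>
    L * norm (Linf_embed (M \<Otimes>\<^sub>M M) U - Linf_embed (M \<Otimes>\<^sub>M M) W)"
proof (cases "C \<ge> 0")
  case True
  interpret MM: pair_prob_space M M ..
  let ?J = "Linf_embed (M \<Otimes>\<^sub>M M)"
  define L where "L = (1 + C) ^ card (vertex_pairs k) * (card (vertex_pairs k) / (1 + C))"
  define L' where "L' = (\<Sum>X\<in>rooted_graphs k. \<bar>flip_coeff k R X\<bar> * L)"
  have "L \<ge> 0" using True by (simp add: L_def)
  then have "L' \<ge> 0" by (auto simp: L'_def intro!: sum_nonneg)
  have "norm (?J (velocity M k R U) - ?J (velocity M k R W)) \<le> L' * norm (?J U - ?J W)"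
    if U: "is_kernel M U" "norm (?J U) \<le> C" and W: "is_kernel M W" "norm (?J W) \<le> C" for U W
  proof -
    note bm = kernel_bounded_measurable
    let ?d = "norm (?J U - ?J W)"
    have "AE p in M \<Otimes>\<^sub>M M. \<bar>rooted_op M k X U p - rooted_op M k X W p\<bar> \<le> L * ?d"
      if "X \<in> rooted_graphs k" for X
      unfolding L_def
      using U W True MM.norm_Linf_embed_le_iff[OF bm[OF U(1)]] MM.norm_Linf_embed_le_iff[OF bm[OF W(1)]]
        MM.AE_le_norm_Linf_embed[OF bm[OF U(1)] bm[OF W(1)]]
      by (intro rooted_op_Linf_lipschitz[OF that]) auto
    then have "AE p in M \<Otimes>\<^sub>M M. \<forall>X\<in>rooted_graphs k. \<bar>rooted_op M k X U p - rooted_op M k X W p\<bar> \<le> L * ?d"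
      by (intro AE_finite_allI finite_rooted_graphs)
    then have "AE p in M \<Otimes>\<^sub>M M. \<bar>velocity M k R U p - velocity M k R W p\<bar> \<le> L' * ?d"
    proof eventually_elim
      case (elim p)
      have "\<bar>velocity M k R U p - velocity M k R W p\<bar> =
          \<bar>\<Sum>X\<in>rooted_graphs k. flip_coeff k R X * (rooted_op M k X U p - rooted_op M k X W p)\<bar>"
        by (simp add: velocity_def sum_subtractf right_diff_distrib)
      also have "\<dots> \<le> (\<Sum>X\<in>rooted_graphs k. \<bar>flip_coeff k R X\<bar> * \<bar>rooted_op M k X U p - rooted_op M k X W p\<bar>)"
        unfolding abs_mult[symmetric] by (rule sum_abs)
      also have "\<dots> \<le> (\<Sum>X\<in>rooted_graphs k. \<bar>flip_coeff k R X\<bar> * (L * ?d))"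
        using elim by (intro sum_mono mult_left_mono) auto
      also have "\<dots> = L' * ?d" by (simp add: L'_def sum_distrib_right mult.assoc)
      finally show ?case .
    qed
    moreover note VUW = velocity_is_kernel[OF U(1), THEN bm] velocity_is_kernel[OF W(1), THEN bm]
    ultimately show ?thesis
      using \<open>L' \<ge> 0\<close> MM.norm_Linf_embed_le_iff[OF bounded_measurable_diff[OF VUW], of "L' * ?d"]
        MM.Linf_embed_diff[OF VUW] by simp
  qed
  then show ?thesis by blast
next
  case False
  then show ?thesis by (auto dest: order_trans[OF norm_ge_zero])
qed

end

section \<open>Isomorphism classes of rooted graphs\<close>

lemma rooted_iso_iff:
  "((F, a, b), (G, c, d)) \<in> rooted_iso k \<longleftrightarrow>
     (F, a, b) \<in> rooted_graphs k \<and> (G, c, d) \<in> rooted_graphs k \<and>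
     (\<exists>\<phi>. bij_betw \<phi> {1..k} {1..k} \<and>
        (\<forall>u\<in>{1..k}. \<forall>v\<in>{1..k}. {u, v} \<in> F \<longleftrightarrow> {\<phi> u, \<phi> v} \<in> G) \<and> \<phi> a = c \<and> \<phi> b = d)"
  by (simp add: rooted_iso_def)

lemma rooted_isoE:
  assumes "(X, Y) \<in> rooted_iso k"
  obtains F a b G c d \<phi> where "X = (F, a, b)" "Y = (G, c, d)"
    "(F, a, b) \<in> rooted_graphs k" "(G, c, d) \<in> rooted_graphs k" "bij_betw \<phi> {1..k} {1..k}"
    "\<forall>u\<in>{1..k}. \<forall>v\<in>{1..k}. {u, v} \<in> F \<longleftrightarrow> {\<phi> u, \<phi> v} \<in> G"
    "\<phi> a = c" "\<phi> b = d"
proof -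
  obtain F a b G c d where XY: "X = (F, a, b)" "Y = (G, c, d)" by (metis surj_pair)
  from assms[unfolded XY rooted_iso_iff] show thesis using that[OF XY] by blast
qed

lemma equiv_rooted_iso: "equiv (rooted_graphs k) (rooted_iso k)"
proof (rule equivI)
  show "rooted_iso k \<subseteq> rooted_graphs k \<times> rooted_graphs k" by (auto simp: rooted_iso_def)
  show "refl_on (rooted_graphs k) (rooted_iso k)"
  proof (rule refl_onI)
    fix X assume "X \<in> rooted_graphs k"
    then show "(X, X) \<in> rooted_iso k"
      by (cases X) (auto simp: rooted_iso_iff intro!: exI[of _ id])
  qed
  show "sym (rooted_iso k)"
  proof (rule symI)
    fix X Y assume "(X, Y) \<in> rooted_iso k"
    then obtain F a b G c d \<phi> where XY: "X = (F, a, b)" "Y = (G, c, d)"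
      and in_graphs: "(F, a, b) \<in> rooted_graphs k" "(G, c, d) \<in> rooted_graphs k"
      and \<phi>: "bij_betw \<phi> {1..k} {1..k}"
        "\<forall>u\<in>{1..k}. \<forall>v\<in>{1..k}. {u, v} \<in> F \<longleftrightarrow> {\<phi> u, \<phi> v} \<in> G"
        "\<phi> a = c" "\<phi> b = d"
      by (rule rooted_isoE)
    let ?\<psi> = "inv_into {1..k} \<phi>"
    have \<psi>: "bij_betw ?\<psi> {1..k} {1..k}" by (rule bij_betw_inv_into[OF \<phi>(1)])
    have "{u, v} \<in> G \<longleftrightarrow> {?\<psi> u, ?\<psi> v} \<in> F" if "u \<in> {1..k}" "v \<in> {1..k}" for u v
      using \<phi>(2)[rule_format, of "?\<psi> u" "?\<psi> v"] that bij_betwE[OF \<psi>] bij_betw_inv_into_right[OF \<phi>(1)] by simp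
    moreover have "?\<psi> c = a" "?\<psi> d = b"
      using in_graphs \<phi>(3,4) bij_betw_inv_into_left[OF \<phi>(1)] by (auto simp: rooted_graphs_def)
    ultimately show "(Y, X) \<in> rooted_iso k"
      using in_graphs \<psi> unfolding XY rooted_iso_iff by blast
  qed
  show "trans (rooted_iso k)"
  proof (rule transI)
    fix X Y Z assume XY0: "(X, Y) \<in> rooted_iso k" and YZ: "(Y, Z) \<in> rooted_iso k"
    from XY0 obtain F a b G c d \<phi> where XY: "X = (F, a, b)" "Y = (G, c, d)"
      and in_graphs: "(F, a, b) \<in> rooted_graphs k" "(G, c, d) \<in> rooted_graphs k"
      and \<phi>: "bij_betw \<phi> {1..k} {1..k}"
        "\<forall>u\<in>{1..k}. \<forall>v\<in>{1..k}. {u, v} \<in> F \<longleftrightarrow> {\<phi> u, \<phi> v} \<in> G"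
        "\<phi> a = c" "\<phi> b = d"
      by (rule rooted_isoE)
    obtain H e f where Z: "Z = (H, e, f)" by (metis surj_pair)
    from YZ[unfolded XY Z rooted_iso_iff] obtain \<psi> where "(H, e, f) \<in> rooted_graphs k"
      and \<psi>: "bij_betw \<psi> {1..k} {1..k}"
        "\<forall>u\<in>{1..k}. \<forall>v\<in>{1..k}. {u, v} \<in> G \<longleftrightarrow> {\<psi> u, \<psi> v} \<in> H"
        "\<psi> c = e" "\<psi> d = f"
      by blast
    have "{u, v} \<in> F \<longleftrightarrow> {(\<psi> \<circ> \<phi>) u, (\<psi> \<circ> \<phi>) v} \<in> H" if "u \<in> {1..k}" "v \<in> {1..k}" for u v
      using that \<phi>(2) \<psi>(2) bij_betwE[OF \<phi>(1)] by simp
    moreover have "bij_betw (\<psi> \<circ> \<phi>) {1..k} {1..k}" by (rule bij_betw_trans[OF \<phi>(1) \<psi>(1)])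
    moreover have "(\<psi> \<circ> \<phi>) a = e" "(\<psi> \<circ> \<phi>) b = f" using \<phi> \<psi> by simp_all
    ultimately show "(X, Z) \<in> rooted_iso k"
      using in_graphs \<open>(H, e, f) \<in> rooted_graphs k\<close> unfolding XY Z rooted_iso_iff by blast
  qed
qed

text \<open>Vertex pairs are enumerated in increasing order, which \<phi> may reverse; symmetry of
  \<open>W\<close> at the points involved makes the reversal harmless.\<close>

lemma induced_weight_reindex:
  assumes \<phi>: "bij_betw \<phi> {1..k} {1..k}"
    and FG: "\<And>u v. u \<in> {1..k} \<Longrightarrow> v \<in> {1..k} \<Longrightarrow> {u, v} \<in> F \<longleftrightarrow> {\<phi> u, \<phi> v} \<in> G"
    and z: "\<And>i. i \<in> {1..k} \<Longrightarrow> z i = z' (\<phi> i)"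
    and sym: "\<And>i j. i \<in> {1..k} \<Longrightarrow> j \<in> {1..k} \<Longrightarrow> W (z' i, z' j) = W (z' j, z' i)"
  shows "induced_weight k F W z = induced_weight k G W z'"
proof -
  let ?\<psi> = "inv_into {1..k} \<phi>"
  \<comment> \<open>The image of a pair under \<open>f\<close>, sorted again so that it belongs to
    \<open>vertex_pairs\<close>.\<close>
  let ?s = "\<lambda>f (i, j). (min (f i) (f j), max (f i) (f j :: nat))"
  have \<psi>: "bij_betw ?\<psi> {1..k} {1..k}" by (rule bij_betw_inv_into[OF \<phi>])
  have mem: "\<phi> i \<in> {1..k}" "?\<psi> i \<in> {1..k}" "\<phi> (?\<psi> i) = i" "?\<psi> (\<phi> i) = i" if "i \<in> {1..k}" for i
    using that bij_betwE[OF \<phi>] bij_betwE[OF \<psi>] bij_betw_inv_into_right[OF \<phi>]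
      bij_betw_inv_into_left[OF \<phi>] by blast+
  have inverse: "?s f p \<in> vertex_pairs k \<and> ?s g (?s f p) = p"
    if p: "p \<in> vertex_pairs k" and f: "\<And>i. i \<in> {1..k} \<Longrightarrow> f i \<in> {1..k} \<and> g (f i) = i"
    for p f g
  proof -
    obtain i j where ij: "p = (i, j)" "i \<in> {1..k}" "j \<in> {1..k}" "i < j"
      using p by (auto simp: vertex_pairs_def)
    have "f i \<noteq> f j" using f[OF ij(2)] f[OF ij(3)] \<open>i < j\<close> by (metis less_irrefl)
    then consider "f i < f j" | "f j < f i" by linarith
    then show ?thesis
      using f[OF ij(2)] f[OF ij(3)] ij by cases (auto simp: vertex_pairs_def min_def max_def)
  qed
  show ?thesis
    unfolding induced_weight_def
  proof (rule prod.reindex_bij_witness[where i = "?s ?\<psi>" and j = "?s \<phi>"])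
    fix p assume p: "p \<in> vertex_pairs k"
    show "?s ?\<psi> (?s \<phi> p) = p" "?s \<phi> p \<in> vertex_pairs k"
      using inverse[OF p, of \<phi> ?\<psi>] mem by blast+
    show "?s \<phi> (?s ?\<psi> p) = p" "?s ?\<psi> p \<in> vertex_pairs k"
      using inverse[OF p, of ?\<psi> \<phi>] mem by blast+
    obtain i j where ij: "p = (i, j)" "i \<in> {1..k}" "j \<in> {1..k}" using p by (auto simp: vertex_pairs_def)
    show "(case ?s \<phi> p of (i, j) \<Rightarrow> if {i, j} \<in> G then W (z' i, z' j) else 1 - W (z' i, z' j)) =
        (case p of (i, j) \<Rightarrow> if {i, j} \<in> F then W (z i, z j) else 1 - W (z i, z j))"
      using FG[OF ij(2,3)] z ij sym[OF mem(1)[OF ij(2)] mem(1)[OF ij(3)]]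
      by (auto simp: min_def max_def insert_commute)
  qed
qed

section \<open>Invariance of the operators under isomorphism\<close>

context prob_space
begin

text \<open>An isomorphism sends roots to roots and therefore free vertices to free vertices, so it
  merely renames the variables of integration. The equality holds at every point, not only almost
  everywhere.\<close>

lemma rooted_op_iso:
  assumes iso: "(X, Y) \<in> rooted_iso k" and W: "is_kernel M W" and xy: "x \<in> space M" "y \<in> space M"
  shows "rooted_op M k X W (x, y) = rooted_op M k Y W (x, y)"
proof -
  obtain F a b G c d \<phi> where XY: "X = (F, a, b)" "Y = (G, c, d)"
    and in_graphs: "(F, a, b) \<in> rooted_graphs k" "(G, c, d) \<in> rooted_graphs k"
    and \<phi>: "bij_betw \<phi> {1..k} {1..k}"
      "\<forall>u\<in>{1..k}. \<forall>v\<in>{1..k}. {u, v} \<in> F \<longleftrightarrow> {\<phi> u, \<phi> v} \<in> G"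
      "\<phi> a = c" "\<phi> b = d"
    using iso by (rule rooted_isoE)
  let ?I = "{1..k} - {a, b}" and ?K = "{1..k} - {c, d}"
  \<comment> \<open>Pulls an assignment of the free vertices of \<open>Y\<close> back to those of
    \<open>X\<close>. Being a renaming of independent coordinates, it preserves the product
    measure.\<close>
  let ?r = "\<lambda>v. \<lambda>n\<in>?I. v (\<phi> n)"
  note ab = rooted_vertices(2-4)[OF in_graphs(1)] and cd = rooted_vertices(2-4)[OF in_graphs(2)]
  have inj: "inj_on \<phi> {1..k}" using \<phi>(1) by (rule bij_betw_imp_inj_on)
  have maps: "\<phi> i \<in> {1..k}" if "i \<in> {1..k}" for i using bij_betwE[OF \<phi>(1)] that by blast
  have \<phi>I: "inj_on \<phi> ?I" "\<phi> \<in> ?I \<rightarrow> ?K"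
  proof -
    show "inj_on \<phi> ?I" by (rule inj_on_subset[OF inj]) blast
    show "\<phi> \<in> ?I \<rightarrow> ?K"
    proof
      fix i assume i: "i \<in> ?I"
      then have "\<phi> i \<noteq> c" "\<phi> i \<noteq> d"
        using inj_onD[OF inj, of i a] inj_onD[OF inj, of i b] ab \<phi>(3,4) by auto
      with maps[of i] i show "\<phi> i \<in> ?K" by simp
    qed
  qed
  have distr: "distr (\<Pi>\<^sub>M i\<in>?K. M) (\<Pi>\<^sub>M i\<in>?I. M) ?r = (\<Pi>\<^sub>M i\<in>?I. M)"
    using distr_PiM_reindex[of ?K "\<lambda>_. M" \<phi> ?I] prob_space_axioms \<phi>I by simp
  have r: "?r \<in> (\<Pi>\<^sub>M i\<in>?K. M) \<rightarrow>\<^sub>M (\<Pi>\<^sub>M i\<in>?I. M)"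
    using \<phi>I(2) by (intro measurable_restrict measurable_component_singleton) auto
  have meas: "(\<lambda>v. induced_weight k F W (v(a := x, b := y))) \<in> borel_measurable (\<Pi>\<^sub>M i\<in>?I. M)"
    using borel_measurable_integrable[OF rooted_integrand_integrable[OF in_graphs(1) W, of "(x, y)"]] xy
    by (simp add: space_pair_measure)
  have "rooted_op M k X W (x, y) =
      (LINT v|distr (\<Pi>\<^sub>M i\<in>?K. M) (\<Pi>\<^sub>M i\<in>?I. M) ?r. induced_weight k F W (v(a := x, b := y)))"
    unfolding distr XY by (rule rooted_op_eq)
  also have "\<dots> = (LINT v|(\<Pi>\<^sub>M i\<in>?K. M). induced_weight k F W ((?r v)(a := x, b := y)))"
    by (rule integral_distr[OF r meas])
  also have "\<dots> = (LINT v|(\<Pi>\<^sub>M i\<in>?K. M). induced_weight k G W (v(c := x, d := y)))"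
  proof (rule Bochner_Integration.integral_cong[OF refl])
    fix v assume v: "v \<in> space (\<Pi>\<^sub>M i\<in>?K. M)"
    let ?z = "v(c := x, d := y)"
    have "?z i \<in> space M" if "i \<in> {1..k}" for i
      using that v xy by (auto simp: space_PiM PiE_def Pi_iff)
    then have sym: "W (?z i, ?z j) = W (?z j, ?z i)" if "i \<in> {1..k}" "j \<in> {1..k}" for i j
      using W that unfolding is_kernel_def by blast
    have upd: "((?r v)(a := x, b := y)) i = ?z (\<phi> i)" if "i \<in> {1..k}" for i
    proof -
      consider "i = b" | "i = a" "i \<noteq> b" | "i \<in> ?I" using \<open>i \<in> {1..k}\<close> by blast
      then show ?thesis
      proof cases
        case 3
        then have "\<phi> i \<in> ?K" using \<phi>I(2) by (rule funcset_mem[rotated])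
        with 3 show ?thesis by simp
      qed (use \<phi>(3,4) cd(1) in simp_all)
    qed
    show "induced_weight k F W ((?r v)(a := x, b := y)) = induced_weight k G W ?z"
    proof (rule induced_weight_reindex[OF \<phi>(1)])
      show "{u, w} \<in> F \<longleftrightarrow> {\<phi> u, \<phi> w} \<in> G" if "u \<in> {1..k}" "w \<in> {1..k}" for u w
        using \<phi>(2) that by blast
    qed (fact upd sym)+
  qed
  also have "\<dots> = rooted_op M k Y W (x, y)" unfolding XY by (rule rooted_op_eq[symmetric])
  finally show ?thesis .
qed

text \<open>On a class the operator is constant by \<open>rooted_op_iso\<close>, so it factors out
  of the sum over the class, and the choice of the representative is immaterial.\<close>

lemma velocity_eq_sum_classes:
  assumes W: "is_kernel M W" and xy: "x \<in> space M" "y \<in> space M"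
  shows "velocity M k R W (x, y) =
    (\<Sum>J\<in>rooted_classes k. class_coeff k R J * rooted_op M k (SOME X. X \<in> J) W (x, y))"
proof -
  let ?t = "\<lambda>X. rooted_op M k X W (x, y)"
  note equiv = equiv_rooted_iso[of k]
  have "velocity M k R W (x, y) = (\<Sum>X\<in>\<Union>(rooted_classes k). flip_coeff k R X * ?t X)"
    by (simp add: velocity_def rooted_classes_def Union_quotient[OF equiv])
  also have "\<dots> = (\<Sum>J\<in>rooted_classes k. \<Sum>X\<in>J. flip_coeff k R X * ?t X)"
  proof (rule sum.Union_disjoint[unfolded comp_def])
    have "J \<subseteq> rooted_graphs k" if "J \<in> rooted_classes k" for J
      using Union_quotient[OF equiv] that by (auto simp: rooted_classes_def)
    then show "\<forall>J\<in>rooted_classes k. finite J"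
      using finite_rooted_graphs finite_subset by blast
    show "\<forall>J\<in>rooted_classes k. \<forall>K\<in>rooted_classes k. J \<noteq> K \<longrightarrow> J \<inter> K = {}"
      using quotient_disj[OF equiv] unfolding rooted_classes_def by blast
  qed
  also have "\<dots> = (\<Sum>J\<in>rooted_classes k. class_coeff k R J * ?t (SOME X. X \<in> J))"
  proof (rule sum.cong[OF refl])
    fix J assume J: "J \<in> rooted_classes k"
    then have "(SOME X. X \<in> J) \<in> J"
      using in_quotient_imp_non_empty[OF equiv] by (auto simp: rooted_classes_def some_in_eq)
    then have "?t X = ?t (SOME X. X \<in> J)" if "X \<in> J" for X
      using quotient_eq_iff[OF equiv J[unfolded rooted_classes_def] J[unfolded rooted_classes_def] that]
      by (intro rooted_op_iso[OF _ W xy]) auto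
    then show "(\<Sum>X\<in>J. flip_coeff k R X * ?t X) = class_coeff k R J * ?t (SOME X. X \<in> J)"
      by (simp add: class_coeff_def sum_distrib_right)
  qed
  finally show ?thesis .
qed

lemma velocity_eq_if_class_coeff_eq:
  assumes "\<forall>J\<in>rooted_classes k. class_coeff k R1 J = class_coeff k R2 J" and "is_kernel M W"
  shows "kernel_eq M (velocity M k R1 W) (velocity M k R2 W)"
  unfolding kernel_eq_def
  using velocity_eq_sum_classes[OF assms(2)] assms(1)
  by (intro AE_I2) (auto simp: space_pair_measure intro!: sum.cong)

end

section \<open>Step graphons\<close>

context finite_measure
begin

text \<open>If \<open>C\<close> is a subset of \<open>B\<close> of strictly intermediate measure,
  then both \<open>C\<close> and \<open>B - C\<close> have positive measure, and one of them has at
  most half the measure of \<open>B\<close>. Halving is iterated until the measure drops below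
  \<open>e\<close>.\<close>

lemma atomless_small_subset:
  assumes at: "atomless M" and A: "A \<in> sets M" "measure M A > 0" and "e > 0"
  shows "\<exists>B\<in>sets M. B \<subseteq> A \<and> 0 < measure M B \<and> measure M B < e"
proof -
  have halve: "\<exists>B'\<in>sets M. B' \<subseteq> B \<and> 0 < measure M B' \<and> measure M B' \<le> measure M B / 2"
    if B: "B \<in> sets M" "measure M B > 0" for B
  proof -
    from at[unfolded atomless_def, rule_format, OF B(1)] B(2)
    obtain C where C: "C \<in> sets M" "C \<subseteq> B" "0 < measure M C" "measure M C < measure M B"
      by (auto simp: emeasure_eq_measure ennreal_less_iff)
    have "measure M (B - C) = measure M B - measure M C"
      using B C by (intro finite_measure_Diff) auto
    then show ?thesis
      using B C by (cases "measure M C \<le> measure M B / 2") (force intro: bexI[of _ C] bexI[of _ "B - C"])+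
  qed
  have "\<exists>B\<in>sets M. B \<subseteq> A \<and> 0 < measure M B \<and> measure M B \<le> measure M A / 2 ^ n" for n
  proof (induction n)
    case 0
    then show ?case using A by auto
  next
    case (Suc n)
    then obtain B where B: "B \<in> sets M" "B \<subseteq> A" "0 < measure M B" "measure M B \<le> measure M A / 2 ^ n" by blast
    from halve[OF B(1,3)] obtain B' where B': "B' \<in> sets M" "B' \<subseteq> B" "0 < measure M B'" "measure M B' \<le> measure M B / 2"
      by blast
    with B show ?case by (intro bexI[of _ B']) auto
  qed
  moreover obtain n where "measure M A / e < 2 ^ n" using real_arch_pow[of 2 "measure M A / e"] by auto
  ultimately obtain B where "B \<in> sets M" "B \<subseteq> A" "0 < measure M B" "measure M B \<le> measure M A / 2 ^ n" by blast
  moreover have "measure M A / 2 ^ n < e" using \<open>measure M A / e < 2 ^ n\<close> \<open>e > 0\<close> by (simp add: divide_simps mult.commute)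
  ultimately show ?thesis by (intro bexI[of _ B]) auto
qed

text \<open>Sierpinski's theorem. Each step of the exhaustion adds a set of at least half the largest
  measure that still fits.\<close>

lemma atomless_subset_of_measure:
  assumes at: "atomless M" and A: "A \<in> sets M" and c: "0 \<le> c" "c \<le> measure M A"
  shows "\<exists>B\<in>sets M. B \<subseteq> A \<and> measure M B = c"
proof -
  let ?P = "\<lambda>B. B \<in> sets M \<and> B \<subseteq> A \<and> measure M B \<le> c"
  let ?Q = "\<lambda>B B'. B \<subseteq> B' \<and> (\<forall>C\<in>sets M. C \<subseteq> A - B \<longrightarrow> measure M B + measure M C \<le> c \<longrightarrow>
    measure M C \<le> 2 * (measure M B' - measure M B))"
  have step: "\<exists>B'. ?P B' \<and> ?Q B B'" if B: "?P B" for B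
  proof -
    let ?X = "{C \<in> sets M. C \<subseteq> A - B \<and> measure M B + measure M C \<le> c}"
    let ?s = "SUP C\<in>?X. measure M C"
    have bdd: "bdd_above (measure M ` ?X)" by (intro bdd_aboveI2[of _ _ c]) (auto intro: order_trans[rotated])
    have "{} \<in> ?X" using B by auto
    then have "?s \<ge> 0" using cSUP_upper[OF _ bdd, of "{}"] by simp
    have "\<exists>C\<in>?X. ?s \<le> 2 * measure M C"
    proof (cases "?s = 0")
      case True
      with \<open>{} \<in> ?X\<close> show ?thesis by (intro bexI[of _ "{}"]) simp_all
    next
      case False
      with \<open>?s \<ge> 0\<close> have "?s / 2 < ?s" by simp
      then obtain C where "C \<in> ?X" "?s / 2 < measure M C"
        using less_cSUP_iff[OF _ bdd, of "?s / 2"] \<open>{} \<in> ?X\<close> by blast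
      then show ?thesis by (intro bexI[of _ C]) simp_all
    qed
    then obtain C where C: "C \<in> sets M" "C \<subseteq> A - B" "measure M B + measure M C \<le> c" "?s \<le> 2 * measure M C"
      by blast
    have un: "measure M (B \<union> C) = measure M B + measure M C"
      using B C by (intro finite_measure_Union) auto
    have "measure M C' \<le> 2 * (measure M (B \<union> C) - measure M B)"
      if "C' \<in> sets M" "C' \<subseteq> A - B" "measure M B + measure M C' \<le> c" for C'
      using cSUP_upper[OF _ bdd, of C'] that C(4) un by simp
    with B C un show ?thesis by (intro exI[of _ "B \<union> C"]) auto
  qed
  have "\<exists>B. \<forall>n. ?P (B n) \<and> ?Q (B n) (B (Suc n))"
  proof (rule dependent_nat_choice)
    show "\<exists>B. ?P B" by (rule exI[of _ "{}"]) (use c in simp)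
  qed (rule step)
  then obtain B where PQ: "\<forall>n. ?P (B n) \<and> ?Q (B n) (B (Suc n))" ..
  have B: "?P (B n)" "?Q (B n) (B (Suc n))" for n using PQ[rule_format, of n] by simp_all
  let ?B = "\<Union>n. B n"
  have inc: "incseq B" by (rule incseq_SucI) (rule B(2)[THEN conjunct1])
  have lim: "(\<lambda>n. measure M (B n)) \<longlonglongrightarrow> measure M ?B"
    using B(1) inc by (intro finite_Lim_measure_incseq) auto
  have sets: "?B \<in> sets M" "?B \<subseteq> A" using B(1) by auto
  have "measure M ?B \<le> c" using B(1) by (intro LIMSEQ_le_const2[OF lim]) auto
  moreover have "\<not> measure M ?B < c"
  proof
    \<comment> \<open>If the union falls short, a small set \<open>C\<close> of positive measure
      outside it fits at every step. Each step must then add at least half the measure of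
      \<open>C\<close>, while the increments of a convergent sequence tend to 0.\<close>
    assume less: "measure M ?B < c"
    have "measure M (A - ?B) = measure M A - measure M ?B" using A sets by (intro finite_measure_Diff)
    then have "measure M (A - ?B) > 0" using less c(2) by simp
    then obtain C where C: "C \<in> sets M" "C \<subseteq> A - ?B" "0 < measure M C" "measure M C < c - measure M ?B"
      using atomless_small_subset[OF at, of "A - ?B" "c - measure M ?B"] A sets less by auto
    have "measure M C \<le> 2 * (measure M (B (Suc n)) - measure M (B n))" for n
    proof -
      have "measure M (B n) \<le> measure M ?B" using sets by (intro finite_measure_mono) auto
      moreover have "C \<subseteq> A - B n" using C(2) by blast
      ultimately show ?thesis using B(2)[of n, THEN conjunct2, rule_format, OF C(1)] C(4) by linarith
    qed
    moreover have "(\<lambda>n. 2 * (measure M (B (Suc n)) - measure M (B n))) \<longlonglongrightarrow> 2 * (measure M ?B - measure M ?B)"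
      by (intro tendsto_intros lim LIMSEQ_Suc)
    ultimately have "measure M C \<le> 2 * (measure M ?B - measure M ?B)"
      by (intro LIMSEQ_le_const) auto
    with C(3) show False by simp
  qed
  ultimately show ?thesis using sets by (intro bexI[of _ ?B]) auto
qed

text \<open>A set of measure \<open>w i\<close> is split off and the rest is divided by induction.
  The induction starts from a single index, which takes all that remains; hence the parts cover
  \<open>A\<close>.\<close>

lemma atomless_partition:
  assumes at: "atomless M" and "finite I" "I \<noteq> {}" and "A \<in> sets M"
    and "\<And>i. i \<in> I \<Longrightarrow> w i \<ge> 0" "(\<Sum>i\<in>I. w i) = measure M A"
  shows "\<exists>s. (\<forall>x\<in>A. s x \<in> I) \<and> (\<forall>i\<in>I. {x \<in> A. s x = i} \<in> sets M \<and> measure M {x \<in> A. s x = i} = w i)"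
  using assms(2-6)
proof (induction I arbitrary: A rule: finite_ne_induct)
  case (singleton i)
  then show ?case by (intro exI[of _ "\<lambda>_. i"]) auto
next
  case (insert i F)
  have "(\<Sum>j\<in>F. w j) \<ge> 0" using insert.prems(2) by (intro sum_nonneg) auto
  then obtain B where B: "B \<in> sets M" "B \<subseteq> A" "measure M B = w i"
    using atomless_subset_of_measure[OF at, of A "w i"] insert by auto
  have "measure M (A - B) = (\<Sum>j\<in>F. w j)"
    using finite_measure_Diff[of A B] B insert by simp
  then obtain s where s: "\<And>x. x \<in> A - B \<Longrightarrow> s x \<in> F"
    "\<And>j. j \<in> F \<Longrightarrow> {x \<in> A - B. s x = j} \<in> sets M \<and> measure M {x \<in> A - B. s x = j} = w j"
    using insert.IH[of "A - B"] insert.prems B(1) by auto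
  let ?s = "\<lambda>x. if x \<in> B then i else s x"
  have eq_i: "{x \<in> A. ?s x = i} = B" using s(1) B(2) insert.hyps by auto
  have eq_j: "{x \<in> A. ?s x = j} = {x \<in> A - B. s x = j}" if "j \<in> F" for j
    using that insert.hyps by auto
  have "{x \<in> A. ?s x = j} \<in> sets M \<and> measure M {x \<in> A. ?s x = j} = w j" if "j \<in> insert i F" for j
  proof (cases "j = i")
    case True
    show ?thesis unfolding True eq_i using B by simp
  next
    case False
    with that have "j \<in> F" by simp
    from s(2)[OF this] show ?thesis unfolding eq_j[OF \<open>j \<in> F\<close>] .
  qed
  moreover have "?s x \<in> insert i F" if "x \<in> A" for x using s(1) that by simp
  ultimately show ?case by (intro exI[of _ ?s]) blast
qed

end

text \<open>The 0-1 step graphon with the fibres of \<open>s\<close> as parts. If \<open>G\<close>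
  is a labelled graph, the diagonal blocks are 0, because there \<open>{s x, s y}\<close> is a
  singleton and so not an edge.\<close>

definition type_kernel :: "('a \<Rightarrow> nat) \<Rightarrow> lgraph \<Rightarrow> 'a kern" where
  "type_kernel s G = (\<lambda>(x, y). of_bool ({s x, s y} \<in> G))"

text \<open>Adjacency and non-adjacency are both preserved, but \<phi> need not be injective: for a
  labelled graph \<open>G\<close>, vertices with a common image have to be non-adjacent in
  \<open>F\<close>.\<close>

definition induces :: "nat \<Rightarrow> lgraph \<Rightarrow> lgraph \<Rightarrow> (nat \<Rightarrow> nat) \<Rightarrow> bool" where
  "induces k F G \<phi> \<longleftrightarrow> (\<forall>(i, j)\<in>vertex_pairs k. {i, j} \<in> F \<longleftrightarrow> {\<phi> i, \<phi> j} \<in> G)"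

text \<open>Extensional functions are used so that these sets are finite and their elements can be
  counted.\<close>

definition rooted_maps :: "nat \<Rightarrow> nat \<Rightarrow> nat \<Rightarrow> nat \<Rightarrow> nat \<Rightarrow> (nat \<Rightarrow> nat) set" where
  "rooted_maps k a b c d = {\<phi> \<in> {1..k} \<rightarrow>\<^sub>E {1..k}. \<phi> a = c \<and> \<phi> b = d}"

lemma finite_rooted_maps: "finite (rooted_maps k a b c d)"
  unfolding rooted_maps_def by (rule finite_subset[of _ "{1..k} \<rightarrow>\<^sub>E {1..k}"]) (auto intro: finite_PiE)

lemma induced_weight_type_kernel:
  "induced_weight k F (type_kernel s G) z = of_bool (induces k F G (s \<circ> z))"
proof (cases "induces k F G (s \<circ> z)")
  case True
  then have "induced_weight k F (type_kernel s G) z = (\<Prod>p\<in>vertex_pairs k. 1)"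
    unfolding induced_weight_def by (intro prod.cong) (auto simp: induces_def type_kernel_def)
  with True show ?thesis by simp
next
  case False
  then obtain i j where "(i, j) \<in> vertex_pairs k" "{i, j} \<in> F \<longleftrightarrow> {s (z i), s (z j)} \<notin> G"
    by (auto simp: induces_def)
  then have "induced_weight k F (type_kernel s G) z = 0"
    unfolding induced_weight_def
    by (intro prod_zero finite_vertex_pairs bexI[of _ "(i, j)"]) (auto simp: type_kernel_def)
  with False show ?thesis by simp
qed

lemma induces_cong:
  assumes "\<And>i. i \<in> {1..k} \<Longrightarrow> \<phi> i = \<psi> i"
  shows "induces k F G \<phi> = induces k F G \<psi>"
  unfolding induces_def using assms by (intro ball_cong) (auto dest!: vertex_pairsD)

lemma is_graphon_type_kernel:
  assumes s: "s \<in> M \<rightarrow>\<^sub>M count_space UNIV"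
  shows "is_graphon M (type_kernel s G)"
proof -
  have "(\<lambda>p. s (fst p)) \<in> M \<Otimes>\<^sub>M M \<rightarrow>\<^sub>M count_space UNIV" "(\<lambda>p. s (snd p)) \<in> M \<Otimes>\<^sub>M M \<rightarrow>\<^sub>M count_space UNIV"
    by (rule measurable_compose[OF measurable_fst s] measurable_compose[OF measurable_snd s])+
  then have "(\<lambda>p. (s (fst p), s (snd p))) \<in> M \<Otimes>\<^sub>M M \<rightarrow>\<^sub>M count_space UNIV \<Otimes>\<^sub>M count_space UNIV"
    by (rule measurable_Pair)
  then have *: "(\<lambda>p. (s (fst p), s (snd p))) \<in> M \<Otimes>\<^sub>M M \<rightarrow>\<^sub>M count_space UNIV"
    by (simp add: pair_measure_countable)
  have "(\<lambda>p. (\<lambda>(i, j). of_bool ({i, j} \<in> G)) (s (fst p), s (snd p)) :: real) \<in> borel_measurable (M \<Otimes>\<^sub>M M)"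
    by (rule measurable_compose[OF *]) simp
  then have "type_kernel s G \<in> borel_measurable (M \<Otimes>\<^sub>M M)"
    by (simp add: type_kernel_def case_prod_beta)
  moreover have "\<bar>type_kernel s G (x, y)\<bar> \<le> 1" "0 \<le> type_kernel s G (x, y)" "type_kernel s G (x, y) \<le> 1"
    "type_kernel s G (x, y) = type_kernel s G (y, x)" for x y
    by (auto simp: type_kernel_def insert_commute)
  ultimately show ?thesis
    unfolding is_graphon_def is_kernel_def by (intro conjI ballI exI[of _ 1]) simp_all
qed

text \<open>The integrand depends on the parts of the vertices only. The assignments of the free
  vertices split into boxes, one for each map of vertices to parts that agrees with the given roots,
  and the measure of a box is a product of part sizes. This is the polynomial in the part
  sizes.\<close>

lemma rooted_op_type_kernel:
  assumes "prob_space M" and s: "s \<in> M \<rightarrow>\<^sub>M count_space UNIV"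
    and s_range: "\<And>x. x \<in> space M \<Longrightarrow> s x \<in> {1..k}"
    and X: "(F, a, b) \<in> rooted_graphs k" and xy: "x \<in> space M" "y \<in> space M"
  shows "rooted_op M k (F, a, b) (type_kernel s G) (x, y) =
    (\<Sum>\<phi>\<in>rooted_maps k a b (s x) (s y).
      (\<Prod>i\<in>{1..k} - {a, b}. measure M {x \<in> space M. s x = \<phi> i}) * of_bool (induces k F G \<phi>))"
proof -
  interpret prob_space M by fact
  interpret P: product_prob_space "\<lambda>_. M" UNIV by standard
  let ?I = "{1..k} - {a, b}" and ?S = "\<lambda>i. {x \<in> space M. s x = i}"
  let ?A = "rooted_maps k a b (s x) (s y)" and ?N = "\<Pi>\<^sub>M i\<in>{1..k} - {a, b}. M"
  interpret N: prob_space ?N by (intro prob_space_PiM prob_space_axioms)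
  note ab = rooted_vertices(2-4)[OF X]
  have S: "?S i \<in> sets M" for i using measurable_sets[OF s, of "{i}"] by (simp add: vimage_def Int_def conj_commute)
  have E: "Pi\<^sub>E ?I (\<lambda>i. ?S (\<phi> i)) \<in> sets ?N" for \<phi> using S by (intro sets_PiM_I_finite) auto
  have meas: "measure ?N (Pi\<^sub>E ?I (\<lambda>i. ?S (\<phi> i))) = (\<Prod>i\<in>?I. measure M (?S (\<phi> i)))" for \<phi>
  proof -
    have "emeasure ?N (Pi\<^sub>E ?I (\<lambda>i. ?S (\<phi> i))) = (\<Prod>i\<in>?I. emeasure M (?S (\<phi> i)))"
      using S by (intro P.emeasure_PiM) auto
    then have "ennreal (measure ?N (Pi\<^sub>E ?I (\<lambda>i. ?S (\<phi> i)))) = ennreal (\<Prod>i\<in>?I. measure M (?S (\<phi> i)))"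
      by (simp only: emeasure_eq_measure N.emeasure_eq_measure prod_ennreal measure_nonneg)
    then show ?thesis by (simp add: prod_nonneg)
  qed
  have "rooted_op M k (F, a, b) (type_kernel s G) (x, y) =
      (LINT v|?N. of_bool (induces k F G (s \<circ> v(a := x, b := y))))"
    by (simp add: rooted_op_eq induced_weight_type_kernel)
  also have "\<dots> = (LINT v|?N. (\<Sum>\<phi>\<in>?A. indicator (Pi\<^sub>E ?I (\<lambda>i. ?S (\<phi> i))) v * of_bool (induces k F G \<phi>)))"
  proof (rule Bochner_Integration.integral_cong[OF refl])
    fix v assume v: "v \<in> space ?N"
    then have v_mem: "v i \<in> space M" if "i \<in> ?I" for i using that by (auto simp: space_PiM PiE_def Pi_iff)
    have v_ext: "v \<in> extensional ?I" using v by (simp add: space_PiM PiE_def)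
    \<comment> \<open>The map of vertices to parts belonging to the assignment \<open>v\<close>.
      Only the box of \<psi> contains \<open>v\<close>, so the sum over all maps has a single
      nonzero term.\<close>
    define \<psi> where "\<psi> = restrict (s \<circ> v(a := x, b := y)) {1..k}"
    have mem: "(v(a := x, b := y)) i \<in> space M" if "i \<in> {1..k}" for i
      using that v_mem xy by auto
    have \<psi>A: "\<psi> \<in> ?A"
      using mem s_range ab by (auto simp: \<psi>_def rooted_maps_def)
    have "v \<in> Pi\<^sub>E ?I (\<lambda>i. ?S (\<phi> i)) \<longleftrightarrow> \<phi> = \<psi>" if \<phi>: "\<phi> \<in> ?A" for \<phi>
    proof
      assume *: "v \<in> Pi\<^sub>E ?I (\<lambda>i. ?S (\<phi> i))"
      have "\<phi> i = \<psi> i" if "i \<in> {1..k}" for i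
      proof -
        consider "i = b" | "i = a" "i \<noteq> b" | "i \<in> ?I" using \<open>i \<in> {1..k}\<close> by blast
        then show ?thesis
        proof cases
          case 3
          then have "s (v i) = \<phi> i" using * by (auto simp: PiE_def Pi_iff)
          with 3 show ?thesis by (auto simp: \<psi>_def)
        qed (use \<phi> ab in \<open>auto simp: \<psi>_def rooted_maps_def\<close>)
      qed
      moreover have "\<phi> \<in> extensional {1..k}" "\<psi> \<in> extensional {1..k}"
        using \<phi> \<psi>A by (auto simp: rooted_maps_def PiE_def)
      ultimately show "\<phi> = \<psi>" by (rule extensionalityI[rotated 2]) 
    next
      assume "\<phi> = \<psi>"
      then show "v \<in> Pi\<^sub>E ?I (\<lambda>i. ?S (\<phi> i))"
        using v_mem v_ext by (auto simp: PiE_def Pi_iff \<psi>_def)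
    qed
    then have "(\<Sum>\<phi>\<in>?A. indicator (Pi\<^sub>E ?I (\<lambda>i. ?S (\<phi> i))) v * of_bool (induces k F G \<phi>)) =
        (\<Sum>\<phi>\<in>?A. if \<phi> = \<psi> then of_bool (induces k F G \<phi>) else (0::real))"
      by (intro sum.cong) (auto simp: indicator_def)
    also have "\<dots> = of_bool (induces k F G \<psi>)" using \<psi>A finite_rooted_maps by simp
    also have "induces k F G \<psi> = induces k F G (s \<circ> v(a := x, b := y))"
      by (rule induces_cong) (simp add: \<psi>_def)
    finally show "of_bool (induces k F G (s \<circ> v(a := x, b := y))) =
        (\<Sum>\<phi>\<in>?A. indicator (Pi\<^sub>E ?I (\<lambda>i. ?S (\<phi> i))) v * of_bool (induces k F G \<phi>) :: real)" ..
  qed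
  also have "\<dots> = (\<Sum>\<phi>\<in>?A. LINT v|?N. indicator (Pi\<^sub>E ?I (\<lambda>i. ?S (\<phi> i))) v * of_bool (induces k F G \<phi>))"
    by (intro Bochner_Integration.integral_sum integrable_mult_left integrable_real_indicator E)
      (simp only: N.emeasure_eq_measure ennreal_less_top infinity_ennreal_def)
  also have "\<dots> = (\<Sum>\<phi>\<in>?A. measure ?N (Pi\<^sub>E ?I (\<lambda>i. ?S (\<phi> i))) * of_bool (induces k F G \<phi>))"
    using E[THEN sets.sets_into_space] by (simp add: Int_absorb2)
  finally show ?thesis by (simp only: meas)
qed

text \<open>The isomorphisms whose mere existence is asserted by \<open>rooted_iso\<close>,
  restricted to \<open>{1..k}\<close> so that each is counted once.\<close>

definition rooted_isos :: "nat \<Rightarrow> rooted \<Rightarrow> rooted \<Rightarrow> (nat \<Rightarrow> nat) set" where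
  "rooted_isos k = (\<lambda>(F, a, b) (G, c, d).
     {\<phi> \<in> rooted_maps k a b c d. bij_betw \<phi> {1..k} {1..k} \<and> induces k F G \<phi>})"

lemma finite_rooted_isos: "finite (rooted_isos k X Y)"
  by (cases X; cases Y) (simp add: rooted_isos_def finite_rooted_maps)

lemma singleton_notin_labelled_graph: "F \<in> labelled_graphs k \<Longrightarrow> {u} \<notin> F"
  by (auto simp: labelled_graphs_def)

text \<open>Passing from increasing pairs to all pairs adds the reversed pairs, which are the same
  sets, and the pairs with \<open>u = v\<close>, for which both sides are false because labelled
  graphs contain no singletons.\<close>

lemma induces_iff:
  assumes F: "F \<in> labelled_graphs k" and G: "G \<in> labelled_graphs k"
  shows "induces k F G \<phi> \<longleftrightarrow> (\<forall>u\<in>{1..k}. \<forall>v\<in>{1..k}. {u, v} \<in> F \<longleftrightarrow> {\<phi> u, \<phi> v} \<in> G)"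
proof
  assume ind: "induces k F G \<phi>"
  show "\<forall>u\<in>{1..k}. \<forall>v\<in>{1..k}. {u, v} \<in> F \<longleftrightarrow> {\<phi> u, \<phi> v} \<in> G"
  proof (intro ballI)
    fix u v assume uv: "u \<in> {1..k}" "v \<in> {1..k}"
    consider "u = v" | "(u, v) \<in> vertex_pairs k" | "(v, u) \<in> vertex_pairs k"
      using uv linorder_less_linear[of u v] by (auto simp: vertex_pairs_def)
    then show "{u, v} \<in> F \<longleftrightarrow> {\<phi> u, \<phi> v} \<in> G"
    proof cases
      case 1
      then show ?thesis using singleton_notin_labelled_graph[OF F] singleton_notin_labelled_graph[OF G] by simp
    next
      case 2
      then show ?thesis using ind by (auto simp: induces_def)
    next
      case 3
      then have "{v, u} \<in> F \<longleftrightarrow> {\<phi> v, \<phi> u} \<in> G" using ind by (auto simp: induces_def)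
      then show ?thesis by (simp add: insert_commute)
    qed
  qed
next
  assume *: "\<forall>u\<in>{1..k}. \<forall>v\<in>{1..k}. {u, v} \<in> F \<longleftrightarrow> {\<phi> u, \<phi> v} \<in> G"
  show "induces k F G \<phi>"
    unfolding induces_def
  proof clarify
    fix i j assume "(i, j) \<in> vertex_pairs k"
    then have "i \<in> {1..k}" "j \<in> {1..k}" using vertex_pairsD by blast+
    with * show "{i, j} \<in> F \<longleftrightarrow> {\<phi> i, \<phi> j} \<in> G" by blast
  qed
qed

lemma rooted_isosI:
  assumes X: "(F, a, b) \<in> rooted_graphs k" and Y: "(G, c, d) \<in> rooted_graphs k"
    and \<phi>: "bij_betw \<phi> {1..k} {1..k}"
      "\<And>u v. u \<in> {1..k} \<Longrightarrow> v \<in> {1..k} \<Longrightarrow> {u, v} \<in> F \<longleftrightarrow> {\<phi> u, \<phi> v} \<in> G"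
      "\<phi> a = c" "\<phi> b = d"
  shows "restrict \<phi> {1..k} \<in> rooted_isos k (F, a, b) (G, c, d)"
proof -
  have ab: "a \<in> {1..k}" "b \<in> {1..k}" and FG: "F \<in> labelled_graphs k" "G \<in> labelled_graphs k"
    using X Y by (auto simp: rooted_graphs_def)
  have "bij_betw (restrict \<phi> {1..k}) {1..k} {1..k}"
    using \<phi>(1) by (subst bij_betw_cong[of _ _ \<phi>]) auto
  moreover have "restrict \<phi> {1..k} \<in> rooted_maps k a b c d"
    using \<phi>(3,4) ab bij_betwE[OF \<phi>(1)] by (auto simp: rooted_maps_def)
  moreover have "induces k F G (restrict \<phi> {1..k})"
    unfolding induces_iff[OF FG]
  proof (intro ballI)
    fix u v assume uv: "u \<in> {1..k}" "v \<in> {1..k}"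
    from \<phi>(2)[OF this] uv show "{u, v} \<in> F \<longleftrightarrow> {restrict \<phi> {1..k} u, restrict \<phi> {1..k} v} \<in> G" by simp
  qed
  ultimately show ?thesis by (simp add: rooted_isos_def)
qed

lemma rooted_isosD:
  assumes X: "(F, a, b) \<in> rooted_graphs k" and Y: "(G, c, d) \<in> rooted_graphs k"
    and "\<phi> \<in> rooted_isos k (F, a, b) (G, c, d)"
  shows "\<phi> \<in> extensional {1..k}" "bij_betw \<phi> {1..k} {1..k}"
    "\<And>u v. u \<in> {1..k} \<Longrightarrow> v \<in> {1..k} \<Longrightarrow> {u, v} \<in> F \<longleftrightarrow> {\<phi> u, \<phi> v} \<in> G"
    "\<phi> a = c" "\<phi> b = d"
proof -
  have FG: "F \<in> labelled_graphs k" "G \<in> labelled_graphs k"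
    using X Y by (auto simp: rooted_graphs_def)
  have \<phi>: "\<phi> \<in> rooted_maps k a b c d" "bij_betw \<phi> {1..k} {1..k}" "induces k F G \<phi>"
    using assms(3) by (auto simp: rooted_isos_def)
  show "bij_betw \<phi> {1..k} {1..k}" by fact
  show "\<phi> \<in> extensional {1..k}" "\<phi> a = c" "\<phi> b = d" using \<phi>(1) by (auto simp: rooted_maps_def PiE_def)
  show "{u, v} \<in> F \<longleftrightarrow> {\<phi> u, \<phi> v} \<in> G" if "u \<in> {1..k}" "v \<in> {1..k}" for u v
    using \<phi>(3) that unfolding induces_iff[OF FG] by blast
qed

lemma rooted_isos_nonempty_iff:
  assumes "X \<in> rooted_graphs k" "Y \<in> rooted_graphs k"
  shows "rooted_isos k X Y \<noteq> {} \<longleftrightarrow> (X, Y) \<in> rooted_iso k"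
proof -
  obtain F a b G c d where XY: "X = (F, a, b)" "Y = (G, c, d)" by (metis surj_pair)
  note in_graphs = assms[unfolded XY]
  show ?thesis
  proof
    assume "(X, Y) \<in> rooted_iso k"
    then obtain \<phi> where "bij_betw \<phi> {1..k} {1..k}"
      "\<forall>u\<in>{1..k}. \<forall>v\<in>{1..k}. {u, v} \<in> F \<longleftrightarrow> {\<phi> u, \<phi> v} \<in> G" "\<phi> a = c" "\<phi> b = d"
      unfolding XY rooted_iso_iff by (elim conjE exE)
    with rooted_isosI[OF in_graphs, of \<phi>] show "rooted_isos k X Y \<noteq> {}" unfolding XY by blast
  next
    assume "rooted_isos k X Y \<noteq> {}"
    then obtain \<phi> where "\<phi> \<in> rooted_isos k (F, a, b) (G, c, d)" unfolding XY by auto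
    note \<phi> = rooted_isosD[OF in_graphs this]
    show "(X, Y) \<in> rooted_iso k"
      unfolding XY rooted_iso_iff using in_graphs \<phi>(2-5) by (intro conjI exI[of _ \<phi>] ballI)
  qed
qed

text \<open>Precomposition with an isomorphism from \<open>X\<close> to \<open>Y\<close> injects the
  isomorphisms \<open>Y\<close> to \<open>Z\<close> into those from \<open>X\<close> to
  \<open>Z\<close>. Used in both directions, this makes the count constant on a class.\<close>

lemma card_rooted_isos_le:
  assumes XY: "(X, Y) \<in> rooted_iso k" and Z: "Z \<in> rooted_graphs k"
  shows "card (rooted_isos k Y Z) \<le> card (rooted_isos k X Z)"
proof -
  obtain F a b G c d \<psi> where eqs: "X = (F, a, b)" "Y = (G, c, d)"
    and in_graphs: "(F, a, b) \<in> rooted_graphs k" "(G, c, d) \<in> rooted_graphs k"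
    and \<psi>: "bij_betw \<psi> {1..k} {1..k}" "\<forall>u\<in>{1..k}. \<forall>v\<in>{1..k}. {u, v} \<in> F \<longleftrightarrow> {\<psi> u, \<psi> v} \<in> G"
      "\<psi> a = c" "\<psi> b = d"
    using XY by (rule rooted_isoE)
  obtain H e f where Z_eq: "Z = (H, e, f)" by (metis surj_pair)
  note Z = Z[unfolded Z_eq]
  note \<psi>_mem = bij_betwE[OF \<psi>(1), rule_format]
  have maps: "restrict (\<phi> \<circ> \<psi>) {1..k} \<in> rooted_isos k X Z" if "\<phi> \<in> rooted_isos k Y Z" for \<phi>
  proof -
    note \<phi> = rooted_isosD[OF in_graphs(2) Z that[unfolded eqs Z_eq]]
    show ?thesis
      unfolding eqs Z_eq
    proof (rule rooted_isosI[OF in_graphs(1) Z])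
      show "bij_betw (\<phi> \<circ> \<psi>) {1..k} {1..k}" by (rule bij_betw_trans[OF \<psi>(1) \<phi>(2)])
      show "{u, v} \<in> F \<longleftrightarrow> {(\<phi> \<circ> \<psi>) u, (\<phi> \<circ> \<psi>) v} \<in> H" if "u \<in> {1..k}" "v \<in> {1..k}" for u v
        using \<psi>(2)[rule_format, OF that] \<phi>(3)[OF \<psi>_mem[OF that(1)] \<psi>_mem[OF that(2)]] by simp
    qed (use \<phi>(4,5) \<psi>(3,4) in simp_all)
  qed
  have "inj_on (\<lambda>\<phi>. restrict (\<phi> \<circ> \<psi>) {1..k}) (rooted_isos k Y Z)"
  proof (rule inj_onI)
    fix \<phi> \<phi>' assume in_isos: "\<phi> \<in> rooted_isos k Y Z" "\<phi>' \<in> rooted_isos k Y Z"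
      and eq: "restrict (\<phi> \<circ> \<psi>) {1..k} = restrict (\<phi>' \<circ> \<psi>) {1..k}"
    show "\<phi> = \<phi>'"
    proof (rule extensionalityI)
      show "\<phi> \<in> extensional {1..k}" "\<phi>' \<in> extensional {1..k}"
        using rooted_isosD(1)[OF in_graphs(2) Z] in_isos unfolding eqs Z_eq by blast+
      fix i assume "i \<in> {1..k}"
      then obtain j where j: "j \<in> {1..k}" "i = \<psi> j" using \<psi>(1) unfolding bij_betw_def by (metis imageE)
      from fun_cong[OF eq, of j] j show "\<phi> i = \<phi>' i" by simp
    qed
  qed
  then show ?thesis
    by (rule card_inj_on_le) (use maps finite_rooted_isos in auto)
qed

text \<open>Expanding the product on the right, \<open>S\<close> is the set of those
  \<open>u\<close> whose factor contributes the power of 2. On the left, the product over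
  \<open>I\<close> is the monomial of \<phi> evaluated at size 2 on \<open>S\<close> and 1
  elsewhere, so the alternating sum is a finite difference in every variable from
  \<open>U\<close>.\<close>

lemma sum_Pow_alternating:
  fixes \<phi> :: "'i \<Rightarrow> 'u"
  assumes U: "finite U" and I: "finite I"
  shows "(\<Sum>S\<in>Pow U. (-1) ^ card S * (\<Prod>i\<in>I. if \<phi> i \<in> S then 2 else 1)) =
    (\<Prod>u\<in>U. 1 - 2 ^ card {i\<in>I. \<phi> i = u} :: real)"
proof -
  have "(\<Prod>u\<in>U. - (2 ^ card {i\<in>I. \<phi> i = u}) + 1 :: real) =
      (\<Sum>S\<in>Pow U. (\<Prod>u\<in>S. - (2 ^ card {i\<in>I. \<phi> i = u})) * (\<Prod>u\<in>U - S. 1))"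
    by (rule prod_add[OF U])
  also have "\<dots> = (\<Sum>S\<in>Pow U. (-1) ^ card S * (\<Prod>i\<in>I. if \<phi> i \<in> S then 2 else 1))"
  proof (rule sum.cong[OF refl])
    fix S assume "S \<in> Pow U"
    then have S: "finite S" using U finite_subset by auto
    have "(\<Prod>i\<in>I. if \<phi> i \<in> S then 2 else 1 :: real) = (\<Prod>i\<in>{i\<in>I. \<phi> i \<in> S}. 2)"
      using I by (intro prod.mono_neutral_cong_right) auto
    also have "\<dots> = (\<Prod>u\<in>S. \<Prod>i\<in>{i\<in>{i\<in>I. \<phi> i \<in> S}. \<phi> i = u}. 2)"
      using I S by (intro prod.group[symmetric]) auto
    also have "\<dots> = (\<Prod>u\<in>S. 2 ^ card {i\<in>I. \<phi> i = u})"
      by (intro prod.cong refl) (auto intro!: arg_cong[where f = card])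
    finally show "(\<Prod>u\<in>S. - (2 ^ card {i\<in>I. \<phi> i = u})) * (\<Prod>u\<in>U - S. 1) =
        (-1) ^ card S * (\<Prod>i\<in>I. if \<phi> i \<in> S then 2 else 1 :: real)"
      by (simp add: prod.distrib[symmetric] prod_uminus)
  qed
  finally show ?thesis by simp
qed

text \<open>Fibres of size 1 give the factor -1, empty fibres the factor 0. A map that is not
  bijective is not surjective, as \<open>{1..k}\<close> is finite, so it misses some
  \<open>u\<close>; this is neither \<open>c\<close> nor \<open>d\<close>, which are images of the
  roots. Hence a factor 0 occurs even if other fibres are large.\<close>

lemma prod_fibres_rooted_map:
  assumes ab: "a \<noteq> b" "a \<in> {1..k}" "b \<in> {1..k}" and cd: "c \<noteq> d" "c \<in> {1..k}" "d \<in> {1..k}"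
    and \<phi>: "\<phi> \<in> rooted_maps k a b c d"
  shows "(\<Prod>u\<in>{1..k} - {c, d}. 1 - 2 ^ card {i\<in>{1..k} - {a, b}. \<phi> i = u} :: real) =
    (if bij_betw \<phi> {1..k} {1..k} then (-1) ^ card ({1..k} - {c, d}) else 0)"
proof (cases "bij_betw \<phi> {1..k} {1..k}")
  case True
  have "card {i\<in>{1..k} - {a, b}. \<phi> i = u} = 1" if u: "u \<in> {1..k} - {c, d}" for u
  proof -
    obtain j where j: "j \<in> {1..k}" "\<phi> j = u" using u True unfolding bij_betw_def by (metis DiffD1 imageE)
    have "{i\<in>{1..k} - {a, b}. \<phi> i = u} = {j}"
    proof (intro set_eqI iffI)
      fix i assume "i \<in> {i\<in>{1..k} - {a, b}. \<phi> i = u}"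
      then show "i \<in> {j}" using bij_betw_imp_inj_on[OF True] j by (auto dest: inj_onD)
    next
      fix i assume "i \<in> {j}"
      then show "i \<in> {i\<in>{1..k} - {a, b}. \<phi> i = u}" using j u \<phi> by (auto simp: rooted_maps_def)
    qed
    then show ?thesis by simp
  qed
  with True show ?thesis by simp
next
  case False
  have maps: "\<phi> ` {1..k} \<subseteq> {1..k}" using \<phi> by (auto simp: rooted_maps_def)
  have "\<phi> ` {1..k} \<noteq> {1..k}"
  proof
    assume "\<phi> ` {1..k} = {1..k}"
    moreover from this have "inj_on \<phi> {1..k}" by (intro eq_card_imp_inj_on) auto
    ultimately show False using False by (simp add: bij_betw_def)
  qed
  with maps obtain u where u: "u \<in> {1..k}" "u \<notin> \<phi> ` {1..k}" by blast
  have "c \<in> \<phi> ` {1..k}" "d \<in> \<phi> ` {1..k}" using \<phi> ab by (auto simp: rooted_maps_def)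
  with u have "u \<in> {1..k} - {c, d}" by auto
  moreover have "{i\<in>{1..k} - {a, b}. \<phi> i = u} = {}" using u by auto
  then have "1 - 2 ^ card {i\<in>{1..k} - {a, b}. \<phi> i = u} = (0 :: real)" by (simp only: card.empty power_0 diff_self)
  ultimately have "(\<Prod>u\<in>{1..k} - {c, d}. 1 - 2 ^ card {i\<in>{1..k} - {a, b}. \<phi> i = u} :: real) = 0"
    by (intro prod_zero bexI[of _ u]) simp_all
  with False show ?thesis by simp
qed

section \<open>From the velocities of step graphons to class sums\<close>

context prob_space
begin

lemma atomless_type_map:
  assumes "atomless M" and "finite I" "I \<noteq> {}" and w: "\<And>i. i \<in> I \<Longrightarrow> w i \<ge> 0" "(\<Sum>i\<in>I. w i) = 1"
  obtains s :: "'a \<Rightarrow> nat" where "s \<in> M \<rightarrow>\<^sub>M count_space UNIV" "\<And>x. x \<in> space M \<Longrightarrow> s x \<in> I"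
    "\<And>i. i \<in> I \<Longrightarrow> prob {x \<in> space M. s x = i} = w i"
proof -
  from atomless_partition[of I "space M" w] assms
  obtain s where s: "\<forall>x\<in>space M. s x \<in> I"
    "\<forall>i\<in>I. {x \<in> space M. s x = i} \<in> sets M \<and> prob {x \<in> space M. s x = i} = w i"
    by (auto simp: prob_space)
  show thesis
  proof (rule that)
    have "s -` {i} \<inter> space M \<in> sets M" for i
    proof (cases "i \<in> I")
      case True
      have "s -` {i} \<inter> space M = {x \<in> space M. s x = i}" by auto
      with s(2) True show ?thesis by simp
    next
      case False
      with s(1) have "s -` {i} \<inter> space M = {}" by auto
      then show ?thesis by simp
    qed
    then show "s \<in> M \<rightarrow>\<^sub>M count_space UNIV" by (simp add: measurable_count_space_eq_countable)
  qed (use s in auto)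
qed

text \<open>The velocities are evaluated at a step graphon modelled on \<open>G\<close>, with parts of measure
  proportional to \<open>n\<close>; the normalisation of \<open>n\<close> cancels because every
  rooted graph on \<open>{1..k}\<close> has the same number of free vertices.\<close>

lemma rooted_map_sum_eq_0:
  assumes at: "atomless M"
    and vel: "\<And>W. is_graphon M W \<Longrightarrow> kernel_eq M (velocity M k R1 W) (velocity M k R2 W)"
    and cd: "c \<noteq> d" "c \<in> {1..k}" "d \<in> {1..k}"
    and n: "\<And>i. i \<in> {1..k} \<Longrightarrow> n i > 0"
  shows "(\<Sum>(F, a, b)\<in>rooted_graphs k. (flip_coeff k R1 (F, a, b) - flip_coeff k R2 (F, a, b)) *
    (\<Sum>\<phi>\<in>rooted_maps k a b c d. (\<Prod>i\<in>{1..k} - {a, b}. n (\<phi> i)) * of_bool (induces k F G \<phi>))) = 0"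
proof -
  define N where "N = (\<Sum>i\<in>{1..k}. n i)"
  have "N > 0" unfolding N_def using n cd by (intro sum_pos) auto
  let ?w = "\<lambda>i. n i / N"
  have "(\<Sum>i\<in>{1..k}. ?w i) = 1" using \<open>N > 0\<close> by (simp add: sum_divide_distrib[symmetric] N_def)
  then obtain s where s: "s \<in> M \<rightarrow>\<^sub>M count_space UNIV" "\<And>x. x \<in> space M \<Longrightarrow> s x \<in> {1..k}"
    "\<And>i. i \<in> {1..k} \<Longrightarrow> prob {x \<in> space M. s x = i} = ?w i"
    using atomless_type_map[OF at, of "{1..k}" ?w] n \<open>N > 0\<close> cd by (auto simp: less_imp_le)
  let ?S = "\<lambda>i. {x \<in> space M. s x = i}" and ?W = "type_kernel s G"
  interpret MM: pair_prob_space M M ..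
  have S: "?S i \<in> sets M" for i using measurable_sets[OF s(1), of "{i}"] by (simp add: vimage_def Int_def conj_commute)
  \<comment> \<open>The velocities agree almost everywhere only. Since \<open>n c\<close> and
    \<open>n d\<close> are positive, the rectangle of parts \<open>c\<close> and \<open>d\<close> is
    not null, so it contains a point of agreement.\<close>
  have "\<exists>x\<in>?S c. \<exists>y\<in>?S d. velocity M k R1 ?W (x, y) = velocity M k R2 ?W (x, y)"
  proof (rule ccontr)
    assume contra: "\<not> ?thesis"
    have "AE p in M \<Otimes>\<^sub>M M. velocity M k R1 ?W p = velocity M k R2 ?W p"
      using vel[OF is_graphon_type_kernel[OF s(1)]] by (simp add: kernel_eq_def)
    then have "AE p in M \<Otimes>\<^sub>M M. p \<notin> ?S c \<times> ?S d"
      by eventually_elim (use contra in auto)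
    then have "?S c \<times> ?S d \<in> null_sets (M \<Otimes>\<^sub>M M)"
      using S by (subst AE_iff_null_sets) auto
    then have "emeasure M (?S c) * emeasure M (?S d) = 0"
      using S by (simp add: null_sets_def emeasure_pair_measure_Times)
    then have "prob (?S c) = 0 \<or> prob (?S d) = 0" by (auto simp: emeasure_eq_measure)
    then show False using s(3)[OF cd(2)] s(3)[OF cd(3)] n[OF cd(2)] n[OF cd(3)] \<open>N > 0\<close> by auto
  qed
  then obtain x y where xy: "x \<in> space M" "s x = c" "y \<in> space M" "s y = d"
    "velocity M k R1 ?W (x, y) = velocity M k R2 ?W (x, y)" by auto
  let ?t = "\<lambda>F a b. \<Sum>\<phi>\<in>rooted_maps k a b c d. (\<Prod>i\<in>{1..k} - {a, b}. n (\<phi> i)) * of_bool (induces k F G \<phi>)"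
  have op: "N ^ (k - 2) * rooted_op M k (F, a, b) ?W (x, y) = ?t F a b" if X: "(F, a, b) \<in> rooted_graphs k" for F a b
  proof -
    note ab = rooted_vertices(2-4)[OF X]
    have "card ({1..k} - {a, b}) = k - 2" using ab by (subst card_Diff_subset) auto
    then have prod: "N ^ (k - 2) * (\<Prod>i\<in>{1..k} - {a, b}. prob (?S (\<phi> i))) = (\<Prod>i\<in>{1..k} - {a, b}. n (\<phi> i))"
      if \<phi>: "\<phi> \<in> rooted_maps k a b c d" for \<phi>
    proof -
      have "(\<Prod>i\<in>{1..k} - {a, b}. prob (?S (\<phi> i))) = (\<Prod>i\<in>{1..k} - {a, b}. n (\<phi> i) / N)"
        using \<phi> by (intro prod.cong refl s(3)) (auto simp: rooted_maps_def)
      with \<open>card ({1..k} - {a, b}) = k - 2\<close> \<open>N > 0\<close> show ?thesis by (simp add: prod_dividef)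
    qed
    have "N ^ (k - 2) * rooted_op M k (F, a, b) ?W (x, y) = (\<Sum>\<phi>\<in>rooted_maps k a b c d.
        N ^ (k - 2) * (\<Prod>i\<in>{1..k} - {a, b}. prob (?S (\<phi> i))) * of_bool (induces k F G \<phi>))"
      by (simp only: rooted_op_type_kernel[OF prob_space_axioms s(1,2) X xy(1,3)] xy(2,4) sum_distrib_left mult.assoc)
    also have "\<dots> = ?t F a b" using prod by (intro sum.cong refl) simp
    finally show ?thesis .
  qed
  have "(\<Sum>X\<in>rooted_graphs k. (flip_coeff k R1 X - flip_coeff k R2 X) * rooted_op M k X ?W (x, y)) = 0"
    using xy(5) by (simp add: velocity_def left_diff_distrib sum_subtractf)
  then have "(\<Sum>X\<in>rooted_graphs k. N ^ (k - 2) * ((flip_coeff k R1 X - flip_coeff k R2 X) * rooted_op M k X ?W (x, y))) = 0"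
    unfolding sum_distrib_left[symmetric] by simp
  moreover have "N ^ (k - 2) * ((flip_coeff k R1 X - flip_coeff k R2 X) * rooted_op M k X ?W (x, y)) =
      (case X of (F, a, b) \<Rightarrow> (flip_coeff k R1 (F, a, b) - flip_coeff k R2 (F, a, b)) * ?t F a b)"
    if "X \<in> rooted_graphs k" for X
  proof -
    obtain F a b where X: "X = (F, a, b)" by (metis surj_pair)
    show ?thesis unfolding X prod.case op[OF that[unfolded X], symmetric] by (simp only: mult_ac)
  qed
  ultimately show ?thesis by simp
qed

text \<open>Part sizes \<open>2\<close> on \<open>S\<close> and \<open>1\<close> elsewhere, summed over all \<open>S\<close> with alternating
  signs, leave only the bijective maps.\<close>

lemma rooted_isos_sum_eq_0:
  assumes at: "atomless M"
    and vel: "\<And>W. is_graphon M W \<Longrightarrow> kernel_eq M (velocity M k R1 W) (velocity M k R2 W)"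
    and Y: "Y \<in> rooted_graphs k"
  shows "(\<Sum>X\<in>rooted_graphs k. (flip_coeff k R1 X - flip_coeff k R2 X) * real (card (rooted_isos k X Y))) = 0"
proof -
  obtain G c d where Y_eq: "Y = (G, c, d)" by (metis surj_pair)
  note cd = rooted_vertices(2-4)[OF Y[unfolded Y_eq]]
  \<comment> \<open>No difference is taken in the sizes of parts \<open>c\<close> and
    \<open>d\<close>: the roots already occupy them, and only the free vertices contribute to the
    monomials.\<close>
  let ?U = "{1..k} - {c, d}"
  let ?n = "\<lambda>S i. if i \<in> S then 2 else 1 :: real"
  let ?q = "\<lambda>X. flip_coeff k R1 X - flip_coeff k R2 X"
  let ?t = "\<lambda>S (F, a, b). \<Sum>\<phi>\<in>rooted_maps k a b c d. (\<Prod>i\<in>{1..k} - {a, b}. ?n S (\<phi> i)) * of_bool (induces k F G \<phi>)"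
  have "(\<Sum>X\<in>rooted_graphs k. ?q X * ?t S X) = 0" for S
    using rooted_map_sum_eq_0[OF at vel cd, of "?n S" G] by (simp add: case_prod_beta)
  then have "0 = (\<Sum>S\<in>Pow ?U. (-1) ^ card S * (\<Sum>X\<in>rooted_graphs k. ?q X * ?t S X))" by simp
  also have "\<dots> = (\<Sum>S\<in>Pow ?U. \<Sum>X\<in>rooted_graphs k. ?q X * ((-1) ^ card S * ?t S X))"
    by (simp only: sum_distrib_left mult.left_commute)
  also have "\<dots> = (\<Sum>X\<in>rooted_graphs k. \<Sum>S\<in>Pow ?U. ?q X * ((-1) ^ card S * ?t S X))"
    by (rule sum.swap)
  also have "\<dots> = (\<Sum>X\<in>rooted_graphs k. ?q X * (\<Sum>S\<in>Pow ?U. (-1) ^ card S * ?t S X))"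
    by (simp only: sum_distrib_left)
  also have "\<dots> = (\<Sum>X\<in>rooted_graphs k. ?q X * ((-1) ^ card ?U * real (card (rooted_isos k X Y))))"
  proof (rule sum.cong[OF refl])
    fix X assume X: "X \<in> rooted_graphs k"
    obtain F a b where X_eq: "X = (F, a, b)" by (metis surj_pair)
    note ab = rooted_vertices(2-4)[OF X[unfolded X_eq]]
    let ?m = "rooted_maps k a b c d" and ?I = "{1..k} - {a, b}"
    have "(\<Sum>S\<in>Pow ?U. (-1) ^ card S * ?t S X) =
        (\<Sum>S\<in>Pow ?U. \<Sum>\<phi>\<in>?m. (-1) ^ card S * (\<Prod>i\<in>?I. ?n S (\<phi> i)) * of_bool (induces k F G \<phi>))"
      by (simp only: X_eq prod.case sum_distrib_left mult.assoc)
    also have "\<dots> = (\<Sum>\<phi>\<in>?m. \<Sum>S\<in>Pow ?U. (-1) ^ card S * (\<Prod>i\<in>?I. ?n S (\<phi> i)) * of_bool (induces k F G \<phi>))"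
      by (rule sum.swap)
    also have "\<dots> = (\<Sum>\<phi>\<in>?m. (\<Prod>u\<in>?U. 1 - 2 ^ card {i\<in>?I. \<phi> i = u}) * of_bool (induces k F G \<phi>))"
      by (simp only: sum_distrib_right[symmetric] sum_Pow_alternating finite_Diff finite_atLeastAtMost)
    also have "\<dots> = (\<Sum>\<phi>\<in>?m. (-1) ^ card ?U * of_bool (\<phi> \<in> rooted_isos k X Y))"
    proof (rule sum.cong[OF refl])
      fix \<phi> assume \<phi>: "\<phi> \<in> ?m"
      show "(\<Prod>u\<in>?U. 1 - 2 ^ card {i\<in>?I. \<phi> i = u}) * of_bool (induces k F G \<phi>) =
          ((-1) ^ card ?U * of_bool (\<phi> \<in> rooted_isos k X Y) :: real)"
        unfolding prod_fibres_rooted_map[OF ab cd \<phi>]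
        using \<phi> by (simp add: rooted_isos_def X_eq Y_eq)
    qed
    also have "\<dots> = (-1) ^ card ?U * real (card (rooted_isos k X Y))"
    proof -
      have "rooted_isos k X Y \<subseteq> ?m" by (auto simp: rooted_isos_def X_eq Y_eq)
      then have "(\<Sum>\<phi>\<in>?m. of_bool (\<phi> \<in> rooted_isos k X Y)) = real (card (rooted_isos k X Y))"
        using finite_rooted_maps by (simp add: of_bool_def sum.If_cases Int_absorb1)
      then show ?thesis by (simp only: sum_distrib_left[symmetric])
    qed
    finally show "?q X * (\<Sum>S\<in>Pow ?U. (-1) ^ card S * ?t S X) = ?q X * ((-1) ^ card ?U * real (card (rooted_isos k X Y)))"
      by simp
  qed
  also have "\<dots> = (-1) ^ card ?U * (\<Sum>X\<in>rooted_graphs k. ?q X * real (card (rooted_isos k X Y)))"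
    by (simp only: sum_distrib_left mult.left_commute)
  finally show ?thesis by simp
qed

text \<open>The number of isomorphisms to \<open>Y\<close> vanishes outside the class of
  \<open>Y\<close> and is constant on it, so the previous identity reduces to the difference of the
  class sums times the number of automorphisms of \<open>Y\<close>. That number is positive, since
  \<open>Y\<close> is isomorphic to itself.\<close>

lemma class_coeff_eq_if_velocity_eq:
  assumes at: "atomless M"
    and vel: "\<And>W. is_graphon M W \<Longrightarrow> kernel_eq M (velocity M k R1 W) (velocity M k R2 W)"
    and J: "J \<in> rooted_classes k"
  shows "class_coeff k R1 J = class_coeff k R2 J"
proof -
  note equiv = equiv_rooted_iso[of k]
  from J obtain Y where Y: "Y \<in> rooted_graphs k" and J_eq: "J = rooted_iso k `` {Y}"
    unfolding rooted_classes_def by (rule quotientE)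
  have J_sub: "J \<subseteq> rooted_graphs k" unfolding J_eq using equiv_type[OF equiv] by blast
  have sym: "(Y, X) \<in> rooted_iso k \<Longrightarrow> (X, Y) \<in> rooted_iso k" for X Y
    using equivE[OF equiv] by (metis symD)
  let ?q = "\<lambda>X. flip_coeff k R1 X - flip_coeff k R2 X"
  have card_J: "card (rooted_isos k X Y) = card (rooted_isos k Y Y)" if "X \<in> J" for X
  proof (rule antisym)
    have "(Y, X) \<in> rooted_iso k" using that J_eq by simp
    then show "card (rooted_isos k X Y) \<le> card (rooted_isos k Y Y)" by (rule card_rooted_isos_le[OF _ Y])
    show "card (rooted_isos k Y Y) \<le> card (rooted_isos k X Y)"
      by (rule card_rooted_isos_le[OF sym Y]) fact
  qed
  have not_J: "card (rooted_isos k X Y) = 0" if "X \<in> rooted_graphs k - J" for X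
    using that rooted_isos_nonempty_iff[of X k Y] Y sym[of X Y] J_eq by auto
  have "(Y, Y) \<in> rooted_iso k" using equiv_class_self[OF equiv Y] by simp
  then have pos: "card (rooted_isos k Y Y) > 0"
    using rooted_isos_nonempty_iff[OF Y Y] finite_rooted_isos by (simp add: card_gt_0_iff)
  have "0 = (\<Sum>X\<in>rooted_graphs k. ?q X * real (card (rooted_isos k X Y)))"
    using rooted_isos_sum_eq_0[OF at vel Y] by simp
  also have "\<dots> = (\<Sum>X\<in>J. ?q X * real (card (rooted_isos k X Y)))"
    using J_sub not_J by (intro sum.mono_neutral_right finite_rooted_graphs) auto
  also have "\<dots> = (\<Sum>X\<in>J. ?q X) * real (card (rooted_isos k Y Y))"
    by (simp add: card_J sum_distrib_right)
  finally have "(\<Sum>X\<in>J. ?q X) = 0" using pos by simp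
  then show ?thesis by (simp add: class_coeff_def sum_subtractf)
qed

end

section \<open>Trajectories\<close>

instance bcontfun :: (metric_space, banach) banach ..

text \<open>The velocity as a map on classes, computed from a chosen representative;
  \<open>lifted_velocity_embed\<close> shows that any kernel of the class gives the same value. Off
  \<open>kernel_space\<close> there is no representative and the value carries no meaning.\<close>

definition lifted_velocity ::
    "'a measure \<Rightarrow> nat \<Rightarrow> rule \<Rightarrow> (('a \<times> 'a) set discrete \<Rightarrow>\<^sub>C real) \<Rightarrow> ('a \<times> 'a) set discrete \<Rightarrow>\<^sub>C real" where
  "lifted_velocity M k R u = Linf_embed (M \<Otimes>\<^sub>M M)
     (velocity M k R (SOME W. is_kernel M W \<and> Linf_embed (M \<Otimes>\<^sub>M M) W = u))"

lemma kernel_spaceI: "is_kernel M W \<Longrightarrow> Linf_embed (M \<Otimes>\<^sub>M M) W \<in> kernel_space M"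
  by (simp add: kernel_space_def)

lemma maximal_trajectory_is_trajectory:
  "is_maximal_trajectory M k R W D \<Phi> \<Longrightarrow> is_trajectory M k R W D \<Phi>"
  by (simp add: is_maximal_trajectory_def)

lemma maximal_trajectory_domain_subset:
  assumes "is_maximal_trajectory M k R W D \<Phi>" "is_trajectory M k R W I \<Psi>"
  shows "I \<subseteq> D"
  using assms(1)[unfolded is_maximal_trajectory_def, THEN conjunct2, rule_format, OF assms(2)] ..

section \<open>Trajectories as solutions in the Banach space\<close>

context prob_space
begin

lemma kernel_eq_iff:
  assumes "is_kernel M U" "is_kernel M W"
  shows "kernel_eq M U W \<longleftrightarrow> Linf_embed (M \<Otimes>\<^sub>M M) U = Linf_embed (M \<Otimes>\<^sub>M M) W"
proof -
  interpret MM: pair_prob_space M M ..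
  show ?thesis
    using MM.Linf_embed_eq_iff[OF assms[THEN kernel_bounded_measurable]] by (simp add: kernel_eq_def)
qed

text \<open>The chosen representative and \<open>W\<close> have the same embedding, so the Lipschitz
  estimate bounds the distance of their velocities by 0.\<close>

lemma lifted_velocity_embed:
  assumes W: "is_kernel M W"
  shows "lifted_velocity M k R (Linf_embed (M \<Otimes>\<^sub>M M) W) = Linf_embed (M \<Otimes>\<^sub>M M) (velocity M k R W)"
proof -
  let ?J = "Linf_embed (M \<Otimes>\<^sub>M M)"
  define U where "U = (SOME U. is_kernel M U \<and> ?J U = ?J W)"
  have U: "is_kernel M U" "?J U = ?J W"
    using someI[of "\<lambda>U. is_kernel M U \<and> ?J U = ?J W" W] W by (simp_all add: U_def)
  obtain L where L: "\<forall>U W'. is_kernel M U \<longrightarrow> is_kernel M W' \<longrightarrow> norm (?J U) \<le> norm (?J W) \<longrightarrow>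
      norm (?J W') \<le> norm (?J W) \<longrightarrow>
      norm (?J (velocity M k R U) - ?J (velocity M k R W')) \<le> L * norm (?J U - ?J W')"
    using velocity_Linf_lipschitz[of "norm (?J W)" k R] ..
  from L[rule_format, OF U(1) W] U(2) show ?thesis by (simp add: lifted_velocity_def U_def[symmetric])
qed

lemma autonomous_ode_kernel_space: "autonomous_ode (kernel_space M) (lifted_velocity M k R)"
proof
  let ?J = "Linf_embed (M \<Otimes>\<^sub>M M)"
  show "subspace (kernel_space M)" "closed (kernel_space M)"
    by (rule subspace_kernel_space closed_kernel_space, rule prob_space_axioms)+
  show "lifted_velocity M k R u \<in> kernel_space M" if "u \<in> kernel_space M" for u
    using that velocity_is_kernel by (auto simp: kernel_space_def lifted_velocity_embed)
  fix C
  obtain L where L: "\<forall>U W. is_kernel M U \<longrightarrow> is_kernel M W \<longrightarrow> norm (?J U) \<le> C \<longrightarrow> norm (?J W) \<le> C \<longrightarrow>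
      norm (?J (velocity M k R U) - ?J (velocity M k R W)) \<le> L * norm (?J U - ?J W)"
    using velocity_Linf_lipschitz[of C k R] ..
  show "\<exists>L. \<forall>u\<in>kernel_space M. \<forall>v\<in>kernel_space M. norm u \<le> C \<longrightarrow> norm v \<le> C \<longrightarrow>
      norm (lifted_velocity M k R u - lifted_velocity M k R v) \<le> L * norm (u - v)"
  proof (intro exI ballI impI)
    fix u v assume "u \<in> kernel_space M" "v \<in> kernel_space M" and le: "norm u \<le> C" "norm v \<le> C"
    then obtain U W where UW: "is_kernel M U" "is_kernel M W" "u = ?J U" "v = ?J W"
      by (auto simp: kernel_space_def)
    show "norm (lifted_velocity M k R u - lifted_velocity M k R v) \<le> L * norm (u - v)"
      using L[rule_format, OF UW(1,2)] le by (simp add: UW lifted_velocity_embed)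
  qed
qed

abbreviation lifted_solution ::
    "nat \<Rightarrow> rule \<Rightarrow> (('a \<times> 'a) set discrete \<Rightarrow>\<^sub>C real) \<Rightarrow> real set \<Rightarrow> (real \<Rightarrow> ('a \<times> 'a) set discrete \<Rightarrow>\<^sub>C real) \<Rightarrow> bool" where
  "lifted_solution k R \<equiv> autonomous_ode.solution (kernel_space M) (lifted_velocity M k R)"

text \<open>On an open \<open>I\<close> all values near a time of \<open>I\<close> are kernels,
  which is what translating the derivative requires. If \<open>I\<close> is not open, lacks 0, or
  some value is not a kernel, both sides fail.\<close>

lemma is_trajectory_iff:
  assumes W: "is_kernel M W"
  shows "is_trajectory M k R W I \<Phi> \<longleftrightarrow> (\<forall>t\<in>I. is_kernel M (\<Phi> t)) \<and>
    lifted_solution k R (Linf_embed (M \<Otimes>\<^sub>M M) W) I (\<lambda>t. Linf_embed (M \<Otimes>\<^sub>M M) (\<Phi> t))"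
proof (cases "open I \<and> 0 \<in> I \<and> (\<forall>t\<in>I. is_kernel M (\<Phi> t))")
  case True
  interpret ode: autonomous_ode "kernel_space M" "lifted_velocity M k R"
    by (rule autonomous_ode_kernel_space)
  have "has_Linf_derivative M \<Phi> (velocity M k R (\<Phi> t)) t \<longleftrightarrow>
      ((\<lambda>s. Linf_embed (M \<Otimes>\<^sub>M M) (\<Phi> s)) has_vector_derivative
        lifted_velocity M k R (Linf_embed (M \<Otimes>\<^sub>M M) (\<Phi> t))) (at t)" if "t \<in> I" for t
  proof -
    have ev: "\<forall>\<^sub>F h in at 0. is_kernel M (\<Phi> (t + h))"
    proof -
      from True that obtain e where "e > 0" "ball t e \<subseteq> I" by (auto simp: open_contains_ball)
      then have "\<forall>h. h \<noteq> 0 \<and> dist h 0 < e \<longrightarrow> is_kernel M (\<Phi> (t + h))"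
        using True by (auto simp: dist_real_def subset_eq)
      with \<open>e > 0\<close> show ?thesis by (auto simp: eventually_at)
    qed
    have "is_kernel M (\<Phi> t)" using True that by blast
    with has_Linf_derivative_iff[OF prob_space_axioms ev this velocity_is_kernel[OF this]]
    show ?thesis by (simp add: lifted_velocity_embed)
  qed
  moreover have "kernel_eq M (\<Phi> 0) W \<longleftrightarrow> Linf_embed (M \<Otimes>\<^sub>M M) (\<Phi> 0) = Linf_embed (M \<Otimes>\<^sub>M M) W"
    using True W by (intro kernel_eq_iff) auto
  moreover have "Linf_embed (M \<Otimes>\<^sub>M M) (\<Phi> t) \<in> kernel_space M" if "t \<in> I" for t
    using True that by (auto simp: kernel_space_def)
  ultimately show ?thesis
    using True by (auto simp: is_trajectory_def ode.solution_def)
next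
  case False
  interpret ode: autonomous_ode "kernel_space M" "lifted_velocity M k R"
    by (rule autonomous_ode_kernel_space)
  from False show ?thesis by (auto simp: is_trajectory_def ode.solution_def)
qed

text \<open>A maximal solution is a family of classes, and a representative is chosen for each time
  separately. No regularity of this choice in \<open>t\<close> is needed, because being a trajectory
  depends on the classes once all values on the domain are kernels.\<close>

lemma maximal_trajectory_exists:
  assumes W: "is_kernel M W"
  obtains D \<Phi> where "is_maximal_trajectory M k R W D \<Phi>"
proof -
  interpret ode: autonomous_ode "kernel_space M" "lifted_velocity M k R"
    by (rule autonomous_ode_kernel_space)
  let ?J = "Linf_embed (M \<Otimes>\<^sub>M M)"
  have "?J W \<in> kernel_space M" using W by (auto simp: kernel_space_def)
  then obtain D \<phi> where \<phi>: "ode.solution (?J W) D \<phi>"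
    and max: "\<And>I \<psi>. ode.solution (?J W) I \<psi> \<Longrightarrow> I \<subseteq> D \<and> (\<forall>t\<in>I. \<psi> t = \<phi> t)"
    using ode.maximal_solution by metis
  have "\<forall>t\<in>D. \<phi> t \<in> kernel_space M" using \<phi> by (simp add: ode.solution_def)
  then have "\<forall>t\<in>D. \<exists>U. is_kernel M U \<and> ?J U = \<phi> t"
    by (simp add: kernel_space_def image_iff Bex_def eq_commute)
  then obtain \<Phi> where \<Phi>: "\<And>t. t \<in> D \<Longrightarrow> is_kernel M (\<Phi> t) \<and> ?J (\<Phi> t) = \<phi> t" by metis
  have "ode.solution (?J W) D (\<lambda>t. ?J (\<Phi> t))"
    unfolding ode.solution_def
  proof (intro conjI ballI)
    show "open D" "is_interval D" "0 \<in> D" using \<phi> by (auto simp: ode.solution_def)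
    then show "?J (\<Phi> 0) = ?J W" using \<Phi>[of 0] \<phi> by (simp add: ode.solution_def)
    fix t assume t: "t \<in> D"
    show "?J (\<Phi> t) \<in> kernel_space M" using kernel_spaceI[of M "\<Phi> t"] \<Phi>[OF t] by simp
    have "(\<phi> has_vector_derivative lifted_velocity M k R (?J (\<Phi> t))) (at t)"
      using \<phi> t \<Phi>[OF t] by (simp add: ode.solution_def)
    then show "((\<lambda>t. ?J (\<Phi> t)) has_vector_derivative lifted_velocity M k R (?J (\<Phi> t))) (at t)"
      by (rule has_vector_derivative_transform_within_open[OF _ \<open>open D\<close> t]) (simp add: \<Phi>)
  qed
  then have "is_trajectory M k R W D \<Phi>" using \<Phi> is_trajectory_iff[OF W] by simp
  moreover have "I \<subseteq> D \<and> (\<forall>t\<in>I. kernel_eq M (\<Psi> t) (\<Phi> t))" if "is_trajectory M k R W I \<Psi>" for I \<Psi>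
  proof -
    have \<Psi>: "\<And>t. t \<in> I \<Longrightarrow> is_kernel M (\<Psi> t)" "ode.solution (?J W) I (\<lambda>t. ?J (\<Psi> t))"
      using that is_trajectory_iff[OF W] by auto
    from max[OF \<Psi>(2)] \<Phi> \<Psi>(1) show ?thesis by (auto simp: kernel_eq_iff subset_eq)
  qed
  ultimately show thesis by (intro that) (auto simp: is_maximal_trajectory_def)
qed

text \<open>This justifies the descriptions behind \<open>traj_domain\<close> and
  \<open>traj\<close>: a maximal trajectory exists, and any two maximal domains contain each
  other.\<close>

lemma traj_is_maximal:
  assumes W: "is_kernel M W"
  shows "is_maximal_trajectory M k R W (traj_domain M k R W) (traj M k R W)"
proof -
  obtain D \<Phi> where D: "is_maximal_trajectory M k R W D \<Phi>" by (rule maximal_trajectory_exists[OF W])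
  have unique: "D' = D" if D': "is_maximal_trajectory M k R W D' \<Phi>'" for D' \<Phi>'
  proof (rule subset_antisym)
    show "D' \<subseteq> D"
      by (rule maximal_trajectory_domain_subset[OF D maximal_trajectory_is_trajectory[OF D']])
    show "D \<subseteq> D'"
      by (rule maximal_trajectory_domain_subset[OF D' maximal_trajectory_is_trajectory[OF D]])
  qed
  have "traj_domain M k R W = D"
    unfolding traj_domain_def
  proof (rule the_equality)
    show "\<exists>\<Phi>. is_maximal_trajectory M k R W D \<Phi>" using D by (rule exI[of _ \<Phi>])
    show "D' = D" if "\<exists>\<Phi>. is_maximal_trajectory M k R W D' \<Phi>" for D' using that unique by (elim exE)
  qed
  with D have "\<exists>\<Phi>. is_maximal_trajectory M k R W (traj_domain M k R W) \<Phi>" by blast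
  from someI_ex[OF this] show ?thesis unfolding traj_def .
qed

lemma trajectory_at_0:
  assumes W: "is_kernel M W" and traj: "is_trajectory M k R W I \<Phi>"
  shows "open I" "0 \<in> I" "((\<lambda>t. Linf_embed (M \<Otimes>\<^sub>M M) (\<Phi> t)) has_vector_derivative
    Linf_embed (M \<Otimes>\<^sub>M M) (velocity M k R W)) (at 0)"
proof -
  interpret ode: autonomous_ode "kernel_space M" "lifted_velocity M k R"
    by (rule autonomous_ode_kernel_space)
  let ?J = "Linf_embed (M \<Otimes>\<^sub>M M)"
  have "ode.solution (?J W) I (\<lambda>t. ?J (\<Phi> t))" using traj is_trajectory_iff[OF W] by simp
  then have I: "open I" "0 \<in> I" "?J (\<Phi> 0) = ?J W"
    and deriv: "\<forall>t\<in>I. ?J (\<Phi> t) \<in> kernel_space M \<and>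
      ((\<lambda>t. ?J (\<Phi> t)) has_vector_derivative lifted_velocity M k R (?J (\<Phi> t))) (at t)"
    by (simp_all add: ode.solution_def)
  show "open I" "0 \<in> I" by fact+
  show "((\<lambda>t. ?J (\<Phi> t)) has_vector_derivative ?J (velocity M k R W)) (at 0)"
    using deriv[rule_format, OF I(2)] unfolding I(3) lifted_velocity_embed[OF W] ..
qed

text \<open>The chosen trajectories of the two rules may be different functions, but their classes
  agree on the open domain. The curves in the Banach space therefore have the same derivative at
  0.\<close>

lemma velocity_eq_if_same_trajectories:
  assumes same: "same_trajectories M k R1 R2" and W: "is_kernel M W"
  shows "kernel_eq M (velocity M k R1 W) (velocity M k R2 W)"
proof -
  let ?J = "Linf_embed (M \<Otimes>\<^sub>M M)"
  let ?D = "traj_domain M k R1 W" and ?\<Phi> = "\<lambda>R. traj M k R W"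
  have D: "traj_domain M k R2 W = ?D"
    and eq: "\<And>t. t \<in> ?D \<Longrightarrow> kernel_eq M (?\<Phi> R1 t) (?\<Phi> R2 t)"
    using same W by (simp_all add: same_trajectories_def)
  note traj1 = maximal_trajectory_is_trajectory[OF traj_is_maximal[OF W, of k R1]]
  note traj2 = maximal_trajectory_is_trajectory[OF traj_is_maximal[OF W, of k R2], unfolded D]
  have "?J (?\<Phi> R1 t) = ?J (?\<Phi> R2 t)" if "t \<in> ?D" for t
  proof -
    have "is_kernel M (?\<Phi> R1 t)" "is_kernel M (?\<Phi> R2 t)"
      using traj1 traj2 that by (simp_all add: is_trajectory_def)
    from kernel_eq_iff[OF this] eq[OF that] show ?thesis by simp
  qed
  from has_vector_derivative_transform_within_open[OF trajectory_at_0(3,1,2)[OF W traj1] this]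
  have "((\<lambda>t. ?J (?\<Phi> R2 t)) has_vector_derivative ?J (velocity M k R1 W)) (at 0)" .
  from vector_derivative_unique_at[OF this trajectory_at_0(3)[OF W traj2]]
  show ?thesis by (simp add: kernel_eq_iff velocity_is_kernel[OF W])
qed

text \<open>The velocities agree up to null sets only, but their lifts are equal on
  \<open>kernel_space\<close>. Hence the two rules have literally the same predicate
  \<open>is_trajectory\<close> for each kernel, and \<open>THE\<close> and \<open>SOME\<close> pick
  the same domain and the same function.\<close>

lemma same_trajectories_if_velocity_eq:
  assumes "\<And>W. is_kernel M W \<Longrightarrow> kernel_eq M (velocity M k R1 W) (velocity M k R2 W)"
  shows "same_trajectories M k R1 R2"
proof -
  have lift: "lifted_velocity M k R1 u = lifted_velocity M k R2 u" if "u \<in> kernel_space M" for u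
  proof -
    from that obtain W where W: "is_kernel M W" "u = Linf_embed (M \<Otimes>\<^sub>M M) W"
      by (auto simp: kernel_space_def)
    with assms[OF W(1)] show ?thesis
      by (simp add: lifted_velocity_embed kernel_eq_iff velocity_is_kernel)
  qed
  have "lifted_solution k R1 u I \<phi> = lifted_solution k R2 u I \<phi>" for u I \<phi>
    unfolding autonomous_ode.solution_def[OF autonomous_ode_kernel_space]
    using lift by (intro conj_cong ball_cong refl) simp
  then have traj: "is_trajectory M k R1 W = is_trajectory M k R2 W" if "is_kernel M W" for W
    by (intro ext) (simp only: is_trajectory_iff[OF that])
  show ?thesis
    unfolding same_trajectories_def
  proof (intro allI impI)
    fix W assume "is_kernel M W"
    from traj[OF this] have "is_maximal_trajectory M k R1 W = is_maximal_trajectory M k R2 W"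
      by (intro ext) (simp only: is_maximal_trajectory_def)
    then have "traj_domain M k R1 W = traj_domain M k R2 W" "traj M k R1 W = traj M k R2 W"
      by (simp_all only: traj_domain_def traj_def)
    then show "traj_domain M k R1 W = traj_domain M k R2 W \<and>
        (\<forall>t\<in>traj_domain M k R1 W. kernel_eq M (traj M k R1 W t) (traj M k R2 W t))"
      by (simp add: kernel_eq_def)
  qed
qed

end

theorem theorem2p3:
  fixes M :: "'a measure" and k :: nat and R1 R2 :: rule
  assumes "prob_space M" and "atomless M" and "separable_sigma_algebra M"
    and "k \<ge> 1" and "is_rule k R1" and "is_rule k R2"
  defines "S1 \<equiv> (\<forall>J\<in>rooted_classes k. class_coeff k R1 J = class_coeff k R2 J)"
    and "S2 \<equiv> (\<forall>W. is_graphon M W \<longrightarrow> kernel_eq M (velocity M k R1 W) (velocity M k R2 W))"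
    and "S3 \<equiv> (\<forall>W. is_kernel M W \<longrightarrow> kernel_eq M (velocity M k R1 W) (velocity M k R2 W))"
    and "S4 \<equiv> same_trajectories M k R1 R2"
  shows "(S1 \<longleftrightarrow> S2) \<and> (S2 \<longleftrightarrow> S3) \<and> (S3 \<longleftrightarrow> S4)"
proof -
  interpret prob_space M by fact
  have S1_S3: "S3" if S1
    unfolding S3_def using velocity_eq_if_class_coeff_eq[OF that[unfolded S1_def]] by blast
  have S3_S2: "S2" if S3
    using that unfolding S2_def S3_def is_graphon_def by blast
  have S2_S1: "S1" if S2
    unfolding S1_def
    using class_coeff_eq_if_velocity_eq[OF assms(2) that[unfolded S2_def, rule_format]] by blast
  have S3_S4: "S4" if S3
    unfolding S4_def by (rule same_trajectories_if_velocity_eq) (use that S3_def in blast)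
  have S4_S3: "S3" if S4
    unfolding S3_def using velocity_eq_if_same_trajectories[OF that[unfolded S4_def]] by blast
  show ?thesis using S1_S3 S3_S2 S2_S1 S3_S4 S4_S3 by blast
qed

end
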